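(* Let $\Omega$ be a smooth bounded domain and $f\in\mathcal{C}(\bar\Omega)$. Then for every $\mu<\Lambda^+$ there exists a unique solution $u\in\mathcal{C}(\mathbb{R}^d)$ to the equation $$\mathbf{I}u+\mu u=f\ \text{in }\Omega,\qquad u=0\ \text{in }\Omega^c.$$
   Context: Fix the dimension $d$, $s\in(0,1)$ and $0<\lambda\le\Lambda$. Let $\mathcal{L}_*$ be the class of all operators $$Lu(x)=\frac12\int_{\mathbb{R}^d}\bigl(u(x+y)+u(x-y)-2u(x)\bigr)\frac{k(y/|y|)}{|y|^{d+2s}}\,dy,$$ where $k\in L^\infty(S^{d-1})$, $\lambda\le k\le\Lambda$ and $k(y)=k(-y)$. Let $\mathcal{L}\subset\mathcal{L}_*$ be a nonempty subclass and $\mathbf{I}u=\sup_{L\in\mathcal{L}}Lu$. A smooth domain is a connected open set in $\mathbb{R}^d$ with smooth boundary. $L^1(\omega)$ is the set of functions integrable with respect to the weight $\omega(y)=(1+|y|)^{-d-2s}$. All (in)equalities are in the viscosity sense: $\mathbf{I}u\ge f$ in $\Omega$ means that whenever $x_0\in\Omega$, $N\subset\Omega$ is a neighbourhood of $x_0$, and $\varphi\in\mathcal{C}^2(\bar N)$ satisfies $\varphi(x_0)=u(x_0)$ and $\varphi>u$ in $N\setminus\{x_0\}$, the function $v$ equal to $\varphi$ in $N$ and $u$ in $N^c$ satisfies $\mathbf{I}v(x_0)\ge f(x_0)$; $\mathbf{I}u\le f$ is defined symmetrically (touching from below, reversed inequality), and $\mathbf{I}u=f$ means both. Define $$\Lambda^+=\sup\{\mu\in\mathbb{R}:\exists\,\psi\in\mathcal{C}(\mathbb{R}^d)\cap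 L^1(\omega),\ \psi\ge0,\ \psi>0\text{ in }\Omega,\ \mathbf{I}\psi+\mu\psi\le0\text{ in }\Omega\}.$$ *)

theory Defs
  imports "HOL-Analysis.Analysis"
begin

text \<open>The space \<open>\<real>\<^sup>d\<close> is a type of class \<open>euclidean_space\<close>, with \<open>d = DIM('a)\<close>.\<close>

section \<open>Regularity of functions and domains\<close>

text \<open>For an open set \<open>N\<close>, the space \<open>C\<^sup>k\<close> of the closure of \<open>N\<close>: the function is \<open>k\<close> times
  continuously differentiable in \<open>N\<close>, and it and its partial derivatives of order at most \<open>k\<close> extend
  continuously to the closure. The partial derivative in direction \<open>b \<in> Basis\<close> is the Frechet
  derivative applied to \<open>b\<close>. For \<open>N = UNIV\<close> this is the usual space of \<open>C\<^sup>k\<close> functions.\<close>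

primrec Ck_closure :: "nat \<Rightarrow> 'a::euclidean_space set \<Rightarrow> ('a \<Rightarrow> real) \<Rightarrow> bool" where
  "Ck_closure 0 N f \<longleftrightarrow> (\<exists>g. continuous_on (closure N) g \<and> (\<forall>x\<in>N. g x = f x))"
| "Ck_closure (Suc k) N f \<longleftrightarrow>
     (\<exists>g. continuous_on (closure N) g \<and> (\<forall>x\<in>N. g x = f x)) \<and>
     (\<forall>x\<in>N. f differentiable (at x)) \<and>
     (\<forall>b\<in>Basis. Ck_closure k N (\<lambda>x. frechet_derivative f (at x) b))"

definition smooth_function :: "('a::euclidean_space \<Rightarrow> real) \<Rightarrow> bool" where
  "smooth_function f \<longleftrightarrow> (\<forall>k. Ck_closure k UNIV f)"

text \<open>Near each boundary point, up to a rotation, the set is the part of the space above the graph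
  of a smooth function of \<open>d - 1\<close> variables. Here \<open>e\<close> is the vertical direction; the function
  \<open>\<gamma>\<close> is only evaluated at the orthogonal projection of \<open>x\<close> to the hyperplane orthogonal
  to \<open>e\<close>.\<close>

definition smooth_boundary :: "'a::euclidean_space set \<Rightarrow> bool" where
  "smooth_boundary \<Omega> \<longleftrightarrow>
     (\<forall>z\<in>frontier \<Omega>. \<exists>r>0. \<exists>e \<gamma>. norm e = 1 \<and> smooth_function \<gamma> \<and>
        \<Omega> \<inter> ball z r = {x \<in> ball z r. x \<bullet> e > \<gamma> (x - (x \<bullet> e) *\<^sub>R e)})"

definition smooth_domain :: "'a::euclidean_space set \<Rightarrow> bool" where
  "smooth_domain \<Omega> \<longleftrightarrow> open \<Omega> \<and> connected \<Omega> \<and> smooth_boundary \<Omega>"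

section \<open>The operators\<close>

text \<open>Surface measure of the unit sphere: the measure of \<open>A\<close> is \<open>d\<close> times the Lebesgue measure of
  the part of the cone over \<open>A\<close> that lies in the unit ball.\<close>

definition surface_measure :: "'a::euclidean_space measure" where
  "surface_measure =
     scale_measure (ennreal (real DIM('a)))
       (distr (restrict_space lborel (ball 0 1 - {0})) (restrict_space borel (sphere 0 1))
          (\<lambda>y. y /\<^sub>R norm y))"

text \<open>As \<open>k\<close> represents an element of \<open>L\<^sup>\<infinity>\<close> of the sphere, the conditions are
  required almost everywhere; essential boundedness follows from the two bounds.\<close>

definition admissible_kernel :: "real \<Rightarrow> real \<Rightarrow> ('a::euclidean_space \<Rightarrow> real) \<Rightarrow> bool" where
  "admissible_kernel lam Lam k \<longleftrightarrow>
     k \<in> borel_measurable surface_measure \<and>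
     (AE \<theta> in surface_measure. lam \<le> k \<theta> \<and> k \<theta> \<le> Lam) \<and>
     (AE \<theta> in surface_measure. k \<theta> = k (- \<theta>))"

definition stable_operator ::
    "real \<Rightarrow> ('a::euclidean_space \<Rightarrow> real) \<Rightarrow> ('a \<Rightarrow> real) \<Rightarrow> 'a \<Rightarrow> real" where
  "stable_operator s k u x =
     1 / 2 * (LINT y|lborel. (u (x + y) + u (x - y) - 2 * u x) *
                (k (y /\<^sub>R norm y) / norm y powr (real DIM('a) + 2 * s)))"

definition L_star :: "real \<Rightarrow> real \<Rightarrow> real \<Rightarrow> (('a::euclidean_space \<Rightarrow> real) \<Rightarrow> 'a \<Rightarrow> real) set" where
  "L_star s lam Lam = {stable_operator s k | k. admissible_kernel lam Lam k}"

text \<open>For a nonempty subclass of \<open>L_star\<close>, and for \<open>u\<close> in the weighted space below that is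
  \<open>C\<^sup>2\<close> near \<open>x\<close>, the supremum is over a nonempty bounded set of reals.\<close>

definition sup_operator ::
    "(('a::euclidean_space \<Rightarrow> real) \<Rightarrow> 'a \<Rightarrow> real) set \<Rightarrow> ('a \<Rightarrow> real) \<Rightarrow> 'a \<Rightarrow> real" where
  "sup_operator \<L> u x = (SUP L\<in>\<L>. L u x)"

definition L1_weight :: "real \<Rightarrow> ('a::euclidean_space \<Rightarrow> real) set" where
  "L1_weight s = {u. integrable lborel (\<lambda>y. u y * (1 + norm y) powr (- real DIM('a) - 2 * s))}"

section \<open>Viscosity inequalities\<close>

text \<open>Neighbourhoods are open, so that \<open>C\<^sup>2\<close> of the closure makes sense. An inequality
  such as \<open>I u + \<mu> u \<ge> f\<close> is the case of right-hand side \<open>f - \<mu> u\<close>.\<close>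

definition visc_ge ::
    "(('a::euclidean_space \<Rightarrow> real) \<Rightarrow> 'a \<Rightarrow> real) \<Rightarrow> 'a set \<Rightarrow> ('a \<Rightarrow> real) \<Rightarrow> ('a \<Rightarrow> real) \<Rightarrow> bool" where
  "visc_ge I \<Omega> u f \<longleftrightarrow>
     (\<forall>x0\<in>\<Omega>. \<forall>N \<phi>. open N \<and> x0 \<in> N \<and> N \<subseteq> \<Omega> \<and> Ck_closure 2 N \<phi> \<and>
        \<phi> x0 = u x0 \<and> (\<forall>x\<in>N - {x0}. \<phi> x > u x) \<longrightarrow>
        I (\<lambda>x. if x \<in> N then \<phi> x else u x) x0 \<ge> f x0)"

definition visc_le ::
    "(('a::euclidean_space \<Rightarrow> real) \<Rightarrow> 'a \<Rightarrow> real) \<Rightarrow> 'a set \<Rightarrow> ('a \<Rightarrow> real) \<Rightarrow> ('a \<Rightarrow> real) \<Rightarrow> bool" where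
  "visc_le I \<Omega> u f \<longleftrightarrow>
     (\<forall>x0\<in>\<Omega>. \<forall>N \<phi>. open N \<and> x0 \<in> N \<and> N \<subseteq> \<Omega> \<and> Ck_closure 2 N \<phi> \<and>
        \<phi> x0 = u x0 \<and> (\<forall>x\<in>N - {x0}. \<phi> x < u x) \<longrightarrow>
        I (\<lambda>x. if x \<in> N then \<phi> x else u x) x0 \<le> f x0)"

definition visc_eq ::
    "(('a::euclidean_space \<Rightarrow> real) \<Rightarrow> 'a \<Rightarrow> real) \<Rightarrow> 'a set \<Rightarrow> ('a \<Rightarrow> real) \<Rightarrow> ('a \<Rightarrow> real) \<Rightarrow> bool" where
  "visc_eq I \<Omega> u f \<longleftrightarrow> visc_ge I \<Omega> u f \<and> visc_le I \<Omega> u f"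

text \<open>The supremum is taken in the extended reals, so no finiteness is presupposed.\<close>

definition Lambda_plus ::
    "real \<Rightarrow> (('a::euclidean_space \<Rightarrow> real) \<Rightarrow> 'a \<Rightarrow> real) set \<Rightarrow> 'a set \<Rightarrow> ereal" where
  "Lambda_plus s \<L> \<Omega> =
     Sup (ereal ` {\<mu>. \<exists>\<psi>. continuous_on UNIV \<psi> \<and> \<psi> \<in> L1_weight s \<and>
                        (\<forall>x. \<psi> x \<ge> 0) \<and> (\<forall>x\<in>\<Omega>. \<psi> x > 0) \<and>
                        visc_le (sup_operator \<L>) \<Omega> \<psi> (\<lambda>x. - \<mu> * \<psi> x)})"

end

theory Submission
  imports Defs
begin

text \<open>The operators commute with translations and are of order below two, so doubling the variables
  with the penalty \<open>n |x - y|\<^sup>2\<close> and shifting both variables by the same vector gives directly that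
  the difference of a subsolution and a supersolution is a subsolution of the difference equation; no
  second-order theory is needed. Since \<open>\<mu> < \<Lambda>\<^sup>+\<close>, a multiple of the function \<open>\<psi>\<close> from the
  definition of \<open>\<Lambda>\<^sup>+\<close>, plus a multiple of a boundary barrier, plus a constant, is a strict
  supersolution \<open>V \<ge> 1\<close>, which yields comparison by looking at the maximum of \<open>(u - v) / V\<close>. The
  barrier is a small power of the distance to the exterior balls of a fixed radius: for a small exponent
  the loss from the jumps into the ball, where the barrier vanishes, dominates everything else. For
  existence, \<open>u\<close> is the supremum of the continuous subsolutions between \<open>- W\<close> and \<open>W\<close>, where the
  supersolution \<open>W\<close> vanishes outside \<open>\<Omega>\<close>. Translating a competitor and lowering it by a small
  multiple of \<open>V\<close> gives another competitor, so \<open>u\<close> inherits the modulus of continuity of \<open>W\<close> and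
  \<open>f\<close>, and Perron's method stays within continuous functions.\<close>

section \<open>Integrability of the jump density\<close>

text \<open>Two obstacles shape the argument. The kernels are merely measurable and bounded in the
  direction, so estimates may use nothing about them but \<open>lam\<close> and \<open>Lam\<close>:
  bounds are taken against \<open>jump_density\<close>, the kernel with \<open>k = 1\<close>, and so
  are uniform over the class. Moreover \<open>\<mu>\<close> may be positive, and then the zero order
  term has the wrong sign for a direct maximum principle; the quotient by a strict supersolution
  \<open>V\<close> repairs this. The function \<open>\<psi>\<close> yields strictness only where it
  is bounded below, since it may tend to zero at the boundary of \<open>\<Omega>\<close>; there the
  barrier takes over. Order below two enters through one fact: the integral of the squared jump
  length over small jumps is small. Once the size \<open>n\<close> of the penalty is fixed, the
  penalty can be tested on so small a ball that its contribution is negligible.\<close>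

definition jump_density :: "real \<Rightarrow> 'a::euclidean_space \<Rightarrow> real" where
  "jump_density s y = 1 / norm y powr (real DIM('a) + 2 * s)"

lemma jump_density_nonneg [simp]: "0 \<le> jump_density s y"
  by (simp add: jump_density_def)

lemma jump_density_measurable [measurable]: "jump_density s \<in> borel_measurable borel"
  unfolding jump_density_def[abs_def] by measurable

lemma jump_density_scale:
  fixes y :: "'a::euclidean_space"
  assumes "t > 0"
  shows "jump_density s (t *\<^sub>R y) = t powr (- real DIM('a) - 2 * s) * jump_density s y"
proof -
  have "t powr (- real DIM('a) - 2 * s) = 1 / t powr (real DIM('a) + 2 * s)"
    using powr_minus_divide[of t "real DIM('a) + 2 * s"] by simp
  then show ?thesis
    using assms by (simp add: jump_density_def powr_mult)
qed

lemma half_powr_less_one: "0 < a \<Longrightarrow> (1/2::real) powr a < 1"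
  using powr_less_mono2[of a "1/2" 1] by simp

text \<open>Stands in for polar coordinates: \<open>F\<close> lies below the sum of
  \<open>q n\<close> times the indicators of the balls of radius \<open>R n\<close>, and the volume
  of such a ball is a fixed multiple of \<open>R n ^ DIM('a)\<close>.\<close>

lemma integrable_layers:
  fixes F :: "'a::euclidean_space \<Rightarrow> real" and q R :: "nat \<Rightarrow> real"
  assumes [measurable]: "F \<in> borel_measurable borel"
    and F0: "\<And>y. 0 \<le> F y" and q0: "\<And>n. 0 \<le> q n" and R0: "\<And>n. 0 \<le> R n"
    and cover: "\<And>y. F y \<noteq> 0 \<Longrightarrow> \<exists>n. norm y \<le> R n \<and> F y \<le> q n"
    and sm: "summable (\<lambda>n. q n * R n ^ DIM('a))"
  shows "integrable lborel F"
proof (rule integrableI_nonneg)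
  let ?w = "unit_ball_vol (DIM('a))"
  have [measurable]: "cball (0::'a) (R n) \<in> sets borel" for n by simp
  have le: "ennreal (F y) \<le> (\<Sum>n. ennreal (q n) * indicator (cball 0 (R n)) y)" for y
  proof (cases "F y = 0")
    case False
    then obtain n where n: "norm y \<le> R n" "F y \<le> q n" using cover by blast
    have "ennreal (F y) \<le> ennreal (q n) * indicator (cball 0 (R n)) y"
      using n by (simp add: ennreal_leI)
    also have "\<dots> = sum (\<lambda>n. ennreal (q n) * indicator (cball 0 (R n)) y) {n}"
      by (subst sum.insert) (auto simp del: sum_mult_indicator)
    also have "\<dots> \<le> (\<Sum>n. ennreal (q n) * indicator (cball 0 (R n)) y)"
      by (rule sum_le_suminf) auto
    finally show ?thesis .
  qed simp
  have "(\<integral>\<^sup>+ y. ennreal (F y) \<partial>lborel)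
      \<le> (\<integral>\<^sup>+ y. (\<Sum>n. ennreal (q n) * indicator (cball 0 (R n)) y) \<partial>(lborel::'a measure))"
    by (rule nn_integral_mono) (rule le)
  also have "\<dots> = (\<Sum>n. \<integral>\<^sup>+ y. ennreal (q n) * indicator (cball 0 (R n)) y \<partial>(lborel::'a measure))"
    by (rule nn_integral_suminf) measurable
  also have "\<dots> = (\<Sum>n. ennreal (?w * (q n * R n ^ DIM('a))))"
    by (intro suminf_cong) 
       (simp add: nn_integral_cmult emeasure_cball R0 q0 ennreal_mult[symmetric] mult_ac)
  also have "\<dots> = ennreal (\<Sum>n. ?w * (q n * R n ^ DIM('a)))"
    by (intro suminf_ennreal2) (use sm q0 R0 in \<open>auto intro!: summable_mult\<close>)
  also have "\<dots> < \<infinity>" by simp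
  finally show "(\<integral>\<^sup>+ y. ennreal (F y) \<partial>lborel) < \<infinity>" .
qed (use F0 in auto)

text \<open>On the dyadic shell of radius 2^-n the integrand is of order 2^(n (d + 2 s - 2)) and the
  volume of order 2^(- n d). The layers form a geometric series of ratio 2^-(2 - 2 s), convergent
  because s < 1.\<close>

lemma integrable_jump_inner:
  assumes s: "0 < s" "s < 1"
  shows "integrable lborel (\<lambda>y::'a::euclidean_space. if norm y \<le> 1 then (norm y)\<^sup>2 * jump_density s y else 0)"
proof (rule integrable_layers[where R = "\<lambda>n. (1/2) ^ n"
      and q = "\<lambda>n. ((1/2) ^ n)\<^sup>2 / ((1/2) ^ Suc n) powr (real DIM('a) + 2 * s)"])
  fix y :: 'a
  assume "(if norm y \<le> 1 then (norm y)\<^sup>2 * jump_density s y else 0) \<noteq> 0"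
  then have y: "norm y \<le> 1" "y \<noteq> 0" by (auto split: if_splits)
  have "\<exists>n. (1/2::real) ^ n < norm y" using y by (intro real_arch_pow_inv) auto
  \<comment> \<open>The least such \<open>n\<close> is positive because
    \<open>norm y \<le> 1\<close>; its predecessor \<open>k\<close> indexes the shell containing
    \<open>y\<close>.\<close>
  then obtain n where n: "(1/2::real) ^ n < norm y" "\<And>m. m < n \<Longrightarrow> \<not> (1/2::real) ^ m < norm y"
    using that[of "LEAST n. (1/2::real) ^ n < norm y"] LeastI_ex[of "\<lambda>n. (1/2::real) ^ n < norm y"] not_less_Least[of _ "\<lambda>n. (1/2::real) ^ n < norm y"] by blast
  have "n \<noteq> 0" using n(1) y by (metis less_le_not_le power_0)
  then obtain k where k: "n = Suc k" by (cases n) auto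
  have yk: "norm y \<le> (1/2) ^ k" using n(2)[of k] k by simp
  have "(norm y)\<^sup>2 * jump_density s y \<le> ((1/2) ^ k)\<^sup>2 * (1 / ((1/2) ^ Suc k) powr (real DIM('a) + 2 * s))"
    unfolding jump_density_def
    using n(1) k yk s by (intro mult_mono power_mono divide_left_mono powr_mono2 mult_pos_pos) auto
  then show "\<exists>n. norm y \<le> (1/2) ^ n \<and>
       (if norm y \<le> 1 then (norm y)\<^sup>2 * jump_density s y else 0)
       \<le> ((1/2) ^ n)\<^sup>2 / ((1/2) ^ Suc n) powr (real DIM('a) + 2 * s)"
    using yk y by (intro exI[of _ k]) auto
next
  have *: "((1/2::real) ^ n)\<^sup>2 / ((1/2) ^ Suc n) powr (real DIM('a) + 2 * s) * ((1/2) ^ n) ^ DIM('a)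
     = 2 powr (real DIM('a) + 2 * s) * ((1/2) powr (2 - 2 * s)) ^ n" for n
  proof -
    have a: "(1/2::real) ^ k = 2 powr (- real k)" for k
      by (simp add: powr_minus_divide powr_realpow power_one_over)
    have b: "(1/2::real) powr (2 - 2 * s) = 2 powr (2 * s - 2)"
      using powr_minus_divide[of 2 "2 - 2 * s"] by (simp add: powr_divide)
    have c: "(2 powr x)^m = (2::real) powr (x * real m)" for x m
      by (simp add: powr_powr flip: powr_realpow)
    show ?thesis
      unfolding b a c powr_powr powr_add[symmetric] powr_diff[symmetric]
      by (rule arg_cong[where f="\<lambda>z. 2 powr z"]) (simp add: algebra_simps)
  qed
  show "summable (\<lambda>n. ((1/2) ^ n)\<^sup>2 / ((1/2) ^ Suc n) powr (real DIM('a) + 2 * s) * ((1/2) ^ n) ^ DIM('a))"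
    unfolding * using s by (intro summable_mult summable_geometric) (simp add: half_powr_less_one)
qed auto

text \<open>The same count outward gives the ratio 2^-s: growth of order s stays below the decay 2 s
  that the kernel has beyond the dimension.\<close>

lemma integrable_jump_outer:
  assumes s: "0 < s" 
  shows "integrable lborel (\<lambda>y::'a::euclidean_space. if 1 < norm y then norm y powr s * jump_density s y else 0)"
proof (rule integrable_layers[where R = "\<lambda>n. 2 ^ Suc n"
      and q = "\<lambda>n. (2 ^ Suc n) powr s / (2 ^ n) powr (real DIM('a) + 2 * s)"])
  fix y :: 'a
  assume "(if 1 < norm y then norm y powr s * jump_density s y else 0) \<noteq> 0"
  then have y: "norm y > 1" by (auto split: if_splits)
  have "\<exists>n. norm y < (2::real) ^ n" using real_arch_pow[of 2 "norm y"] by auto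
  then obtain n where n: "norm y < (2::real) ^ n" "\<And>m. m < n \<Longrightarrow> \<not> norm y < (2::real) ^ m"
    using that[of "LEAST n. norm y < (2::real) ^ n"] LeastI_ex[of "\<lambda>n. norm y < (2::real) ^ n"] not_less_Least[of _ "\<lambda>n. norm y < (2::real) ^ n"] by blast
  have "n \<noteq> 0" using n(1) y by (metis less_le_not_le power_0)
  then obtain k where k: "n = Suc k" by (cases n) auto
  have yk: "2 ^ k \<le> norm y" using n(2)[of k] k by simp
  have "norm y powr s * jump_density s y \<le> (2 ^ Suc k) powr s * (1 / (2 ^ k) powr (real DIM('a) + 2 * s))"
    unfolding jump_density_def
    using n(1) k yk s y by (intro mult_mono divide_left_mono powr_mono2 mult_pos_pos) auto
  then show "\<exists>n. norm y \<le> 2 ^ Suc n \<and>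
       (if 1 < norm y then norm y powr s * jump_density s y else 0)
       \<le> (2 ^ Suc n) powr s / (2 ^ n) powr (real DIM('a) + 2 * s)"
    using n k y by (intro exI[of _ k]) auto
next
  have *: "(2 ^ Suc n) powr s / (2 ^ n) powr (real DIM('a) + 2 * s) * (2 ^ Suc n) ^ DIM('a)
     = 2 powr (real DIM('a) + s) * ((1/2) powr s) ^ n" for n
  proof -
    have a: "(2::real) ^ k = 2 powr (real k)" for k
      by (simp add: powr_realpow)
    have b: "(1/2::real) powr s = 2 powr (- s)"
      using powr_minus_divide[of 2 "s"] by (simp add: powr_divide)
    have c: "(2 powr x)^m = (2::real) powr (x * real m)" for x m
      by (simp add: powr_powr flip: powr_realpow)
    show ?thesis
      unfolding b a c powr_powr powr_add[symmetric] powr_diff[symmetric]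
      by (rule arg_cong[where f="\<lambda>z. 2 powr z"]) (simp add: algebra_simps)
  qed
  show "summable (\<lambda>n. (2 ^ Suc n) powr s / (2 ^ n) powr (real DIM('a) + 2 * s) * (2 ^ Suc n) ^ DIM('a))"
    unfolding * using s by (intro summable_mult summable_geometric) (simp add: half_powr_less_one)
qed auto

text \<open>The weight is quadratic near 0 and grows like \<open>norm y powr s\<close> far out. The
  exponent s is one choice strictly between 0 and 2 s; it leaves room for the barrier exponents
  \<open>a \<le> s\<close>.\<close>

lemma integrable_jump_min:
  assumes s: "0 < s" "s < 1"
  shows "integrable lborel (\<lambda>y::'a::euclidean_space. min ((norm y)\<^sup>2) (norm y powr s) * jump_density s y)"
proof (rule Bochner_Integration.integrable_bound)
  show "integrable lborel (\<lambda>y::'a. (if norm y \<le> 1 then (norm y)\<^sup>2 * jump_density s y else 0)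
     + (if 1 < norm y then norm y powr s * jump_density s y else 0))"
    using integrable_jump_inner[OF s] integrable_jump_outer[OF s(1)] by (rule Bochner_Integration.integrable_add)
  show "AE y in lborel. norm (min ((norm y)\<^sup>2) (norm y powr s) * jump_density s y)
      \<le> norm ((if norm y \<le> 1 then (norm y)\<^sup>2 * jump_density s y else 0)
     + (if 1 < norm (y::'a) then norm y powr s * jump_density s y else 0))"
    by (intro AE_I2) (auto simp: abs_mult intro!: mult_right_mono)
qed measurable

text \<open>Dilation by \<open>t\<close> contributes \<open>t ^ DIM('a)\<close> from the volume and
  \<open>t powr (- real DIM('a) - 2 * s)\<close> from the density. This homogeneity makes the
  barrier estimate a pure power of the distance.\<close>

lemma integral_jump_min_scale:
  assumes t: "t > 0"
  shows "(LINT y::'a::euclidean_space|lborel. min ((norm (y /\<^sub>R t))\<^sup>2) (norm (y /\<^sub>R t) powr s) * jump_density s y)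
    = t powr (- 2 * s) * (LINT y::'a|lborel. min ((norm y)\<^sup>2) (norm y powr s) * jump_density s y)"
    (is "?L = ?R")
  and integrable_jump_min_scale:
    "0 < s \<Longrightarrow> s < 1 \<Longrightarrow> integrable lborel (\<lambda>y::'a. min ((norm (y /\<^sub>R t))\<^sup>2) (norm (y /\<^sub>R t) powr s) * jump_density s y)"
proof -
  let ?f = "\<lambda>y::'a. min ((norm (y /\<^sub>R t))\<^sup>2) (norm (y /\<^sub>R t) powr s) * jump_density s y"
  let ?g = "\<lambda>y::'a. min ((norm y)\<^sup>2) (norm y powr s) * jump_density s y"
  have eq: "(lborel :: 'a measure) = density (distr lborel borel (\<lambda>x. t *\<^sub>R x)) (\<lambda>_. ennreal (t ^ DIM('a)))"
    using lborel_affine[of t "0::'a"] t by simp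
  have fg: "t ^ DIM('a) * ?f (t *\<^sub>R x) = t powr (- 2 * s) * ?g x" for x
  proof -
    have "t ^ DIM('a) * t powr (- real DIM('a) - 2 * s) = t powr (- 2 * s)"
      using t by (simp add: powr_realpow[symmetric] powr_add[symmetric])
    then show ?thesis
      using t by (simp add: jump_density_scale ac_simps)
  qed
  have "?L = (LINT y|density (distr lborel borel (\<lambda>x. t *\<^sub>R x)) (\<lambda>_. ennreal (t ^ DIM('a))). ?f y)"
    by (rule arg_cong[OF eq, where f="\<lambda>M. LINT y|M. ?f y"])
  also have "\<dots> = (LINT y|lborel. t ^ DIM('a) * ?f (t *\<^sub>R y))"
    using t by (subst integral_density) (simp_all add: integral_distr del: norm_scaleR)
  also have "\<dots> = ?R" unfolding fg by simp
  finally show "?L = ?R" .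
  assume s: "0 < s" "s < 1"
  have "integrable (density (distr lborel borel (\<lambda>x::'a. t *\<^sub>R x)) (\<lambda>_. ennreal (t ^ DIM('a)))) ?f
     \<longleftrightarrow> integrable lborel (\<lambda>y. t ^ DIM('a) * ?f (t *\<^sub>R y))"
    using t by (subst integrable_density) (simp_all add: integrable_distr_eq del: norm_scaleR)
  also have "\<dots>" unfolding fg using integrable_jump_min[OF s, where 'a='a] by simp
  finally show "integrable lborel ?f" by (subst eq)
qed

text \<open>The surface measure is read off from the punctured unit ball, so a null set of
  directions gives a null set of points only there. The rest of the space is reached by countably
  many dilations, which preserve null sets.\<close>

lemma AE_surface_measure_cone:
  assumes "AE \<theta> in (surface_measure :: 'a::euclidean_space measure). P \<theta>"
  shows "AE y in lborel. (y::'a) \<noteq> 0 \<longrightarrow> P (y /\<^sub>R norm y)"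
proof -
  let ?B = "ball (0::'a) 1 - {0}"
  let ?f = "\<lambda>y::'a. y /\<^sub>R norm y"
  have meas: "?f \<in> measurable (restrict_space lborel ?B) (restrict_space borel (sphere 0 1))"
    by (intro measurable_restrict_space2)
      (auto simp: space_restrict_space intro!: measurable_restrict_space1)
  have "AE \<theta> in distr (restrict_space lborel ?B) (restrict_space borel (sphere 0 1)) ?f. P \<theta>"
  proof -
    obtain N where N: "{\<theta> \<in> space surface_measure. \<not> P \<theta>} \<subseteq> N" "N \<in> sets surface_measure"
        "emeasure surface_measure N = 0"
      using assms by (auto elim!: AE_E)
    then show ?thesis
      unfolding surface_measure_def
      by (intro AE_I[where N=N]) (auto simp: space_scale_measure)
  qed
  then have "AE y in restrict_space lborel ?B. P (?f y)"
    by (rule AE_distrD[OF meas])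
  then have "AE y in lborel. y \<in> ?B \<longrightarrow> P (?f y)"
    by (subst (asm) AE_restrict_space_iff) auto
  then obtain N where N: "N \<in> null_sets (lborel::'a measure)" "{y. \<not> (y \<in> ?B \<longrightarrow> P (?f y))} \<subseteq> N"
    by (auto elim!: AE_E simp: null_sets_def)
  have null: "AE y in lborel. (1 / real (Suc n)) *\<^sub>R y \<notin> N" for n
  proof -
    let ?c = "real (Suc n)"
    have eq: "(lborel :: 'a measure) = density (distr lborel borel (\<lambda>x. ?c *\<^sub>R x)) (\<lambda>_. ennreal (?c ^ DIM('a)))"
      using lborel_affine[of ?c "0::'a"] by (simp del: of_nat_Suc)
    have [measurable]: "N \<in> sets borel" using N(1) by (auto simp: null_sets_def)
    have "AE y in density (distr lborel borel (\<lambda>x::'a. ?c *\<^sub>R x)) (\<lambda>_. ennreal (?c ^ DIM('a))). (1 / ?c) *\<^sub>R y \<notin> N"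
      using AE_not_in[OF N(1)] by (subst AE_density) (auto simp: AE_distr_iff simp del: of_nat_Suc)
    then show ?thesis by (subst eq)
  qed
  have "AE y in lborel. \<forall>n. (1 / real (Suc n)) *\<^sub>R y \<notin> N"
    using null by (subst AE_all_countable) blast
  then show ?thesis
  proof (eventually_elim, intro impI)
    fix y :: 'a
    assume *: "\<forall>n. (1 / real (Suc n)) *\<^sub>R y \<notin> N" and y: "y \<noteq> 0"
    obtain n where n: "norm y < real (Suc n)"
      by (metis reals_Archimedean2 less_trans lessI of_nat_less_iff)
    let ?z = "(1 / real (Suc n)) *\<^sub>R y"
    have "?z \<in> ?B" using n y by (simp add: field_simps)
    then have "P (?f ?z)" using N(2) *[rule_format, of n] by blast
    also have "?f ?z = ?f y" using y by (simp add: field_simps)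
    finally show "P (?f y)" .
  qed
qed

text \<open>Trades \<open>k\<close> for a Borel kernel on the whole space. Since \<open>k\<close> is
  measurable only on the sphere, the composition is first formed off the origin; division by zero
  gives \<open>K 0 = 0\<close>.\<close>

lemma L_star_kernel:
  fixes L :: "('a::euclidean_space \<Rightarrow> real) \<Rightarrow> 'a \<Rightarrow> real"
  assumes "L \<in> L_star s lam Lam"
  obtains K where "K \<in> borel_measurable borel"
    "AE y in lborel. lam * jump_density s y \<le> K y \<and> K y \<le> Lam * jump_density s y"
    "\<And>u x. L u x = 1 / 2 * (LINT y|lborel. (u (x + y) + u (x - y) - 2 * u x) * K y)"
proof -
  from assms obtain k where L: "L = stable_operator s k" and k: "admissible_kernel lam Lam k"
    by (auto simp: L_star_def)
  define K where "K y = k (y /\<^sub>R norm y) / norm y powr (real DIM('a) + 2 * s)" for y :: 'a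
  have km: "k \<in> borel_measurable (restrict_space borel (sphere 0 1))"
    using k unfolding admissible_kernel_def surface_measure_def
    by (simp add: measurable_cong_sets[of "scale_measure _ _" "restrict_space borel (sphere 0 1)"])
  have "(\<lambda>y::'a. k (y /\<^sub>R norm y)) \<in> borel_measurable (restrict_space borel (- {0}))"
    by (rule measurable_compose[OF _ km], intro measurable_restrict_space2)
      (auto simp: space_restrict_space intro!: measurable_restrict_space1)
  then have [measurable]: "(\<lambda>y::'a. if y \<in> - {0} then k (y /\<^sub>R norm y) else 0) \<in> borel_measurable borel"
    by (subst (asm) measurable_restrict_space_iff[where c=0]) auto
  have "K = (\<lambda>y. (if y \<in> - {0} then k (y /\<^sub>R norm y) else 0) * jump_density s y)"
    by (auto simp: K_def jump_density_def)
  then have m: "K \<in> borel_measurable borel" by (simp only:) measurable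
  have "AE \<theta> in (surface_measure :: 'a measure). lam \<le> k \<theta> \<and> k \<theta> \<le> Lam"
    using k by (auto simp: admissible_kernel_def)
  from AE_surface_measure_cone[OF this]
  have "AE y in lborel. lam * jump_density s y \<le> K y \<and> K y \<le> Lam * jump_density s y"
  proof eventually_elim
    case (elim y)
    show ?case
    proof (cases "y = 0")
      case False
      with elim show ?thesis
        by (auto simp: K_def jump_density_def divide_right_mono)
    qed (simp add: K_def jump_density_def)
  qed
  moreover have "L u x = 1 / 2 * (LINT y|lborel. (u (x + y) + u (x - y) - 2 * u x) * K y)" for u x
    by (simp add: L stable_operator_def K_def)
  ultimately show ?thesis using that m by blast
qed

section \<open>Functions of class \<open>C\<^sup>k\<close>\<close>

definition second_diff :: "('a::real_vector \<Rightarrow> real) \<Rightarrow> 'a \<Rightarrow> 'a \<Rightarrow> real" where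
  "second_diff u x y = u (x + y) + u (x - y) - 2 * u x"

lemma Ck_closure_SucD1:
  "Ck_closure (Suc k) N f \<Longrightarrow> x \<in> N \<Longrightarrow> (f has_derivative frechet_derivative f (at x)) (at x)"
  by (simp only: Ck_closure.simps frechet_derivative_works)

lemma Ck_closure_SucD2:
  "Ck_closure (Suc k) N f \<Longrightarrow> b \<in> Basis \<Longrightarrow> Ck_closure k N (\<lambda>x. frechet_derivative f (at x) b)"
  by (simp only: Ck_closure.simps)

text \<open>Besides restricting, this exchanges \<open>f\<close> for a function that agrees with it
  on \<open>M\<close>; as \<open>M\<close> is open, the derivatives agree as well, so the exchange
  passes through the recursion.\<close>

lemma Ck_closure_subset:
  assumes "Ck_closure k N f" "open M" "M \<subseteq> N" "\<And>x. x \<in> M \<Longrightarrow> f x = g x"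
  shows "Ck_closure k M g"
  using assms
proof (induction k arbitrary: f g)
  case 0
  then obtain h where h: "continuous_on (closure N) h" "\<forall>x\<in>N. h x = f x" by auto
  have "continuous_on (closure M) h"
    using h(1) closure_mono[OF 0(3)] by (rule continuous_on_subset)
  moreover have "\<forall>x\<in>M. h x = g x" using h 0 by auto
  ultimately show ?case by (auto intro: exI[of _ h])
next
  case (Suc k)
  obtain h where h: "continuous_on (closure N) h" "\<forall>x\<in>N. h x = f x" using Suc(2) by auto
  have 1: "continuous_on (closure M) h"
    using h(1) closure_mono[OF Suc(4)] by (rule continuous_on_subset)
  have 2: "\<forall>x\<in>M. h x = g x" using h Suc by auto
  have hd: "(g has_derivative frechet_derivative f (at x)) (at x)" if "x \<in> M" for x
    using that Suc(4) by (intro has_derivative_transform_within_open[OF Ck_closure_SucD1[OF Suc(2)] Suc(3) that])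
      (auto simp: Suc(5))
  have eq: "frechet_derivative g (at x) = frechet_derivative f (at x)" if "x \<in> M" for x
    using frechet_derivative_at[OF hd[OF that]] by simp
  have "Ck_closure k M (\<lambda>x. frechet_derivative g (at x) b)" if "b \<in> Basis" for b
    using Ck_closure_SucD2[OF Suc(2) that] Suc(3,4) by (rule Suc.IH) (simp add: eq)
  moreover have "\<forall>x\<in>M. g differentiable (at x)" using hd by (auto simp: differentiable_def)
  ultimately show ?case
    using 1 2 by (simp only: Ck_closure.simps) (intro conjI exI[of _ h] ballI; simp)
qed

lemma Ck_closure_SucI:
  assumes "open N" and "continuous_on (closure N) g" "\<And>x. x \<in> N \<Longrightarrow> g x = f x"
    and D: "\<And>x. x \<in> N \<Longrightarrow> (f has_derivative D x) (at x)"
    and "\<And>b. b \<in> Basis \<Longrightarrow> Ck_closure k N (\<lambda>x. D x b)"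
  shows "Ck_closure (Suc k) N f"
proof -
  have "Ck_closure k N (\<lambda>x. frechet_derivative f (at x) b)" if "b \<in> Basis" for b
    using assms(5)[OF that] assms(1) order_refl
    by (rule Ck_closure_subset) (metis frechet_derivative_at[OF D])
  moreover have "\<forall>x\<in>N. f differentiable (at x)" using D by (auto simp: differentiable_def)
  ultimately show ?thesis
    using assms(2,3) by (simp only: Ck_closure.simps) (intro conjI exI[of _ g] ballI; simp)
qed

lemma Ck_closure_SucE:
  assumes "Ck_closure (Suc k) N f"
  obtains g where "continuous_on (closure N) g" "\<And>x. x \<in> N \<Longrightarrow> g x = f x"
    "\<And>x. x \<in> N \<Longrightarrow> (f has_derivative frechet_derivative f (at x)) (at x)"
    "\<And>b. b \<in> Basis \<Longrightarrow> Ck_closure k N (\<lambda>x. frechet_derivative f (at x) b)"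
proof -
  have "\<exists>g. continuous_on (closure N) g \<and> (\<forall>x\<in>N. g x = f x)"
    using assms by (simp only: Ck_closure.simps)
  then obtain g where "continuous_on (closure N) g" "\<forall>x\<in>N. g x = f x" by blast
  then show thesis
    by (intro that[of g] Ck_closure_SucD1[OF assms] Ck_closure_SucD2[OF assms]) auto
qed

lemma Ck_closure_0I:
  assumes "continuous_on (closure N) g" "\<And>x. x \<in> N \<Longrightarrow> g x = f x"
  shows "Ck_closure 0 N f"
  using assms by auto

lemma Ck_closure_translate:
  fixes N :: "'a::euclidean_space set"
  assumes "Ck_closure k N f" and N: "open N"
  shows "Ck_closure k ((\<lambda>x. x - h) ` N) (\<lambda>x. f (x + h))"
proof -
  let ?M = "(\<lambda>x. x - h) ` N"
  have M: "?M = (+) (-h) ` N" by (auto simp: image_def)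
  have c: "continuous_on (closure ?M) (\<lambda>x. g (x + h))" if "continuous_on (closure N) g" for g :: "'a \<Rightarrow> real"
    unfolding M closure_translation by (intro continuous_on_compose2[OF that] continuous_intros) auto
  show ?thesis using assms(1)
  proof (induction k arbitrary: f)
    case 0
    then obtain g where "continuous_on (closure N) g" "\<And>x. x \<in> N \<Longrightarrow> g x = f x"
      unfolding Ck_closure.simps by blast
    then show ?case by (intro Ck_closure_0I[OF c[of g]]) auto
  next
    case (Suc k)
    from Suc.prems show ?case
    proof (rule Ck_closure_SucE)
      fix g assume g: "continuous_on (closure N) g" "\<And>x. x \<in> N \<Longrightarrow> g x = f x"
        "\<And>x. x \<in> N \<Longrightarrow> (f has_derivative frechet_derivative f (at x)) (at x)"
        "\<And>b. b \<in> Basis \<Longrightarrow> Ck_closure k N (\<lambda>x. frechet_derivative f (at x) b)"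
      show ?thesis
      proof (rule Ck_closure_SucI[OF _ c[OF g(1)]])
        show "open ?M" unfolding M by (rule open_translation[OF N])
        show "g (x + h) = f (x + h)" if "x \<in> ?M" for x using that g(2) by auto
        show "Ck_closure k ?M (\<lambda>x. frechet_derivative f (at (x + h)) b)" if "b \<in> Basis" for b
          using Suc.IH[OF g(4)[OF that]] .
        show "((\<lambda>x. f (x + h)) has_derivative frechet_derivative f (at (x + h))) (at x)" if "x \<in> ?M" for x
        proof -
          have "(f has_derivative frechet_derivative f (at (x + h))) (at (x + h))"
            using that by (intro g(3)) auto
          then have "(f \<circ> (\<lambda>x. x + h) has_derivative frechet_derivative f (at (x + h)) \<circ> (\<lambda>x. x)) (at x)"
            by (intro diff_chain_at) (auto intro!: derivative_eq_intros)
          then show ?thesis by (simp add: o_def)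
        qed
      qed
    qed
  qed
qed

lemma Ck_closure_add:
  assumes "Ck_closure k N f" "Ck_closure k N g" and N: "open N"
  shows "Ck_closure k N (\<lambda>x. f x + g x)"
  using assms(1,2)
proof (induction k arbitrary: f g)
  case 0
  obtain f' where f: "continuous_on (closure N) f'" "\<And>x. x \<in> N \<Longrightarrow> f' x = f x"
    using 0(1) unfolding Ck_closure.simps by blast
  obtain g' where g: "continuous_on (closure N) g'" "\<And>x. x \<in> N \<Longrightarrow> g' x = g x"
    using 0(2) unfolding Ck_closure.simps by blast
  show ?case
    using f g by (intro Ck_closure_0I[OF continuous_on_add[of _ f' g']]) auto
next
  case (Suc k)
  from Suc.prems(1) show ?case
  proof (rule Ck_closure_SucE)
    fix f' assume f: "continuous_on (closure N) f'" "\<And>x. x \<in> N \<Longrightarrow> f' x = f x"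
        "\<And>x. x \<in> N \<Longrightarrow> (f has_derivative frechet_derivative f (at x)) (at x)"
        "\<And>b. b \<in> Basis \<Longrightarrow> Ck_closure k N (\<lambda>x. frechet_derivative f (at x) b)"
    from Suc.prems(2) show ?thesis
    proof (rule Ck_closure_SucE)
      fix g' assume g: "continuous_on (closure N) g'" "\<And>x. x \<in> N \<Longrightarrow> g' x = g x"
        "\<And>x. x \<in> N \<Longrightarrow> (g has_derivative frechet_derivative g (at x)) (at x)"
        "\<And>b. b \<in> Basis \<Longrightarrow> Ck_closure k N (\<lambda>x. frechet_derivative g (at x) b)"
      show ?thesis
        by (rule Ck_closure_SucI[OF N continuous_on_add[OF f(1) g(1)] _ has_derivative_add[OF f(3) g(3)]])
          (use f g Suc.IH in auto)
    qed
  qed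
qed

lemma Ck_closure_cmult:
  assumes "Ck_closure k N f" and N: "open N"
  shows "Ck_closure k N (\<lambda>x. c * f x)"
  using assms(1)
proof (induction k arbitrary: f)
  case 0
  then obtain g where "continuous_on (closure N) g" "\<And>x. x \<in> N \<Longrightarrow> g x = f x"
    unfolding Ck_closure.simps by blast
  then show ?case by (intro Ck_closure_0I[OF continuous_on_mult_left[of _ g]]) auto
next
  case (Suc k)
  from Suc.prems show ?case
  proof (rule Ck_closure_SucE)
    fix f' assume f: "continuous_on (closure N) f'" "\<And>x. x \<in> N \<Longrightarrow> f' x = f x"
        "\<And>x. x \<in> N \<Longrightarrow> (f has_derivative frechet_derivative f (at x)) (at x)"
        "\<And>b. b \<in> Basis \<Longrightarrow> Ck_closure k N (\<lambda>x. frechet_derivative f (at x) b)"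
    show ?thesis
      by (rule Ck_closure_SucI[OF N continuous_on_mult_left[OF f(1)] _ has_derivative_mult_right[OF f(3)]])
        (use f Suc.IH in auto)
  qed
qed

lemma Ck_closure_const: "open N \<Longrightarrow> Ck_closure k N (\<lambda>x. c)"
proof (induction k arbitrary: c)
  case 0
  show ?case by (rule Ck_closure_0I[of _ "\<lambda>x. c"]) auto
next
  case (Suc k)
  show ?case
    by (rule Ck_closure_SucI[of _ "\<lambda>x. c" _ "\<lambda>x v. 0"]) (auto simp: Suc)
qed

lemma Ck_closure_quadratic:
  fixes a :: "'a::euclidean_space"
  assumes "open N"
  shows "Ck_closure 2 N (\<lambda>x. c * (norm (x - a))\<^sup>2 + e)"
proof -
  have 1: "((\<lambda>x. c * (norm (x - a))\<^sup>2 + e) has_derivative (\<lambda>v. 2 * c * ((x - a) \<bullet> v))) (at x)" for x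
    unfolding power2_norm_eq_inner
    by (rule has_derivative_eq_rhs, (rule derivative_eq_intros refl)+) (auto simp: inner_commute algebra_simps)
  have 2: "((\<lambda>x. 2 * c * ((x - a) \<bullet> b)) has_derivative (\<lambda>v. 2 * c * (v \<bullet> b))) (at x)" for x b
    by (rule has_derivative_eq_rhs, (rule derivative_eq_intros refl)+) auto
  have "Ck_closure (Suc 0) N (\<lambda>x. 2 * c * ((x - a) \<bullet> b))" for b
    by (rule Ck_closure_SucI[OF assms _ refl 2 Ck_closure_const[OF assms]]) (intro continuous_intros)
  then have "Ck_closure (Suc (Suc 0)) N (\<lambda>x. c * (norm (x - a))\<^sup>2 + e)"
    by (intro Ck_closure_SucI[OF assms _ refl 1] continuous_intros)
  then show ?thesis by (simp add: numeral_2_eq_2)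
qed

lemma Ck_closure_continuous_on: "Ck_closure k N f \<Longrightarrow> continuous_on N f"
proof (cases k)
  case 0
  assume "Ck_closure k N f"
  then obtain g where "continuous_on (closure N) g" "\<forall>x\<in>N. g x = f x" using 0 by auto
  then show ?thesis
    by (metis closure_subset continuous_on_cong continuous_on_subset)
next
  case (Suc m)
  assume "Ck_closure k N f"
  then obtain g where "continuous_on (closure N) g" "\<forall>x\<in>N. g x = f x" using Suc by auto
  then show ?thesis
    by (metis closure_subset continuous_on_cong continuous_on_subset)
qed

lemma Ck_closure_bounded:
  fixes N :: "'a::euclidean_space set"
  assumes "Ck_closure k N f" "bounded N"
  obtains B where "\<And>x. x \<in> N \<Longrightarrow> \<bar>f x\<bar> \<le> B"
proof -
  obtain g where g: "continuous_on (closure N) g" "\<forall>x\<in>N. g x = f x"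
    using assms(1) by (cases k) auto
  have "compact (g ` closure N)" using g(1) assms(2) by (intro compact_continuous_image) auto
  then obtain B where "\<forall>x\<in>g ` closure N. norm x \<le> B" using compact_imp_bounded bounded_iff by metis
  then show ?thesis using that[of B] g(2) closure_subset by force
qed

text \<open>Second partial derivatives are continuous, hence bounded on the compact ball; the mean
  value inequality on the convex ball then makes every first partial derivative Lipschitz.\<close>

lemma Ck_closure_gradient_lipschitz:
  fixes f :: "'a::euclidean_space \<Rightarrow> real"
  assumes C2: "Ck_closure 2 N f" and "cball x0 r \<subseteq> N"
  obtains C where "0 \<le> C" "\<And>x y h. x \<in> cball x0 r \<Longrightarrow> y \<in> cball x0 r \<Longrightarrow>
     \<bar>frechet_derivative f (at x) h - frechet_derivative f (at y) h\<bar> \<le> C * norm h * norm (x - y)"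
proof -
  define D where "D b x = frechet_derivative f (at x) b" for b x
  have C2': "Ck_closure (Suc (Suc 0)) N f" using C2 by (simp only: numeral_2_eq_2)
  have c1: "Ck_closure (Suc 0) N (D b)" if "b \<in> Basis" for b
    unfolding D_def using Ck_closure_SucD2[OF C2' that] .
  have d0: "(f has_derivative frechet_derivative f (at x)) (at x)" if "x \<in> N" for x
    using Ck_closure_SucD1[OF C2' that] .
  have d1: "(D b has_derivative frechet_derivative (D b) (at x)) (at x)" if "b \<in> Basis" "x \<in> N" for b x
    using Ck_closure_SucD1[OF c1[OF that(1)] that(2)] .
  have c0: "continuous_on N (\<lambda>x. frechet_derivative (D b) (at x) b')" if "b \<in> Basis" "b' \<in> Basis" for b b'
    using Ck_closure_continuous_on[OF Ck_closure_SucD2[OF c1[OF that(1)] that(2)]] .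
  have "\<exists>M. \<forall>x\<in>cball x0 r. \<bar>frechet_derivative (D b) (at x) b'\<bar> \<le> M" if "b \<in> Basis" "b' \<in> Basis" for b b'
  proof -
    have "compact ((\<lambda>x. frechet_derivative (D b) (at x) b') ` cball x0 r)"
      by (intro compact_continuous_image continuous_on_subset[OF c0[OF that] assms(2)]) auto
    then have "bounded ((\<lambda>x. frechet_derivative (D b) (at x) b') ` cball x0 r)" by (rule compact_imp_bounded)
    then show ?thesis unfolding bounded_iff by simp
  qed
  then have "\<forall>b\<in>Basis. \<forall>b'\<in>Basis. \<exists>M. \<forall>x\<in>cball x0 r. \<bar>frechet_derivative (D b) (at x) b'\<bar> \<le> M"
    by blast
  then obtain M where "\<forall>b\<in>Basis. \<forall>b'\<in>Basis. \<forall>x\<in>cball x0 r. \<bar>frechet_derivative (D b) (at x) b'\<bar> \<le> M b b'"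
    unfolding bchoice_iff by blast
  then have M: "\<bar>frechet_derivative (D b) (at x) b'\<bar> \<le> M b b'"
    if "b \<in> Basis" "b' \<in> Basis" "x \<in> cball x0 r" for b b' x using that by blast
  define B where "B = (\<Sum>b\<in>Basis. \<Sum>b'\<in>Basis. \<bar>M b b'\<bar>)"
  have B: "\<bar>frechet_derivative (D b) (at x) b'\<bar> \<le> B" if "b \<in> Basis" "b' \<in> Basis" "x \<in> cball x0 r" for b b' x
  proof -
    have "\<bar>M b b'\<bar> \<le> (\<Sum>b'\<in>Basis. \<bar>M b b'\<bar>)" using that by (intro member_le_sum) auto
    also have "\<dots> \<le> B" unfolding B_def
      using that member_le_sum[of b Basis "\<lambda>b. \<Sum>b'\<in>Basis. \<bar>M b b'\<bar>"] by (auto simp: sum_nonneg)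
    finally show ?thesis using M[OF that] by simp
  qed
  have B0: "0 \<le> B" unfolding B_def by (intro sum_nonneg) auto
  \<comment> \<open>A linear form bounded by \<open>Q\<close> on the basis is bounded by
    \<open>real DIM('a) * Q\<close> in norm. It is applied once to the derivatives of the partial
    derivatives and once to a difference of gradients.\<close>
  have lin: "\<bar>T h\<bar> \<le> (real DIM('a) * Q) * norm h"
    if T: "linear T" and Q: "\<And>b. b \<in> Basis \<Longrightarrow> \<bar>T b\<bar> \<le> Q" for T :: "'a \<Rightarrow> real" and Q h
  proof -
    have "T h = T (\<Sum>b\<in>Basis. (h \<bullet> b) *\<^sub>R b)" by (simp add: euclidean_representation)
    also have "\<dots> = (\<Sum>b\<in>Basis. (h \<bullet> b) * T b)"
      using T by (simp add: linear_sum linear_cmul)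
    finally have "\<bar>T h\<bar> \<le> (\<Sum>b\<in>Basis. \<bar>(h \<bullet> b) * T b\<bar>)" by (simp add: sum_abs)
    also have "\<dots> \<le> (\<Sum>b\<in>(Basis::'a set). norm h * Q)"
      by (intro sum_mono) (auto simp: abs_mult intro!: mult_mono Q Basis_le_norm)
    finally show ?thesis by (simp add: mult_ac)
  qed
  have Dlip: "\<bar>D b x - D b y\<bar> \<le> (real DIM('a) * B) * norm (x - y)"
    if b: "b \<in> Basis" and xy: "x \<in> cball x0 r" "y \<in> cball x0 r" for b x y
  proof -
    have "norm (D b x - D b y) \<le> (real DIM('a) * B) * norm (x - y)"
    proof (rule differentiable_bound[OF convex_cball _ _ xy])
      fix z assume z: "z \<in> cball x0 r"
      then have hd: "(D b has_derivative frechet_derivative (D b) (at z)) (at z)"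
        using d1[OF b, of z] assms(2) by blast
      then show "(D b has_derivative frechet_derivative (D b) (at z)) (at z within cball x0 r)"
        by (rule has_derivative_at_withinI)
      show "onorm (frechet_derivative (D b) (at z)) \<le> real DIM('a) * B"
        using lin[OF has_derivative_linear[OF hd], of B] B[OF b _ z]
        by (intro onorm_le) auto
    qed
    then show ?thesis by simp
  qed
  show ?thesis
  proof (rule that[of "real DIM('a) * (real DIM('a) * B)"])
    show "0 \<le> real DIM('a) * (real DIM('a) * B)" using B0 by simp
    fix x y h assume xy: "x \<in> cball x0 r" "y \<in> cball x0 r"
    let ?T = "\<lambda>h. frechet_derivative f (at x) h - frechet_derivative f (at y) h"
    have "linear ?T"
      using xy assms(2) by (intro linear_compose_sub has_derivative_linear[OF d0]) auto
    from lin[OF this, of "(real DIM('a) * B) * norm (x - y)" h] Dlip[OF _ xy]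
    show "\<bar>?T h\<bar> \<le> real DIM('a) * (real DIM('a) * B) * norm h * norm (x - y)"
      by (simp add: D_def mult_ac)
  qed
qed

text \<open>The mean value theorem for \<open>f (x + t *\<^sub>R y) + f (x - t *\<^sub>R y)\<close>
  in \<open>t\<close> leaves a difference of gradients at points at distance
  \<open>2 * t * norm y\<close>. The bound is uniform in \<open>x\<close> near \<open>x0\<close>, as
  limits with moving base points require.\<close>

lemma Ck_closure_second_diff:
  fixes f :: "'a::euclidean_space \<Rightarrow> real"
  assumes C2: "Ck_closure 2 N f" and N: "cball x0 r \<subseteq> N"
  obtains C where "0 \<le> C" "\<And>x y. norm (x - x0) + norm y \<le> r \<Longrightarrow> \<bar>second_diff f x y\<bar> \<le> C * (norm y)\<^sup>2"
proof -
  obtain C where C: "0 \<le> C" "\<And>x y h. x \<in> cball x0 r \<Longrightarrow> y \<in> cball x0 r \<Longrightarrow>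
     \<bar>frechet_derivative f (at x) h - frechet_derivative f (at y) h\<bar> \<le> C * norm h * norm (x - y)"
    using Ck_closure_gradient_lipschitz[OF assms] by blast
  show ?thesis
  proof (rule that[of "2 * C"])
    show "0 \<le> 2 * C" using C by simp
    fix x y :: 'a assume xy: "norm (x - x0) + norm y \<le> r"
    have inb: "x + t *\<^sub>R y \<in> cball x0 r" "x - t *\<^sub>R y \<in> cball x0 r" if "0 \<le> t" "t \<le> 1" for t
    proof -
      have "t * norm y \<le> norm y" using that by (simp add: mult_left_le_one_le)
      then have "norm (x - x0 + t *\<^sub>R y) \<le> r" "norm (x - x0 - t *\<^sub>R y) \<le> r"
        using xy norm_triangle_ineq[of "x - x0" "t *\<^sub>R y"] norm_triangle_ineq4[of "x - x0" "t *\<^sub>R y"] that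
        by auto
      moreover have "x + t *\<^sub>R y - x0 = x - x0 + t *\<^sub>R y" "x - t *\<^sub>R y - x0 = x - x0 - t *\<^sub>R y"
        by simp_all
      ultimately show "x + t *\<^sub>R y \<in> cball x0 r" "x - t *\<^sub>R y \<in> cball x0 r"
        by (simp_all only: mem_cball dist_norm norm_minus_commute[of x0])
    qed
    have fd: "(f has_derivative frechet_derivative f (at z)) (at z)" if "z \<in> cball x0 r" for z
      using Ck_closure_SucD1[OF C2[unfolded numeral_2_eq_2], of z] N that by blast
    let ?F = "\<lambda>t. f (x + t *\<^sub>R y) + f (x - t *\<^sub>R y)"
    let ?F' = "\<lambda>t. frechet_derivative f (at (x + t *\<^sub>R y)) y - frechet_derivative f (at (x - t *\<^sub>R y)) y"
    have der: "(?F has_real_derivative ?F' t) (at t)" if t: "0 \<le> t" "t \<le> 1" for t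
    proof -
      let ?D1 = "frechet_derivative f (at (x + t *\<^sub>R y))" and ?D2 = "frechet_derivative f (at (x - t *\<^sub>R y))"
      have "(f \<circ> (\<lambda>t. x + t *\<^sub>R y) has_derivative ?D1 \<circ> (\<lambda>h. h *\<^sub>R y)) (at t)"
        by (intro diff_chain_at fd inb t) (auto intro!: derivative_eq_intros)
      moreover have "(f \<circ> (\<lambda>t. x - t *\<^sub>R y) has_derivative ?D2 \<circ> (\<lambda>h. - (h *\<^sub>R y))) (at t)"
        by (intro diff_chain_at fd inb t) (auto intro!: derivative_eq_intros)
      ultimately have "((\<lambda>t. (f \<circ> (\<lambda>t. x + t *\<^sub>R y)) t + (f \<circ> (\<lambda>t. x - t *\<^sub>R y)) t) has_derivative
          (\<lambda>h. (?D1 \<circ> (\<lambda>h. h *\<^sub>R y)) h + (?D2 \<circ> (\<lambda>h. - (h *\<^sub>R y))) h)) (at t)"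
        by (rule has_derivative_add)
      moreover have "linear ?D1" "linear ?D2"
        using fd[OF inb(1)[OF t]] fd[OF inb(2)[OF t]] by (auto dest: has_derivative_linear)
      ultimately have "((\<lambda>t. f (x + t *\<^sub>R y) + f (x - t *\<^sub>R y)) has_derivative
          (\<lambda>h. h * ?D1 y - h * ?D2 y)) (at t)"
        by (simp add: o_def linear_cmul linear_neg)
      moreover have "(\<lambda>h. h * ?D1 y - h * ?D2 y) = (*) (?D1 y - ?D2 y)"
        by (auto simp: algebra_simps)
      ultimately show ?thesis
        by (simp add: has_field_derivative_def)
    qed
    obtain t where t: "0 < t" "t < 1" "?F 1 - ?F 0 = (1 - 0) * ?F' t"
      using MVT2[of 0 1 ?F ?F'] der zero_less_one by blast
    have "\<bar>?F' t\<bar> \<le> C * norm y * norm ((x + t *\<^sub>R y) - (x - t *\<^sub>R y))"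
      by (rule C(2); rule inb) (use t in simp_all)
    also have "(x + t *\<^sub>R y) - (x - t *\<^sub>R y) = t *\<^sub>R y + t *\<^sub>R y" by simp
    also have "\<dots> = (2 * t) *\<^sub>R y" using scaleR_left_distrib[of t t y] mult_2[of t] by metis
    also have "C * norm y * norm ((2 * t) *\<^sub>R y) = 2 * C * (norm y)\<^sup>2 * t"
      using t by (simp add: power2_eq_square)
    also have "\<dots> \<le> 2 * C * (norm y)\<^sup>2 * 1"
      using t C by (intro mult_left_mono) auto
    finally have "\<bar>?F' t\<bar> \<le> 2 * C * (norm y)\<^sup>2" by simp
    then show "\<bar>second_diff f x y\<bar> \<le> 2 * C * (norm y)\<^sup>2"
      using t by (simp add: second_diff_def)
  qed
qed

section \<open>The operators at a point\<close>

text \<open>A Bochner integral defaults to 0 without integrability and a supremum of an unbounded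
  set of reals is unspecified, so this condition accompanies comparisons of operator values.
  Integrability against \<open>jump_density\<close> gives it for all operators of the class at
  once.\<close>

definition jump_integrable :: "real \<Rightarrow> ('a::euclidean_space \<Rightarrow> real) \<Rightarrow> 'a \<Rightarrow> bool" where
  "jump_integrable s u x \<longleftrightarrow> integrable lborel (\<lambda>y. second_diff u x y * jump_density s y)"

definition patch :: "'a set \<Rightarrow> ('a \<Rightarrow> real) \<Rightarrow> ('a \<Rightarrow> real) \<Rightarrow> 'a \<Rightarrow> real" where
  "patch N \<phi> u = (\<lambda>x. if x \<in> N then \<phi> x else u x)"

lemma second_diff_0 [simp]: "second_diff u x 0 = 0"
  by (simp add: second_diff_def)

lemma second_diff_measurable [measurable]:
  fixes u :: "'a::euclidean_space \<Rightarrow> real"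
  assumes [measurable]: "u \<in> borel_measurable borel"
  shows "second_diff u x \<in> borel_measurable borel"
  unfolding second_diff_def[abs_def] by measurable

lemma lborel_distr_uminus':
  "distr lborel borel uminus = (lborel :: 'a::euclidean_space measure)"
  by (subst (2) lborel_affine[of "-1" 0]) (auto simp: density_1 one_ennreal_def[symmetric])

lemma integrable_lborel_reflect:
  fixes f :: "'a::euclidean_space \<Rightarrow> real"
  assumes "integrable lborel f"
  shows "integrable lborel (\<lambda>y. f (- y))"
proof -
  have "integrable (distr lborel borel uminus) f" using assms by (simp add: lborel_distr_uminus')
  then show ?thesis by (subst (asm) integrable_distr_eq) (use assms in auto)
qed

lemma jump_density_minus [simp]: "jump_density s (- y) = jump_density s y"
  by (simp add: jump_density_def)

locale stable_order =
  fixes s :: real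
  assumes s: "0 < s" "s < 1"
begin

lemma integrable_jump_far:
  assumes r: "0 < r"
  shows "integrable lborel (\<lambda>y::'a::euclidean_space. if norm y < r then 0 else jump_density s y)"
proof (rule Bochner_Integration.integrable_bound)
  let ?m = "min (r\<^sup>2) (r powr s)"
  show "integrable lborel (\<lambda>y::'a. (min ((norm y)\<^sup>2) (norm y powr s) * jump_density s y) / ?m)"
    using integrable_jump_min[OF s, where 'a='a] by simp
  have m: "?m > 0" using r by simp
  show "AE y::'a in lborel. norm (if norm y < r then 0 else jump_density s y) \<le>
      norm ((min ((norm y)\<^sup>2) (norm y powr s) * jump_density s y) / ?m)"
  proof (intro AE_I2)
    fix y :: 'a
    show "norm (if norm y < r then 0 else jump_density s y) \<le>
      norm ((min ((norm y)\<^sup>2) (norm y powr s) * jump_density s y) / ?m)"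
    proof (cases "norm y < r")
      case False
      then have "?m \<le> min ((norm y)\<^sup>2) (norm y powr s)"
        using r s by (intro min.mono power_mono powr_mono2) auto
      then have "?m * jump_density s y \<le> min ((norm y)\<^sup>2) (norm y powr s) * jump_density s y"
        by (intro mult_right_mono) auto
      then show ?thesis using m False by (simp add: field_simps abs_mult)
    qed simp
  qed
qed measurable

lemma integrable_jump_near:
  "integrable lborel (\<lambda>y::'a::euclidean_space. if norm y < r then (norm y)\<^sup>2 * jump_density s y else 0)"
proof (rule Bochner_Integration.integrable_bound)
  let ?M = "max 1 (r\<^sup>2)"
  show "integrable lborel (\<lambda>y::'a. ?M * (min ((norm y)\<^sup>2) (norm y powr s) * jump_density s y))"
    using integrable_jump_min[OF s, where 'a='a] by simp
  show "AE y::'a in lborel. norm (if norm y < r then (norm y)\<^sup>2 * jump_density s y else 0) \<le>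
      norm (?M * (min ((norm y)\<^sup>2) (norm y powr s) * jump_density s y))"
  proof (intro AE_I2)
    fix y :: 'a
    show "norm (if norm y < r then (norm y)\<^sup>2 * jump_density s y else 0) \<le>
      norm (?M * (min ((norm y)\<^sup>2) (norm y powr s) * jump_density s y))"
    proof (cases "norm y < r")
      case True
      have "(norm y)\<^sup>2 \<le> ?M * min ((norm y)\<^sup>2) (norm y powr s)"
      proof (cases "norm y \<le> 1")
        case True
        have "(norm y)\<^sup>2 \<le> norm y powr s"
        proof (cases "y = 0")
          case False
          then show ?thesis using True s powr_mono'[of s 2 "norm y"] by (simp add: powr_numeral)
        qed simp
        then have "min ((norm y)\<^sup>2) (norm y powr s) = (norm y)\<^sup>2" by simp
        then show ?thesis by (simp add: mult_le_cancel_right1)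
      next
        case F: False
        have "1 \<le> norm y powr s" using F s by (intro ge_one_powr_ge_zero) auto
        moreover have "1 \<le> (norm y)\<^sup>2" using F by simp
        ultimately have 1: "1 \<le> min ((norm y)\<^sup>2) (norm y powr s)" by simp
        have "(norm y)\<^sup>2 \<le> r\<^sup>2" using True by (intro power_mono) auto
        also have "\<dots> \<le> ?M" by simp
        also have "?M \<le> ?M * min ((norm y)\<^sup>2) (norm y powr s)"
          using 1 mult_left_mono[OF 1, of ?M] by simp
        finally show ?thesis .
      qed
      then have "(norm y)\<^sup>2 * jump_density s y \<le> ?M * min ((norm y)\<^sup>2) (norm y powr s) * jump_density s y"
        by (intro mult_right_mono) auto
      then show ?thesis using True by (simp add: abs_mult mult.assoc)
    qed simp
  qed
qed measurable

text \<open>Far away only \<open>u (x + y)\<close> has to be controlled: reflection in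
  \<open>y\<close> gives the other half, and the value at \<open>x\<close> is integrated against the
  tail of the density.\<close>

lemma jump_integrableI:
  fixes u :: "'a::euclidean_space \<Rightarrow> real"
  assumes [measurable]: "u \<in> borel_measurable borel" and r: "0 < r"
    and near: "\<And>y. norm y < r \<Longrightarrow> \<bar>second_diff u x y\<bar> \<le> C * (norm y)\<^sup>2"
    and far: "integrable lborel (\<lambda>y. if norm y < r then 0 else u (x + y) * jump_density s y)"
  shows "jump_integrable s u x"
  unfolding jump_integrable_def
proof (rule Bochner_Integration.integrable_bound)
  let ?F = "\<lambda>y. if norm y < r then 0 else u (x + y) * jump_density s y"
  let ?H = "\<lambda>y. \<bar>C\<bar> * (if norm y < r then (norm y)\<^sup>2 * jump_density s y else 0)
      + (\<bar>?F y\<bar> + \<bar>?F (- y)\<bar> + 2 * \<bar>u x\<bar> * (if norm y < r then 0 else jump_density s y))"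
  show "integrable lborel ?H"
    using far integrable_lborel_reflect[OF far] integrable_jump_near[where 'a='a] integrable_jump_far[OF r, where 'a='a]
    by (intro Bochner_Integration.integrable_add integrable_mult_right integrable_abs) auto
  show "AE y in lborel. norm (second_diff u x y * jump_density s y) \<le> norm (?H y)"
  proof (intro AE_I2)
    fix y
    have H0: "0 \<le> ?H y" by simp
    have "\<bar>second_diff u x y\<bar> * jump_density s y \<le> ?H y"
    proof (cases "norm y < r")
      case True
      have "\<bar>second_diff u x y\<bar> \<le> \<bar>C\<bar> * (norm y)\<^sup>2"
        using near[OF True] mult_right_mono[OF abs_ge_self[of C], of "(norm y)\<^sup>2"] by simp
      then have "\<bar>second_diff u x y\<bar> * jump_density s y \<le> \<bar>C\<bar> * (norm y)\<^sup>2 * jump_density s y"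
        by (intro mult_right_mono) auto
      then show ?thesis using True by (simp add: mult.assoc)
    next
      case False
      have "\<bar>second_diff u x y\<bar> * jump_density s y \<le> (\<bar>u (x + y)\<bar> + \<bar>u (x - y)\<bar> + 2 * \<bar>u x\<bar>) * jump_density s y"
        by (intro mult_right_mono) (auto simp: second_diff_def)
      then show ?thesis using False by (simp add: abs_mult algebra_simps)
    qed
    then show "norm (second_diff u x y * jump_density s y) \<le> norm (?H y)"
      using H0 by (simp add: abs_mult)
  qed
qed measurable

lemma jump_integrable_bounded:
  fixes u :: "'a::euclidean_space \<Rightarrow> real"
  assumes [measurable]: "u \<in> borel_measurable borel" and r: "0 < r"
    and near: "\<And>y. norm y < r \<Longrightarrow> \<bar>second_diff u x y\<bar> \<le> C * (norm y)\<^sup>2"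
    and bd: "\<And>x. \<bar>u x\<bar> \<le> B"
  shows "jump_integrable s u x"
proof (rule jump_integrableI[OF assms(1) r near])
  show "integrable lborel (\<lambda>y. if norm y < r then 0 else u (x + y) * jump_density s y)"
  proof (rule Bochner_Integration.integrable_bound)
    show "integrable lborel (\<lambda>y::'a. B * (if norm y < r then 0 else jump_density s y))"
      using integrable_jump_far[OF r, where 'a='a] by simp
    show "AE y in lborel. norm (if norm y < r then 0 else u (x + y) * jump_density s y)
        \<le> norm (B * (if norm y < r then 0 else jump_density s y))"
    proof (intro AE_I2)
      fix y
      have "\<bar>u (x + y)\<bar> \<le> \<bar>B\<bar>" using bd[of "x + y"] by linarith
      then show "norm (if norm y < r then 0 else u (x + y) * jump_density s y)
        \<le> norm (B * (if norm y < r then 0 else jump_density s y))"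
        by (simp add: abs_mult mult_right_mono)
    qed
  qed measurable
qed auto

end

section \<open>Linear operators of the class and their supremum\<close>

lemma L_star_cmult:
  assumes "L \<in> L_star s lam Lam"
  shows "L (\<lambda>z. c * u z) x = c * L u x"
proof -
  obtain K where K: "\<And>u x. L u x = 1 / 2 * (LINT y|lborel. (u (x + y) + u (x - y) - 2 * u x) * K y)"
    using L_star_kernel[OF assms] by blast
  have eq: "(c * u (x + y) + c * u (x - y) - 2 * (c * u x)) * K y = c * ((u (x + y) + u (x - y) - 2 * u x) * K y)" for y
    by (simp add: algebra_simps)
  show ?thesis unfolding K eq by simp
qed

text \<open>The class is a parameter so that results can also be applied to singletons; statements
  on supersolutions are reduced to single operators in this way.\<close>

locale jump_class = stable_order s for s :: real +
  fixes lam Lam :: real and \<L> :: "(('a::euclidean_space \<Rightarrow> real) \<Rightarrow> 'a \<Rightarrow> real) set"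
  assumes lam: "0 < lam" "lam \<le> Lam"
    and sub: "\<L> \<subseteq> L_star s lam Lam" and ne: "\<L> \<noteq> {}"
begin

abbreviation I :: "('a \<Rightarrow> real) \<Rightarrow> 'a \<Rightarrow> real" where "I \<equiv> sup_operator \<L>"

lemma kernel:
  assumes "L \<in> \<L>"
  obtains K where "AE y in lborel. lam * jump_density s y \<le> K y \<and> K y \<le> Lam * jump_density s y"
    "\<And>u x. jump_integrable s u x \<Longrightarrow> integrable lborel (\<lambda>y. second_diff u x y * K y)"
    "\<And>u x. L u x = 1 / 2 * (LINT y|lborel. second_diff u x y * K y)"
proof -
  have "L \<in> L_star s lam Lam" using assms sub by blast
  from L_star_kernel[OF this] obtain K where
    m [measurable]: "K \<in> borel_measurable borel" and
    b: "AE y in lborel. lam * jump_density s y \<le> K y \<and> K y \<le> Lam * jump_density s y" and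
    e: "\<And>u x. L u x = 1 / 2 * (LINT y|lborel. (u (x + y) + u (x - y) - 2 * u x) * K y)"
    by blast
  have i: "integrable lborel (\<lambda>y. second_diff u x y * K y)" if u: "jump_integrable s u x" for u x
  proof (rule Bochner_Integration.integrable_bound)
    show "integrable lborel (\<lambda>y. Lam * (second_diff u x y * jump_density s y))"
      using u by (simp add: jump_integrable_def)
    have [measurable]: "(\<lambda>y. second_diff u x y * jump_density s y) \<in> borel_measurable borel"
      using borel_measurable_integrable[OF u[unfolded jump_integrable_def]] by simp
    \<comment> \<open>Measurability is known only for the second difference times the density, not
      for \<open>u\<close> itself. Dividing by the density recovers it for the product with
      \<open>K\<close>; at \<open>y = 0\<close> both sides vanish.\<close>
    have "(\<lambda>y. second_diff u x y * K y) = (\<lambda>y. (second_diff u x y * jump_density s y) * (K y / jump_density s y))"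
    proof
      fix y :: 'a
      show "second_diff u x y * K y = (second_diff u x y * jump_density s y) * (K y / jump_density s y)"
        by (cases "y = 0") (auto simp: jump_density_def)
    qed
    also have "\<dots> \<in> borel_measurable lborel" by measurable
    finally show "(\<lambda>y. second_diff u x y * K y) \<in> borel_measurable lborel" .
    show "AE y in lborel. norm (second_diff u x y * K y) \<le> norm (Lam * (second_diff u x y * jump_density s y))"
      using b
    proof eventually_elim
      case (elim y)
      have "0 \<le> lam * jump_density s y" using lam by simp
      then have "\<bar>K y\<bar> \<le> Lam * jump_density s y" using elim by linarith
      then have "\<bar>second_diff u x y\<bar> * \<bar>K y\<bar> \<le> \<bar>second_diff u x y\<bar> * (Lam * jump_density s y)"
        by (intro mult_left_mono) auto
      then show ?case using lam by (simp add: abs_mult ac_simps)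
    qed
  qed
  show thesis using that[OF b i] e by (simp add: second_diff_def)
qed

lemma op_zero:
  assumes "L \<in> \<L>" shows "L (\<lambda>z. c) x = 0"
proof -
  obtain K where K: "\<And>u x. L u x = 1 / 2 * (LINT y|lborel. second_diff u x y * K y)"
    by (rule kernel[OF assms]) (rule that)
  show ?thesis unfolding K by (simp add: second_diff_def)
qed

lemma jump_integrable_const [simp]: "jump_integrable s (\<lambda>z. c) x"
  by (simp add: jump_integrable_def second_diff_def)

text \<open>A bound of Pucci type: what pushes up is weighted by the largest kernel, what pulls down
  by the smallest. The term with \<open>lam\<close> lets the barrier profit from jumps into an
  exterior ball.\<close>

lemma op_upper:
  assumes L: "L \<in> \<L>" and u: "jump_integrable s u x"
    and P: "integrable lborel (\<lambda>y. P y * jump_density s y)" "\<And>y. 0 \<le> P y"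
    and G: "integrable lborel (\<lambda>y. G y * jump_density s y)" "\<And>y. 0 \<le> G y"
    and le: "\<And>y. second_diff u x y \<le> P y - G y"
  shows "L u x \<le> Lam / 2 * (LINT y|lborel. P y * jump_density s y) - lam / 2 * (LINT y|lborel. G y * jump_density s y)"
proof -
  obtain K where K: "AE y in lborel. lam * jump_density s y \<le> K y \<and> K y \<le> Lam * jump_density s y"
    "\<And>u x. jump_integrable s u x \<Longrightarrow> integrable lborel (\<lambda>y. second_diff u x y * K y)"
    "\<And>u x. L u x = 1 / 2 * (LINT y|lborel. second_diff u x y * K y)"
    by (rule kernel[OF L]) (rule that)
  have "(LINT y|lborel. second_diff u x y * K y)
     \<le> (LINT y|lborel. Lam * (P y * jump_density s y) - lam * (G y * jump_density s y))"
  proof (rule integral_mono_AE[OF K(2)[OF u]])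
    show "integrable lborel (\<lambda>y. Lam * (P y * jump_density s y) - lam * (G y * jump_density s y))"
      using P(1) G(1) by (intro Bochner_Integration.integrable_diff integrable_mult_right) auto
    show "AE y in lborel. second_diff u x y * K y \<le> Lam * (P y * jump_density s y) - lam * (G y * jump_density s y)"
      using K(1)
    proof eventually_elim
      case (elim y)
      have "0 \<le> lam * jump_density s y" using lam by simp
      then have "0 \<le> K y" using elim by linarith
      then have "second_diff u x y * K y \<le> (P y - G y) * K y" using le by (intro mult_right_mono)
      also have "\<dots> = P y * K y - G y * K y" by (simp add: algebra_simps)
      also have "\<dots> \<le> P y * (Lam * jump_density s y) - G y * (lam * jump_density s y)"
        using elim P(2) G(2) by (intro diff_mono mult_left_mono) auto
      finally show ?case by (simp add: ac_simps)
    qed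
  qed
  also have "\<dots> = Lam * (LINT y|lborel. P y * jump_density s y) - lam * (LINT y|lborel. G y * jump_density s y)"
    using P(1) G(1) by (subst Bochner_Integration.integral_diff) auto
  finally show ?thesis unfolding K(3) by (simp add: field_simps)
qed

text \<open>One kernel acts on all three functions although the base points differ, because it
  depends on the jump alone. This is what makes doubling of variables possible; \<open>P\<close>
  collects the errors.\<close>

lemma op_add_le:
  assumes L: "L \<in> \<L>" and int: "jump_integrable s U x" "jump_integrable s W x'" "jump_integrable s w x''"
    and P: "integrable lborel (\<lambda>y. P y * jump_density s y)" "\<And>y. 0 \<le> P y"
    and le: "\<And>y. second_diff U x y \<le> second_diff W x' y + second_diff w x'' y + P y"
  shows "L U x \<le> L W x' + L w x'' + Lam / 2 * (LINT y|lborel. P y * jump_density s y)"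
proof -
  obtain K where K: "AE y in lborel. lam * jump_density s y \<le> K y \<and> K y \<le> Lam * jump_density s y"
    "\<And>u x. jump_integrable s u x \<Longrightarrow> integrable lborel (\<lambda>y. second_diff u x y * K y)"
    "\<And>u x. L u x = 1 / 2 * (LINT y|lborel. second_diff u x y * K y)"
    by (rule kernel[OF L]) (rule that)
  note i = K(2)[OF int(1)] K(2)[OF int(2)] K(2)[OF int(3)]
  have "(LINT y|lborel. second_diff U x y * K y)
     \<le> (LINT y|lborel. second_diff W x' y * K y + second_diff w x'' y * K y + Lam * (P y * jump_density s y))"
  proof (rule integral_mono_AE[OF i(1)])
    show "integrable lborel (\<lambda>y. second_diff W x' y * K y + second_diff w x'' y * K y + Lam * (P y * jump_density s y))"
      using P(1) i by (intro Bochner_Integration.integrable_add integrable_mult_right) auto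
    show "AE y in lborel. second_diff U x y * K y
        \<le> second_diff W x' y * K y + second_diff w x'' y * K y + Lam * (P y * jump_density s y)"
      using K(1)
    proof eventually_elim
      case (elim y)
      have "0 \<le> lam * jump_density s y" using lam by simp
      then have "0 \<le> K y" using elim by linarith
      then have "second_diff U x y * K y \<le> (second_diff W x' y + second_diff w x'' y + P y) * K y"
        using le by (intro mult_right_mono)
      also have "\<dots> = second_diff W x' y * K y + second_diff w x'' y * K y + P y * K y" by (simp add: algebra_simps)
      also have "P y * K y \<le> P y * (Lam * jump_density s y)"
        using elim P(2) by (intro mult_left_mono) auto
      finally show ?case by (simp add: ac_simps)
    qed
  qed
  also have "\<dots> = (LINT y|lborel. second_diff W x' y * K y) + (LINT y|lborel. second_diff w x'' y * K y)
      + Lam * (LINT y|lborel. P y * jump_density s y)"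
    using P(1) i by (simp add: Bochner_Integration.integral_add)
  finally show ?thesis unfolding K(3) by (simp add: field_simps)
qed

lemma op_close:
  assumes L: "L \<in> \<L>" and int: "jump_integrable s U x" "jump_integrable s W x'"
    and P: "integrable lborel (\<lambda>y. P y * jump_density s y)" "\<And>y. 0 \<le> P y"
    and le: "\<And>y. second_diff U x y \<le> second_diff W x' y + P y"
  shows "L U x \<le> L W x' + Lam / 2 * (LINT y|lborel. P y * jump_density s y)"
  using op_add_le[OF L int jump_integrable_const[of 0] P, of x] le op_zero[OF L]
  by (simp add: second_diff_def)

lemma op_mono:
  assumes L: "L \<in> \<L>" and int: "jump_integrable s U x" "jump_integrable s W x'"
    and le: "\<And>y. second_diff U x y \<le> second_diff W x' y"
  shows "L U x \<le> L W x'"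
  using op_close[OF L int, of "\<lambda>_. 0"] le by simp

lemma op_cmult: "L \<in> \<L> \<Longrightarrow> L (\<lambda>z. c * u z) x = c * L u x"
  using L_star_cmult sub by blast

lemma op_minus: "L \<in> \<L> \<Longrightarrow> L (\<lambda>z. - u z) x = - L u x"
  using op_cmult[of L "-1" u x] by simp

lemma op_bdd_above:
  assumes u: "jump_integrable s u x"
  shows "bdd_above ((\<lambda>L. L u x) ` \<L>)"
proof (rule bdd_aboveI2)
  fix L assume L: "L \<in> \<L>"
  have "integrable lborel (\<lambda>y. \<bar>second_diff u x y\<bar> * jump_density s y)"
    using integrable_abs[OF u[unfolded jump_integrable_def]] by (simp add: abs_mult)
  from op_close[OF L u jump_integrable_const[of 0] this, of x]
  show "L u x \<le> Lam / 2 * (LINT y|lborel. \<bar>second_diff u x y\<bar> * jump_density s y)"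
    using op_zero[OF L] by (simp add: second_diff_def)
qed

lemma sup_ge: "L \<in> \<L> \<Longrightarrow> jump_integrable s u x \<Longrightarrow> L u x \<le> I u x"
  unfolding sup_operator_def by (intro cSUP_upper op_bdd_above)

lemma sup_le: "(\<And>L. L \<in> \<L> \<Longrightarrow> L u x \<le> c) \<Longrightarrow> I u x \<le> c"
  unfolding sup_operator_def by (intro cSUP_least ne)

lemma sup_approx: "jump_integrable s u x \<Longrightarrow> c < I u x \<Longrightarrow> \<exists>L\<in>\<L>. c < L u x"
  unfolding sup_operator_def using less_cSUP_iff[OF ne op_bdd_above] by blast

lemma sup_close:
  assumes int: "jump_integrable s U x" "jump_integrable s W x'"
    and P: "integrable lborel (\<lambda>y. P y * jump_density s y)" "\<And>y. 0 \<le> P y"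
    and le: "\<And>y. second_diff U x y \<le> second_diff W x' y + P y"
  shows "I U x \<le> I W x' + Lam / 2 * (LINT y|lborel. P y * jump_density s y)"
  using op_close[OF _ int P le] sup_ge[OF _ int(2)] by (intro sup_le) (meson add_right_mono order_trans)

lemma sup_mono:
  assumes int: "jump_integrable s U x" "jump_integrable s W x'"
    and le: "\<And>y. second_diff U x y \<le> second_diff W x' y"
  shows "I U x \<le> I W x'"
  using sup_close[OF int, of "\<lambda>_. 0"] le by simp

end

section \<open>Viscosity inequalities\<close>

definition bounded_continuous :: "('a::euclidean_space \<Rightarrow> real) \<Rightarrow> bool" where
  "bounded_continuous u \<longleftrightarrow> continuous_on UNIV u \<and> (\<exists>B. \<forall>x. \<bar>u x\<bar> \<le> B)"

lemma bounded_continuousI: "continuous_on UNIV u \<Longrightarrow> (\<And>x. \<bar>u x\<bar> \<le> B) \<Longrightarrow> bounded_continuous u"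
  by (auto simp: bounded_continuous_def)

lemma bounded_continuousE:
  assumes "bounded_continuous u"
  obtains B where "0 \<le> B" "\<And>x. \<bar>u x\<bar> \<le> B"
  using assms unfolding bounded_continuous_def by (meson abs_ge_zero order_trans)

lemma bounded_continuous_between:
  assumes "continuous_on UNIV w" "bounded_continuous W" "\<And>x. - W x \<le> w x" "\<And>x. w x \<le> W x"
  shows "bounded_continuous w"
proof -
  obtain B where B: "\<And>x. \<bar>W x\<bar> \<le> B" using bounded_continuousE[OF assms(2)] by metis
  have "\<bar>w x\<bar> \<le> B" for x
    using assms(3,4)[of x] abs_ge_self[of "W x"] B[of x] by (intro abs_leI) linarith+
  with assms(1) show ?thesis by (rule bounded_continuousI)
qed

lemma bounded_continuous_cont: "bounded_continuous u \<Longrightarrow> continuous_on A u"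
  unfolding bounded_continuous_def by (meson continuous_on_subset subset_UNIV)

lemma bounded_continuous_isCont: "bounded_continuous u \<Longrightarrow> isCont u x"
  unfolding bounded_continuous_def by (simp add: continuous_on_eq_continuous_at)

lemma bounded_continuous_measurable: "bounded_continuous u \<Longrightarrow> u \<in> borel_measurable borel"
  unfolding bounded_continuous_def by (auto intro: borel_measurable_continuous_onI)

lemma bounded_continuous_diff:
  assumes u: "bounded_continuous u" and v: "bounded_continuous v"
  shows "bounded_continuous (\<lambda>x. u x - v x)"
proof -
  obtain B B' where B: "\<And>x. \<bar>u x\<bar> \<le> B" "\<And>x. \<bar>v x\<bar> \<le> B'"
    using u v by (metis bounded_continuousE)
  show ?thesis
  proof (rule bounded_continuousI)
    show "continuous_on UNIV (\<lambda>x. u x - v x)"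
      using u v by (intro continuous_on_diff bounded_continuous_cont)
    show "\<bar>u x - v x\<bar> \<le> B + B'" for x
      using B(1)[of x] B(2)[of x] abs_triangle_ineq4[of "u x" "v x"] by linarith
  qed
qed

lemma bounded_continuous_cmult:
  assumes u: "bounded_continuous u"
  shows "bounded_continuous (\<lambda>x. c * u x)"
proof -
  obtain B where B: "\<And>x. \<bar>u x\<bar> \<le> B" using u by (metis bounded_continuousE)
  show ?thesis
  proof (rule bounded_continuousI)
    show "continuous_on UNIV (\<lambda>x. c * u x)"
      using u by (intro continuous_on_mult_left bounded_continuous_cont)
    show "\<bar>c * u x\<bar> \<le> \<bar>c\<bar> * B" for x
      using B[of x] by (simp add: abs_mult mult_left_mono)
  qed
qed

lemma bounded_continuous_uminus: "bounded_continuous u \<Longrightarrow> bounded_continuous (\<lambda>x. - u x)"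
  using bounded_continuous_cmult[of u "-1"] by simp

lemma bounded_continuous_const: "bounded_continuous (\<lambda>x. c)"
  by (rule bounded_continuousI[where B="\<bar>c\<bar>"]) auto

lemma bounded_continuous_add:
  assumes u: "bounded_continuous u" and v: "bounded_continuous v"
  shows "bounded_continuous (\<lambda>x. u x + v x)"
  using bounded_continuous_diff[OF u bounded_continuous_uminus[OF v]] by simp

lemma second_diff_add: "second_diff (\<lambda>z. f z + g z) x y = second_diff f x y + second_diff g x y"
  by (simp add: second_diff_def)

lemma second_diff_quadratic:
  fixes x y a :: "'a::euclidean_space"
  shows "second_diff (\<lambda>z. c * (norm (z - a))\<^sup>2 + e) x y = 2 * c * (norm y)\<^sup>2"
  unfolding second_diff_def power2_norm_eq_inner by (simp add: algebra_simps inner_commute)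

lemma patch_in [simp]: "x \<in> N \<Longrightarrow> patch N \<phi> u x = \<phi> x"
  by (simp add: patch_def)

lemma patch_out [simp]: "x \<notin> N \<Longrightarrow> patch N \<phi> u x = u x"
  by (simp add: patch_def)

lemma second_diff_patch_near:
  assumes "ball x r \<subseteq> N" "norm y < r"
  shows "second_diff (patch N \<phi> u) x y = second_diff \<phi> x y"
proof -
  have r: "0 < r" using assms(2) norm_ge_zero[of y] by linarith
  have "x + y \<in> N" "x - y \<in> N" "x \<in> N"
    using assms r by (auto simp: subset_iff dist_norm)
  then show ?thesis by (simp add: second_diff_def)
qed

lemma second_diff_patch_far:
  assumes "0 < r" "r \<le> norm y"
  shows "second_diff (patch (ball x r) \<phi> u) x y = u (x + y) + u (x - y) - 2 * \<phi> x"
  using assms by (simp add: second_diff_def dist_norm)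

lemma patch_measurable:
  assumes "open N" "continuous_on N \<phi>" "bounded_continuous u"
  shows "patch N \<phi> u \<in> borel_measurable borel"
  unfolding patch_def using assms(1,2) bounded_continuous_cont[OF assms(3)]
  by (intro borel_measurable_continuous_on_if) auto

context stable_order
begin

lemma jump_integrable_patch:
  fixes N :: "'a::euclidean_space set"
  assumes N: "open N" "bounded N" "x \<in> N" and C: "Ck_closure 2 N \<phi>" and u: "bounded_continuous u"
  shows "jump_integrable s (patch N \<phi> u) x"
proof -
  obtain r where r: "r > 0" "cball x r \<subseteq> N"
    using N open_contains_cball_eq by metis
  obtain D where D: "0 \<le> D" "\<And>z y. norm (z - x) + norm y \<le> r \<Longrightarrow> \<bar>second_diff \<phi> z y\<bar> \<le> D * (norm y)\<^sup>2"
    by (rule Ck_closure_second_diff[OF C r(2)]) (rule that)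
  obtain B where B: "\<And>x. x \<in> N \<Longrightarrow> \<bar>\<phi> x\<bar> \<le> B" by (rule Ck_closure_bounded[OF C N(2)]) (rule that)
  obtain B' where B': "0 \<le> B'" "\<And>x. \<bar>u x\<bar> \<le> B'" by (rule bounded_continuousE[OF u]) (rule that)
  show ?thesis
  proof (rule jump_integrable_bounded[OF _ r(1), where B = "\<bar>B\<bar> + B'" and C = D])
    show "patch N \<phi> u \<in> borel_measurable borel"
      using N C u by (intro patch_measurable Ck_closure_continuous_on)
    show "\<bar>patch N \<phi> u x\<bar> \<le> \<bar>B\<bar> + B'" for x
    proof (cases "x \<in> N")
      case True
      then show ?thesis using B[of x] B'(1) abs_ge_self[of B] by simp
    next
      case False
      then show ?thesis using B'(2)[of x] by simp
    qed
    show "\<bar>second_diff (patch N \<phi> u) x y\<bar> \<le> D * (norm y)\<^sup>2" if "norm y < r" for y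
      using D(2)[of x y] that r(2) ball_subset_cball[of x r]
      by (subst second_diff_patch_near[of _ r]) auto
  qed
qed

text \<open>Meant for errors caused by moving base points: quadratic near 0 by the bounds on second
  differences, bounded far out. One radius \<open>r\<close> for all \<open>n\<close> gives an
  integrable majorant.\<close>

lemma jump_dominated_convergence:
  fixes a :: "nat \<Rightarrow> 'a::euclidean_space \<Rightarrow> real"
  assumes r: "0 < r" and m [measurable]: "\<And>n. a n \<in> borel_measurable borel"
    and bd: "\<And>n y. \<bar>a n y\<bar> \<le> C * (if norm y < r then (norm y)\<^sup>2 else 1)"
    and lim: "\<And>y. (\<lambda>n. a n y) \<longlonglongrightarrow> 0"
  shows "(\<lambda>n. LINT y|lborel. \<bar>a n y\<bar> * jump_density s y) \<longlonglongrightarrow> 0"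
    and "integrable lborel (\<lambda>y. \<bar>a n y\<bar> * jump_density s y)"
proof -
  let ?w = "\<lambda>y::'a. C * ((if norm y < r then (norm y)\<^sup>2 * jump_density s y else 0)
      + (if norm y < r then 0 else jump_density s y))"
  have w: "integrable lborel ?w"
    using integrable_jump_near[of r, where 'a='a] integrable_jump_far[OF r, where 'a='a] by simp
  have le: "norm (\<bar>a n y\<bar> * jump_density s y) \<le> ?w y" for n y
    using mult_right_mono[OF bd[of n y] jump_density_nonneg[of s y]]
    by (cases "norm y < r") (auto simp: mult.assoc)
  have 1: "(\<lambda>n. \<bar>a n y\<bar> * jump_density s y) \<longlonglongrightarrow> 0" for y
    by (rule tendsto_mult_left_zero, rule tendsto_rabs_zero, rule lim)
  have "(\<lambda>n. LINT y|lborel. \<bar>a n y\<bar> * jump_density s y) \<longlonglongrightarrow> (LINT y::'a|lborel. 0)"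
    by (rule integral_dominated_convergence[where w="?w"]) (use 1 le w in auto)
  then show "(\<lambda>n. LINT y|lborel. \<bar>a n y\<bar> * jump_density s y) \<longlonglongrightarrow> 0" by simp
  show "integrable lborel (\<lambda>y. \<bar>a n y\<bar> * jump_density s y)"
  proof (rule Bochner_Integration.integrable_bound[OF w])
    show "AE y in lborel. norm (\<bar>a n y\<bar> * jump_density s y) \<le> norm (?w y)"
      using order_trans[OF le abs_ge_self] unfolding real_norm_def by (intro AE_I2)
  qed measurable
qed

text \<open>This is where order below two enters: small jumps carry arbitrarily little of the
  integral of \<open>(norm y)\<^sup>2\<close>, so a quadratic penalty of any fixed size can be made
  negligible.\<close>

lemma jump_near_small:
  assumes "0 < e" "0 < r"
  obtains \<rho> where "0 < \<rho>" "\<rho> < r"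
    "(LINT y::'a::euclidean_space|lborel. (if norm y < \<rho> then (norm y)\<^sup>2 else 0) * jump_density s y) < e"
proof -
  let ?a = "\<lambda>(n::nat) (y::'a). if norm y < r / (real n + 2) then (norm y)\<^sup>2 else 0"
  have "(\<lambda>n. LINT y|lborel. \<bar>?a n y\<bar> * jump_density s y) \<longlonglongrightarrow> 0"
  proof (rule jump_dominated_convergence(1)[OF assms(2), where C=1])
    fix n :: nat and y :: 'a
    have "r / (real n + 2) \<le> r / 1" using assms by (intro divide_left_mono) auto
    then show "\<bar>?a n y\<bar> \<le> 1 * (if norm y < r then (norm y)\<^sup>2 else 1)" by auto
  next
    fix y :: 'a
    show "(\<lambda>n. ?a n y) \<longlonglongrightarrow> 0"
    proof (cases "y = 0")
      case False
      have "(\<lambda>n. r / (real n + 2)) \<longlonglongrightarrow> 0" by real_asymp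
      then have "\<forall>\<^sub>F n in sequentially. r / (real n + 2) < norm y"
        using False by (intro order_tendstoD(2)) auto
      then have "\<forall>\<^sub>F n in sequentially. ?a n y = 0" by eventually_elim auto
      then show ?thesis by (rule tendsto_eventually)
    next
      case True
      then have "?a n y = 0" for n by simp
      then show ?thesis by (simp only: tendsto_const)
    qed
  qed measurable
  then have "\<forall>\<^sub>F n in sequentially. (LINT y|lborel. \<bar>?a n y\<bar> * jump_density s y) < e"
    using assms(1) by (rule order_tendstoD(2))
  then obtain n where n: "(LINT y|lborel. \<bar>?a n y\<bar> * jump_density s y) < e"
    by (auto simp: eventually_sequentially)
  have "(\<lambda>y. \<bar>?a n y\<bar>) = ?a n" by auto
  with n have "(LINT y|lborel. ?a n y * jump_density s y) < e" by metis
  moreover have "0 < r / (real n + 2)" using assms by simp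
  moreover have "r / (real n + 2) < r / 1" using assms by (intro divide_strict_left_mono) auto
  ultimately show thesis using that[of "r / (real n + 2)"] by simp
qed

end

text \<open>Strictness made quantitative: off \<open>ball x0 e\<close> a continuous positive
  function on a compact set has a positive minimum. Approximate touching points thus converge
  without extraction of subsequences.\<close>

lemma strict_minimum_stable:
  fixes h :: "'a::euclidean_space \<Rightarrow> real"
  assumes K: "compact K" and h: "continuous_on K h" and pos: "\<And>x. x \<in> K \<Longrightarrow> x \<noteq> x0 \<Longrightarrow> 0 < h x"
    and e: "0 < e"
  obtains m where "0 < m" "\<And>x. x \<in> K \<Longrightarrow> h x < m \<Longrightarrow> dist x x0 < e"
proof (cases "K - ball x0 e = {}")
  case True
  then show thesis using that[of 1] by (auto simp: dist_commute subset_iff)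
next
  case False
  have "compact (K - ball x0 e)" using K by (intro compact_diff) auto
  then obtain z where z: "z \<in> K - ball x0 e" "\<And>x. x \<in> K - ball x0 e \<Longrightarrow> h z \<le> h x"
    using continuous_attains_inf[OF _ False continuous_on_subset[OF h]] by blast
  show thesis
  proof (rule that[of "h z"])
    show "0 < h z" using z(1) e by (intro pos) auto
    show "dist x x0 < e" if "x \<in> K" "h x < h z" for x
    proof (rule ccontr)
      assume "\<not> dist x x0 < e"
      then have "x \<in> K - ball x0 e" using that(1) by (simp add: dist_commute)
      then show False using z(2)[of x] that(2) by simp
    qed
  qed
qed

context jump_class
begin

lemma singleton: "L \<in> \<L> \<Longrightarrow> jump_class s lam Lam {L}"
  using lam sub by unfold_locales auto

lemma sup_operator_singleton: "sup_operator {L} = (L :: ('a \<Rightarrow> real) \<Rightarrow> 'a \<Rightarrow> real)"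
  by (intro ext) (simp add: sup_operator_def)

lemma visc_patch_ge:
  "visc_ge J \<Omega> u f \<longleftrightarrow>
     (\<forall>x0\<in>\<Omega>. \<forall>N \<phi>. open N \<and> x0 \<in> N \<and> N \<subseteq> \<Omega> \<and> Ck_closure 2 N \<phi> \<and>
        \<phi> x0 = u x0 \<and> (\<forall>x\<in>N - {x0}. \<phi> x > u x) \<longrightarrow> J (patch N \<phi> u) x0 \<ge> f x0)"
  by (simp add: visc_ge_def patch_def)

lemma visc_patch_le:
  "visc_le J \<Omega> u f \<longleftrightarrow>
     (\<forall>x0\<in>\<Omega>. \<forall>N \<phi>. open N \<and> x0 \<in> N \<and> N \<subseteq> \<Omega> \<and> Ck_closure 2 N \<phi> \<and>
        \<phi> x0 = u x0 \<and> (\<forall>x\<in>N - {x0}. \<phi> x < u x) \<longrightarrow> J (patch N \<phi> u) x0 \<le> f x0)"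
  by (simp add: visc_le_def patch_def)

text \<open>A single operator is odd while a supremum need not be, so negation exchanges sub- and
  supersolutions only operator by operator.\<close>

lemma visc_le_neg:
  assumes L: "L \<in> \<L>"
  shows "visc_le L \<Omega> v g \<longleftrightarrow> visc_ge L \<Omega> (\<lambda>x. - v x) (\<lambda>x. - g x)"
proof -
  have neg: "L (patch N (\<lambda>x. - \<phi> x) (\<lambda>x. - w x)) x0 = - L (patch N \<phi> w) x0" for N \<phi> w x0
  proof -
    have "patch N (\<lambda>x. - \<phi> x) (\<lambda>x. - w x) = (\<lambda>x. - patch N \<phi> w x)" by (auto simp: patch_def)
    then show ?thesis using op_minus[OF L] by simp
  qed
  have Cneg: "Ck_closure 2 N (\<lambda>x. - \<phi> x)" if "open N" "Ck_closure 2 N \<phi>" for N and \<phi> :: "'a \<Rightarrow> real"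
    using Ck_closure_cmult[OF that(2,1), of "-1"] by simp
  show ?thesis
  proof
    assume v: "visc_le L \<Omega> v g"
    show "visc_ge L \<Omega> (\<lambda>x. - v x) (\<lambda>x. - g x)"
      unfolding visc_patch_ge
    proof (intro ballI allI impI, elim conjE)
      fix x0 N \<phi> assume *: "x0 \<in> \<Omega>" "open N" "x0 \<in> N" "N \<subseteq> \<Omega>" "Ck_closure 2 N \<phi>" "\<phi> x0 = - v x0"
        "\<forall>x\<in>N - {x0}. - v x < \<phi> x"
      have "\<forall>x\<in>N - {x0}. - \<phi> x < v x" using *(7) by (metis minus_less_iff)
      then have "L (patch N (\<lambda>x. - \<phi> x) v) x0 \<le> g x0"
        using v[unfolded visc_patch_le, rule_format, of x0 N "\<lambda>x. - \<phi> x"] * Cneg[OF *(2,5)] by auto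
      then show "- g x0 \<le> L (patch N \<phi> (\<lambda>x. - v x)) x0"
        using neg[of N "\<lambda>x. - \<phi> x" v x0] by simp
    qed
  next
    assume v: "visc_ge L \<Omega> (\<lambda>x. - v x) (\<lambda>x. - g x)"
    show "visc_le L \<Omega> v g"
      unfolding visc_patch_le
    proof (intro ballI allI impI, elim conjE)
      fix x0 N \<phi> assume *: "x0 \<in> \<Omega>" "open N" "x0 \<in> N" "N \<subseteq> \<Omega>" "Ck_closure 2 N \<phi>" "\<phi> x0 = v x0"
        "\<forall>x\<in>N - {x0}. \<phi> x < v x"
      have "- g x0 \<le> L (patch N (\<lambda>x. - \<phi> x) (\<lambda>x. - v x)) x0"
        using v[unfolded visc_patch_ge, rule_format, of x0 N "\<lambda>x. - \<phi> x"] * Cneg[OF *(2,5)] by auto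
      then show "L (patch N \<phi> v) x0 \<le> g x0" using neg[of N \<phi> v x0] by simp
    qed
  qed
qed

text \<open>An upper bound on a supremum is an upper bound on each member. With
  \<open>visc_le_neg\<close> a supersolution for the class becomes a subsolution, after negation,
  for every singleton.\<close>

lemma visc_le_sup_iff:
  assumes "bounded \<Omega>" "bounded_continuous u"
  shows "visc_le I \<Omega> u f \<longleftrightarrow> (\<forall>L\<in>\<L>. visc_le L \<Omega> u f)"
proof
  assume v: "visc_le I \<Omega> u f"
  show "\<forall>L\<in>\<L>. visc_le L \<Omega> u f"
    unfolding visc_patch_le
  proof (intro ballI allI impI, elim conjE)
    fix L x0 N \<phi> assume *: "L \<in> \<L>" "x0 \<in> \<Omega>" "open N" "x0 \<in> N" "N \<subseteq> \<Omega>" "Ck_closure 2 N \<phi>" "\<phi> x0 = u x0"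
        "\<forall>x\<in>N - {x0}. \<phi> x < u x"
    have "jump_integrable s (patch N \<phi> u) x0"
      using * assms bounded_subset by (intro jump_integrable_patch) blast+
    then have "L (patch N \<phi> u) x0 \<le> I (patch N \<phi> u) x0" by (rule sup_ge[OF *(1)])
    also have "\<dots> \<le> f x0" using v * unfolding visc_patch_le by blast
    finally show "L (patch N \<phi> u) x0 \<le> f x0" .
  qed
next
  assume v: "\<forall>L\<in>\<L>. visc_le L \<Omega> u f"
  show "visc_le I \<Omega> u f"
    unfolding visc_patch_le
  proof (intro ballI allI impI, elim conjE)
    fix x0 N \<phi> assume *: "x0 \<in> \<Omega>" "open N" "x0 \<in> N" "N \<subseteq> \<Omega>" "Ck_closure 2 N \<phi>" "\<phi> x0 = u x0"
        "\<forall>x\<in>N - {x0}. \<phi> x < u x"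
    show "I (patch N \<phi> u) x0 \<le> f x0"
      using v * unfolding visc_patch_le by (intro sup_le) blast
  qed
qed

lemma sup_patch_mono:
  assumes "open N" "bounded N" "x0 \<in> N" "Ck_closure 2 N \<phi>" "bounded_continuous u" "bounded_continuous v"
    and le: "\<And>x. u x \<le> v x"
  shows "I (patch N \<phi> u) x0 \<le> I (patch N \<phi> v) x0"
proof (rule sup_mono)
  show "jump_integrable s (patch N \<phi> u) x0" "jump_integrable s (patch N \<phi> v) x0"
    using assms by (auto intro!: jump_integrable_patch)
  have "patch N \<phi> u z \<le> patch N \<phi> v z" for z using le by (simp add: patch_def)
  from add_mono[OF this this] assms(3)
  show "second_diff (patch N \<phi> u) x0 y \<le> second_diff (patch N \<phi> v) x0 y" for y
    by (simp add: second_diff_def)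
qed

lemma second_diff_patch_mono:
  assumes "x0 \<in> M" "x0 \<in> N" "M \<subseteq> N" "\<And>x. x \<in> N \<Longrightarrow> u x \<le> \<phi> x"
  shows "second_diff (patch M \<phi> u) x0 y \<le> second_diff (patch N \<phi> u) x0 y"
proof -
  have "patch M \<phi> u z \<le> patch N \<phi> u z" for z
    using assms by (auto simp: patch_def)
  from add_mono[OF this[of "x0 + y"] this[of "x0 - y"]] assms(1,2) show ?thesis
    by (simp add: second_diff_def)
qed

lemma second_diff_patch_mono':
  assumes "x0 \<in> M" "x0 \<in> N" "M \<subseteq> N" "\<And>x. x \<in> N \<Longrightarrow> \<phi> x \<le> u x"
  shows "second_diff (patch N \<phi> u) x0 y \<le> second_diff (patch M \<phi> u) x0 y"
proof -
  have "patch N \<phi> u z \<le> patch M \<phi> u z" for z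
    using assms by (auto simp: patch_def)
  from add_mono[OF this[of "x0 + y"] this[of "x0 - y"]] assms(1,2) show ?thesis
    by (simp add: second_diff_def)
qed

text \<open>Shrinking the neighbourhood replaces \<open>\<phi>\<close> by the smaller
  \<open>u\<close> and so lowers the operator; an inequality on one small ball therefore suffices.
  The test function becomes measurable by setting it to 0 outside \<open>N\<close>.\<close>

lemma visc_geI:
  assumes \<Omega>: "bounded \<Omega>" and u: "bounded_continuous u"
    and touch: "\<And>x0 N \<phi>. x0 \<in> \<Omega> \<Longrightarrow> open N \<Longrightarrow> x0 \<in> N \<Longrightarrow> N \<subseteq> \<Omega> \<Longrightarrow> Ck_closure 2 N \<phi> \<Longrightarrow>
      \<phi> \<in> borel_measurable borel \<Longrightarrow> \<phi> x0 = u x0 \<Longrightarrow> (\<And>x. x \<in> N \<Longrightarrow> x \<noteq> x0 \<Longrightarrow> u x < \<phi> x) \<Longrightarrow>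
      \<exists>r>0. ball x0 r \<subseteq> N \<and> f x0 \<le> I (patch (ball x0 r) \<phi> u) x0"
  shows "visc_ge I \<Omega> u f"
  unfolding visc_patch_ge
proof (intro ballI allI impI, elim conjE)
  fix x0 N \<phi> assume *: "x0 \<in> \<Omega>" "open N" "x0 \<in> N" "N \<subseteq> \<Omega>" "Ck_closure 2 N \<phi>" "\<phi> x0 = u x0"
        "\<forall>x\<in>N - {x0}. u x < \<phi> x"
  define \<phi>' where "\<phi>' = patch N \<phi> (\<lambda>x. 0)"
  have C': "Ck_closure 2 N \<phi>'"
    using *(5,2) order_refl by (rule Ck_closure_subset) (simp add: \<phi>'_def)
  have m: "\<phi>' \<in> borel_measurable borel"
    unfolding \<phi>'_def using * by (intro patch_measurable Ck_closure_continuous_on bounded_continuous_const)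
  obtain r where r: "r > 0" "ball x0 r \<subseteq> N" "f x0 \<le> I (patch (ball x0 r) \<phi>' u) x0"
    using touch[OF *(1-4) C' m] * by (auto simp: \<phi>'_def)
  have "patch N \<phi> u = patch N \<phi>' u" by (auto simp: patch_def \<phi>'_def)
  moreover have "I (patch (ball x0 r) \<phi>' u) x0 \<le> I (patch N \<phi>' u) x0"
  proof (rule sup_mono)
    show "jump_integrable s (patch (ball x0 r) \<phi>' u) x0"
      using r u by (intro jump_integrable_patch Ck_closure_subset[OF C']) auto
    show "jump_integrable s (patch N \<phi>' u) x0"
      using * \<Omega> bounded_subset u C' by (intro jump_integrable_patch) blast+
    have "u x \<le> \<phi>' x" if "x \<in> N" for x
      using that * by (cases "x = x0") (auto simp: \<phi>'_def less_imp_le)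
    then show "second_diff (patch (ball x0 r) \<phi>' u) x0 y \<le> second_diff (patch N \<phi>' u) x0 y" for y
      using r * by (intro second_diff_patch_mono) auto
  qed
  ultimately show "f x0 \<le> I (patch N \<phi> u) x0" using r(3) by simp
qed

text \<open>The order is reversed: shrinking now replaces \<open>\<phi>\<close> by the larger
  \<open>u\<close> and raises the operator.\<close>

lemma visc_leI:
  assumes \<Omega>: "bounded \<Omega>" and u: "bounded_continuous u"
    and touch: "\<And>x0 N \<phi>. x0 \<in> \<Omega> \<Longrightarrow> open N \<Longrightarrow> x0 \<in> N \<Longrightarrow> N \<subseteq> \<Omega> \<Longrightarrow> Ck_closure 2 N \<phi> \<Longrightarrow>
      \<phi> \<in> borel_measurable borel \<Longrightarrow> \<phi> x0 = u x0 \<Longrightarrow> (\<And>x. x \<in> N \<Longrightarrow> x \<noteq> x0 \<Longrightarrow> \<phi> x < u x) \<Longrightarrow>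
      \<exists>r>0. ball x0 r \<subseteq> N \<and> I (patch (ball x0 r) \<phi> u) x0 \<le> f x0"
  shows "visc_le I \<Omega> u f"
  unfolding visc_patch_le
proof (intro ballI allI impI, elim conjE)
  fix x0 N \<phi> assume *: "x0 \<in> \<Omega>" "open N" "x0 \<in> N" "N \<subseteq> \<Omega>" "Ck_closure 2 N \<phi>" "\<phi> x0 = u x0"
        "\<forall>x\<in>N - {x0}. \<phi> x < u x"
  define \<phi>' where "\<phi>' = patch N \<phi> (\<lambda>x. 0)"
  have C': "Ck_closure 2 N \<phi>'"
    using *(5,2) order_refl by (rule Ck_closure_subset) (simp add: \<phi>'_def)
  have m: "\<phi>' \<in> borel_measurable borel"
    unfolding \<phi>'_def using * by (intro patch_measurable Ck_closure_continuous_on bounded_continuous_const)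
  obtain r where r: "r > 0" "ball x0 r \<subseteq> N" "I (patch (ball x0 r) \<phi>' u) x0 \<le> f x0"
    using touch[OF *(1-4) C' m] * by (auto simp: \<phi>'_def)
  have "patch N \<phi> u = patch N \<phi>' u" by (auto simp: patch_def \<phi>'_def)
  moreover have "I (patch N \<phi>' u) x0 \<le> I (patch (ball x0 r) \<phi>' u) x0"
  proof (rule sup_mono)
    show "jump_integrable s (patch (ball x0 r) \<phi>' u) x0"
      using r u by (intro jump_integrable_patch Ck_closure_subset[OF C']) auto
    show "jump_integrable s (patch N \<phi>' u) x0"
      using * \<Omega> bounded_subset u C' by (intro jump_integrable_patch) blast+
    have "\<phi>' x \<le> u x" if "x \<in> N" for x
      using that * by (cases "x = x0") (auto simp: \<phi>'_def less_imp_le)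
    then show "second_diff (patch N \<phi>' u) x0 y \<le> second_diff (patch (ball x0 r) \<phi>' u) x0 y" for y
      using r * by (intro second_diff_patch_mono') auto
  qed
  ultimately show "I (patch N \<phi> u) x0 \<le> f x0" using r(3) by simp
qed

text \<open>Touching may be non-strict here: a small multiple of the squared distance to
  \<open>x0\<close> makes it strict, and its effect on the operator vanishes with the
  multiple.\<close>

lemma visc_geD:
  assumes v: "visc_ge I \<Omega> u f" and u: "bounded_continuous u" and r: "0 < r" "ball x0 r \<subseteq> \<Omega>"
    and C: "Ck_closure 2 (ball x0 r) \<phi>" and t: "\<phi> x0 = u x0" "\<And>x. x \<in> ball x0 r \<Longrightarrow> u x \<le> \<phi> x"
  shows "f x0 \<le> I (patch (ball x0 r) \<phi> u) x0"
proof (rule field_le_epsilon)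
  fix e :: real assume e: "0 < e"
  define Q where "Q = (LINT y::'a|lborel. (if norm y < r then (norm y)\<^sup>2 else 0) * jump_density s y)"
  have iQ: "integrable lborel (\<lambda>y::'a. (if norm y < r then (norm y)\<^sup>2 else 0) * jump_density s y)"
    using integrable_jump_near[of r, where 'a='a] by (simp add: if_distrib[of "\<lambda>z. z * _"] cong: if_cong)
  have Q0: "0 \<le> Q" unfolding Q_def by (intro Bochner_Integration.integral_nonneg) auto
  \<comment> \<open>The perturbation costs \<open>Lam * \<eta> * Q\<close>, at most \<open>e\<close>
    for this choice; the 1 keeps the denominator positive without a lower bound on
    \<open>Q\<close>.\<close>
  define \<eta> where "\<eta> = e / (Lam * Q + 1)"
  have pos: "0 < Lam * Q + 1" using Q0 lam by (intro add_nonneg_pos mult_nonneg_nonneg) auto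
  have \<eta>: "0 < \<eta>" "Lam * \<eta> * Q \<le> e"
    using e pos by (auto simp: \<eta>_def field_simps)
  define \<psi> where "\<psi> = (\<lambda>x. \<phi> x + (\<eta> * (norm (x - x0))\<^sup>2 + 0))"
  have C\<psi>: "Ck_closure 2 (ball x0 r) \<psi>"
    unfolding \<psi>_def by (intro Ck_closure_add C Ck_closure_quadratic) auto
  have "f x0 \<le> I (patch (ball x0 r) \<psi> u) x0"
  proof -
    have "u x < \<psi> x" if "x \<in> ball x0 r - {x0}" for x
    proof -
      have "0 < \<eta> * (norm (x - x0))\<^sup>2" using that \<eta>(1) by simp
      then show ?thesis using t(2)[of x] that by (simp add: \<psi>_def)
    qed
    moreover have "x0 \<in> \<Omega>" "\<psi> x0 = u x0" using r t(1) by (auto simp: \<psi>_def)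
    ultimately show ?thesis
      using v[unfolded visc_patch_ge, rule_format, of x0 "ball x0 r" \<psi>] r C\<psi> by simp
  qed
  also have "\<dots> \<le> I (patch (ball x0 r) \<phi> u) x0
      + Lam / 2 * (LINT y::'a|lborel. (2 * \<eta> * (if norm y < r then (norm y)\<^sup>2 else 0)) * jump_density s y)"
  proof (rule sup_close[where P = "\<lambda>y. 2 * \<eta> * (if norm y < r then (norm y)\<^sup>2 else 0)"])
    show "jump_integrable s (patch (ball x0 r) \<psi> u) x0" "jump_integrable s (patch (ball x0 r) \<phi> u) x0"
      using C C\<psi> r u by (auto intro!: jump_integrable_patch)
    show "integrable lborel (\<lambda>y::'a. 2 * \<eta> * (if norm y < r then (norm y)\<^sup>2 else 0) * jump_density s y)"
      using integrable_mult_right[OF iQ, of "2 * \<eta>"] by (simp add: mult.assoc)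
    show "0 \<le> 2 * \<eta> * (if norm y < r then (norm y)\<^sup>2 else 0)" for y :: 'a using \<eta> by simp
    show "second_diff (patch (ball x0 r) \<psi> u) x0 y \<le> second_diff (patch (ball x0 r) \<phi> u) x0 y
        + 2 * \<eta> * (if norm y < r then (norm y)\<^sup>2 else 0)" for y
    proof (cases "norm y < r")
      case True
      then show ?thesis
        by (simp add: second_diff_patch_near[OF order_refl] \<psi>_def second_diff_add
            second_diff_quadratic[of \<eta> x0 0, simplified])
    next
      case False
      then show ?thesis using r by (simp add: second_diff_patch_far \<psi>_def)
    qed
  qed
  also have "(LINT y::'a|lborel. (2 * \<eta> * (if norm y < r then (norm y)\<^sup>2 else 0)) * jump_density s y) = 2 * \<eta> * Q"
    unfolding Q_def by (simp only: mult.assoc integral_mult_right_zero)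
  finally show "f x0 \<le> I (patch (ball x0 r) \<phi> u) x0 + e" using \<eta>(2) by simp
qed

text \<open>The bound comes for each operator separately, from the subsolution case for the
  singleton class after negation. In this form an operator selected for one function can be applied
  to another.\<close>

lemma visc_leD:
  assumes v: "visc_le I \<Omega> u f" and \<Omega>: "bounded \<Omega>" and u: "bounded_continuous u" and r: "0 < r" "ball x0 r \<subseteq> \<Omega>"
    and C: "Ck_closure 2 (ball x0 r) \<phi>" and t: "\<phi> x0 = u x0" "\<And>x. x \<in> ball x0 r \<Longrightarrow> \<phi> x \<le> u x"
    and L: "L \<in> \<L>"
  shows "L (patch (ball x0 r) \<phi> u) x0 \<le> f x0"
proof -
  interpret S: jump_class s lam Lam "{L}" by (rule singleton[OF L])
  have "visc_le L \<Omega> u f" using v L visc_le_sup_iff[OF \<Omega> u] by blast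
  then have "visc_ge (sup_operator {L}) \<Omega> (\<lambda>x. - u x) (\<lambda>x. - f x)"
    unfolding visc_le_neg[OF L] sup_operator_singleton .
  from S.visc_geD[OF this bounded_continuous_uminus[OF u] r, of "\<lambda>x. - \<phi> x"]
  have "- f x0 \<le> L (patch (ball x0 r) (\<lambda>x. - \<phi> x) (\<lambda>x. - u x)) x0"
    using t Ck_closure_cmult[OF C, of "-1"] by (simp add: sup_operator_singleton)
  moreover have "patch (ball x0 r) (\<lambda>x. - \<phi> x) (\<lambda>x. - u x) = (\<lambda>x. - patch (ball x0 r) \<phi> u x)"
    by (auto simp: patch_def)
  ultimately show ?thesis using op_minus[OF L] by simp
qed

end

section \<open>The difference of a subsolution and a supersolution\<close>

context jump_class
begin

text \<open>Perron's method moves the touching point and shifts the test function by a constant. The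
  doubled radius leaves room for balls of radius \<open>r\<close> around nearby centres.\<close>

lemma sup_patch_continuous:
  assumes C: "Ck_closure 2 N \<phi>" and N: "open N" "bounded N" and r: "0 < r" "cball x0 (2 * r) \<subseteq> N"
    and u: "bounded_continuous u" and m [measurable]: "\<phi> \<in> borel_measurable borel" and e: "0 < e"
  shows "\<exists>\<delta>>0. \<forall>x c. dist x x0 < \<delta> \<and> \<bar>c\<bar> < \<delta> \<longrightarrow>
    \<bar>I (patch (ball x r) (\<lambda>z. \<phi> z + c) u) x - I (patch (ball x0 r) \<phi> u) x0\<bar> < e"
proof (rule ccontr)
  have [measurable]: "u \<in> borel_measurable borel" by (rule bounded_continuous_measurable[OF u])
  assume "\<not> ?thesis"
  then have *: "\<exists>x c. dist x x0 < \<delta> \<and> \<bar>c\<bar> < \<delta> \<and>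
    e \<le> \<bar>I (patch (ball x r) (\<lambda>z. \<phi> z + c) u) x - I (patch (ball x0 r) \<phi> u) x0\<bar>" if "0 < \<delta>" for \<delta>
    using that by (meson not_less)
  \<comment> \<open>Failure at every tolerance is turned into sequences; the caps \<open>r\<close>
    and 1 keep the centres in range and the constants bounded, as the majorant needs.\<close>
  define d where "d n = min (min 1 r) (1 / real (Suc n))" for n
  have d0: "0 < d n" for n using r by (simp add: d_def)
  have dlim: "d \<longlonglongrightarrow> 0"
  proof (rule tendsto_sandwich[OF _ _ tendsto_const])
    show "(\<lambda>n. 1 / real (Suc n)) \<longlonglongrightarrow> 0" by real_asymp
  qed (use d0 in \<open>auto simp: d_def less_imp_le\<close>)
  obtain x c where xc: "\<And>n. dist (x n) x0 < d n" "\<And>n. \<bar>c n\<bar> < d n"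
    "\<And>n. e \<le> \<bar>I (patch (ball (x n) r) (\<lambda>z. \<phi> z + c n) u) (x n) - I (patch (ball x0 r) \<phi> u) x0\<bar>"
    using *[OF d0] by metis
  have xr: "dist (x n) x0 < r" "\<bar>c n\<bar> < 1" for n using xc(1,2)[of n] by (auto simp: d_def)
  have xlim: "x \<longlonglongrightarrow> x0"
    by (rule tendsto_dist_iff[THEN iffD2], rule tendsto_sandwich[OF _ _ tendsto_const dlim])
      (use xc(1) in \<open>auto simp: less_imp_le\<close>)
  have clim: "c \<longlonglongrightarrow> 0"
    by (rule tendsto_rabs_zero_cancel, rule tendsto_sandwich[OF _ _ tendsto_const dlim])
      (use xc(2) in \<open>auto simp: less_imp_le\<close>)
  have sub: "ball (x n) r \<subseteq> N" for n
  proof -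
    have "ball (x n) r \<subseteq> cball x0 (2 * r)"
    proof
      fix z assume "z \<in> ball (x n) r"
      then show "z \<in> cball x0 (2 * r)" using dist_triangle[of x0 z "x n"] xr(1)[of n] by (simp add: dist_commute)
    qed
    then show ?thesis using r by blast
  qed
  have sub0: "ball x0 r \<subseteq> N" using r by (auto simp: subset_iff)
  obtain D where D: "0 \<le> D" "\<And>z y. norm (z - x0) + norm y \<le> 2 * r \<Longrightarrow> \<bar>second_diff \<phi> z y\<bar> \<le> D * (norm y)\<^sup>2"
    by (rule Ck_closure_second_diff[OF C r(2)]) (rule that)
  obtain B where B: "\<And>x. x \<in> N \<Longrightarrow> \<bar>\<phi> x\<bar> \<le> B" by (rule Ck_closure_bounded[OF C N(2)]) (rule that)
  obtain B' where B': "0 \<le> B'" "\<And>x. \<bar>u x\<bar> \<le> B'" by (rule bounded_continuousE[OF u]) (rule that)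
  \<comment> \<open>The difference of the two second differences. The ball moves with its centre, so
    the case distinction at \<open>r\<close> is the same for all \<open>n\<close>.\<close>
  define a where "a n y = (if norm y < r then second_diff \<phi> (x n) y - second_diff \<phi> x0 y
    else (u (x n + y) + u (x n - y) - 2 * (\<phi> (x n) + c n)) - (u (x0 + y) + u (x0 - y) - 2 * \<phi> x0))" for n y
  have am: "a n \<in> borel_measurable borel" for n
    unfolding a_def[abs_def] by measurable
  have xN: "x n \<in> N" "x0 \<in> N" for n using sub[of n] sub0 r by auto
  have cont: "isCont \<phi> z" if "z \<in> N" for z
    using Ck_closure_continuous_on[OF C] N(1) that by (simp add: continuous_on_eq_continuous_at)
  have alim: "(\<lambda>n. a n y) \<longlonglongrightarrow> 0" for y
  proof (cases "norm y < r")
    case True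
    have in0: "x0 + y \<in> N" "x0 - y \<in> N" using sub0 True by (auto simp: subset_iff dist_norm)
    have "(\<lambda>n. (\<phi> (x n + y) + \<phi> (x n - y) - 2 * \<phi> (x n)) - (\<phi> (x0 + y) + \<phi> (x0 - y) - 2 * \<phi> x0))
        \<longlonglongrightarrow> (\<phi> (x0 + y) + \<phi> (x0 - y) - 2 * \<phi> x0) - (\<phi> (x0 + y) + \<phi> (x0 - y) - 2 * \<phi> x0)"
      by (intro tendsto_intros isCont_tendsto_compose[OF cont] in0 xN xlim)
    then show ?thesis using True by (simp add: a_def second_diff_def)
  next
    case False
    have "(\<lambda>n. (u (x n + y) + u (x n - y) - 2 * (\<phi> (x n) + c n)) - (u (x0 + y) + u (x0 - y) - 2 * \<phi> x0))
       \<longlonglongrightarrow> (u (x0 + y) + u (x0 - y) - 2 * (\<phi> x0 + 0)) - (u (x0 + y) + u (x0 - y) - 2 * \<phi> x0)"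
      by (intro tendsto_intros isCont_tendsto_compose[OF cont] isCont_tendsto_compose[OF bounded_continuous_isCont[OF u]]
          xN xlim clim)
    then show ?thesis using False by (simp add: a_def)
  qed
  define Q where "Q = 2 * D + 4 * B' + 4 * \<bar>B\<bar> + 2"
  have abd: "\<bar>a n y\<bar> \<le> Q * (if norm y < r then (norm y)\<^sup>2 else 1)" for n y
  proof (cases "norm y < r")
    case True
    have "\<bar>second_diff \<phi> (x n) y\<bar> \<le> D * (norm y)\<^sup>2" "\<bar>second_diff \<phi> x0 y\<bar> \<le> D * (norm y)\<^sup>2"
      using True xr(1)[of n] r by (auto intro!: D(2) simp: dist_norm)
    then have "\<bar>a n y\<bar> \<le> 2 * D * (norm y)\<^sup>2" using True by (auto simp: a_def)
    also have "\<dots> \<le> Q * (norm y)\<^sup>2" using B' unfolding Q_def by (intro mult_right_mono) auto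
    finally show ?thesis using True by simp
  next
    case False
    have "\<bar>u (x n + y) + u (x n - y) - 2 * (\<phi> (x n) + c n)\<bar> \<le> 2 * B' + 2 * B + 2"
      using B'(2)[of "x n + y"] B'(2)[of "x n - y"] B[OF xN(1)[of n]] less_imp_le[OF xr(2)[of n]]
      unfolding distrib_left by - (rule abs_leI; linarith)
    moreover have "\<bar>u (x0 + y) + u (x0 - y) - 2 * \<phi> x0\<bar> \<le> 2 * B' + 2 * B"
      using B'(2)[of "x0 + y"] B'(2)[of "x0 - y"] B[OF xN(2)]
      by - (rule abs_leI; linarith)
    moreover have "a n y = (u (x n + y) + u (x n - y) - 2 * (\<phi> (x n) + c n)) - (u (x0 + y) + u (x0 - y) - 2 * \<phi> x0)"
      using False by (simp add: a_def)
    ultimately have "\<bar>a n y\<bar> \<le> Q"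
      using D(1) abs_ge_self[of B] unfolding Q_def by - (rule abs_leI; linarith)
    then show ?thesis using False by simp
  qed
  note lim = jump_dominated_convergence[OF r(1) am abd alim]
  have Ck: "Ck_closure 2 M (\<lambda>z. \<phi> z + c')" if "open M" "M \<subseteq> N" for M c'
    using that by (intro Ck_closure_add Ck_closure_const Ck_closure_subset[OF C]) auto
  have C0: "Ck_closure 2 (ball x0 r) \<phi>" using sub0 by (intro Ck_closure_subset[OF C]) auto
  have i1: "jump_integrable s (patch (ball (x n) r) (\<lambda>z. \<phi> z + c n) u) (x n)" for n
    using r u sub by (intro jump_integrable_patch Ck) auto
  have i2: "jump_integrable s (patch (ball x0 r) \<phi> u) x0"
    using r u by (intro jump_integrable_patch C0) auto
  have sd: "second_diff (patch (ball (x n) r) (\<lambda>z. \<phi> z + c n) u) (x n) y - second_diff (patch (ball x0 r) \<phi> u) x0 y = a n y" for n y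
  proof (cases "norm y < r")
    case True
    then show ?thesis
      by (simp add: second_diff_patch_near[OF order_refl] a_def) (simp add: second_diff_def)
  next
    case False
    then show ?thesis using r by (simp add: second_diff_patch_far a_def)
  qed
  have "\<bar>I (patch (ball (x n) r) (\<lambda>z. \<phi> z + c n) u) (x n) - I (patch (ball x0 r) \<phi> u) x0\<bar>
      \<le> Lam / 2 * (LINT y|lborel. \<bar>a n y\<bar> * jump_density s y)" for n
  proof -
    have "I (patch (ball (x n) r) (\<lambda>z. \<phi> z + c n) u) (x n) \<le> I (patch (ball x0 r) \<phi> u) x0
        + Lam / 2 * (LINT y|lborel. \<bar>a n y\<bar> * jump_density s y)"
      using sd[of n] abs_ge_self[of "a n _"] by (intro sup_close[OF i1 i2 lim(2)]) (auto simp: algebra_simps)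
    moreover have "I (patch (ball x0 r) \<phi> u) x0 \<le> I (patch (ball (x n) r) (\<lambda>z. \<phi> z + c n) u) (x n)
        + Lam / 2 * (LINT y|lborel. \<bar>a n y\<bar> * jump_density s y)"
    proof (rule sup_close[OF i2 i1 lim(2)])
      show "second_diff (patch (ball x0 r) \<phi> u) x0 y \<le> second_diff (patch (ball (x n) r) (\<lambda>z. \<phi> z + c n) u) (x n) y + \<bar>a n y\<bar>" for y
        using sd[of n y] abs_ge_minus_self[of "a n y"] by linarith
    qed auto
    ultimately show ?thesis by linarith
  qed
  then have le: "\<forall>n\<ge>0. e \<le> Lam / 2 * (LINT y|lborel. \<bar>a n y\<bar> * jump_density s y)"
    using xc(3) order_trans by blast
  have "(\<lambda>n. Lam / 2 * (LINT y|lborel. \<bar>a n y\<bar> * jump_density s y)) \<longlonglongrightarrow> Lam / 2 * 0"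
    by (intro tendsto_mult_left lim(1))
  then have "e \<le> Lam / 2 * 0" using le by (intro LIMSEQ_le_const) blast+
  then show False using e by simp
qed

text \<open>An operator that nearly attains the supremum for \<open>u\<close> also obeys the bound
  \<open>g\<close> for \<open>v\<close>; hence the supremum for the difference is nearly at least
  the difference of the right-hand sides. The penalty is the only term that grows, and it is
  confined to a ball chosen after its size.\<close>

lemma visc_ge_diff:
  assumes \<Omega>: "bounded \<Omega>" and u: "bounded_continuous u" and v: "bounded_continuous v"
    and vu: "visc_ge I \<Omega> u f" and vv: "visc_le I \<Omega> v g"
    and f: "continuous_on \<Omega> f" and g: "continuous_on \<Omega> g"
  shows "visc_ge I \<Omega> (\<lambda>x. u x - v x) (\<lambda>x. f x - g x)"
proof (rule visc_geI[OF \<Omega> bounded_continuous_diff[OF u v]])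
  note [measurable] = bounded_continuous_measurable[OF u] bounded_continuous_measurable[OF v]
  fix x0 N and \<phi> :: "'a \<Rightarrow> real"
  assume x0: "x0 \<in> \<Omega>" and N: "open N" "x0 \<in> N" "N \<subseteq> \<Omega>" and C: "Ck_closure 2 N \<phi>"
    and m [measurable]: "\<phi> \<in> borel_measurable borel" and \<phi>0: "\<phi> x0 = u x0 - v x0"
    and touch: "\<And>x. x \<in> N \<Longrightarrow> x \<noteq> x0 \<Longrightarrow> u x - v x < \<phi> x"
  have Nb: "bounded N" using \<Omega> N(3) by (rule bounded_subset)
  obtain r' where r': "r' > 0" "cball x0 r' \<subseteq> N" using N(1,2) open_contains_cball_eq by metis
  define r where "r = r' / 2"
  have r: "r > 0" "cball x0 (2 * r) \<subseteq> N" using r' by (auto simp: r_def)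
  define K where "K = cball x0 (2 * r)"
  have K: "compact K" "x0 \<in> K" "K \<subseteq> N" using r by (auto simp: K_def)
  have contphi: "continuous_on N \<phi>" by (rule Ck_closure_continuous_on[OF C])
  have cont: "isCont \<phi> z" if "z \<in> N" for z
    using contphi N(1) that by (simp add: continuous_on_eq_continuous_at)
  define \<Phi> where "\<Phi> n p = u (fst p) - v (snd p) - \<phi> (fst p) - real (Suc n) * (norm (fst p - snd p))\<^sup>2" for n p
  have "\<exists>p\<in>K \<times> K. \<forall>q\<in>K \<times> K. \<Phi> n q \<le> \<Phi> n p" for n
  proof (rule continuous_attains_sup)
    have "continuous_on (K \<times> K) (\<lambda>p. \<phi> (fst p))"
      using K by (intro continuous_on_compose2[OF contphi continuous_on_fst]) (auto intro: continuous_on_id)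
    moreover have "continuous_on (K \<times> K) (\<lambda>p. u (fst p))"
      by (intro continuous_on_compose2[OF bounded_continuous_cont[OF u, of UNIV]] continuous_on_fst continuous_on_id) auto
    moreover have "continuous_on (K \<times> K) (\<lambda>p. v (snd p))"
      by (intro continuous_on_compose2[OF bounded_continuous_cont[OF v, of UNIV]] continuous_on_snd continuous_on_id) auto
    ultimately show "continuous_on (K \<times> K) (\<Phi> n)"
      unfolding \<Phi>_def[abs_def] by (intro continuous_intros)
  qed (use K in \<open>auto intro: compact_Times\<close>)
  then obtain p where p: "\<And>n. p n \<in> K \<times> K" "\<And>n q. q \<in> K \<times> K \<Longrightarrow> \<Phi> n q \<le> \<Phi> n (p n)"
    by metis
  define X where "X n = fst (p n)" for n
  define Y where "Y n = snd (p n)" for n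
  have XY: "X n \<in> K" "Y n \<in> K" for n using p(1)[of n] by (auto simp: X_def Y_def mem_Times_iff)
  have max: "u x - v y - \<phi> x - real (Suc n) * (norm (x - y))\<^sup>2
      \<le> u (X n) - v (Y n) - \<phi> (X n) - real (Suc n) * (norm (X n - Y n))\<^sup>2" if "x \<in> K" "y \<in> K" for n x y
    using p(2)[of "(x, y)" n] that by (simp add: \<Phi>_def X_def Y_def)
  \<comment> \<open>Comparison with the pair \<open>(x0, x0)\<close>, where the functional is 0. It
    bounds the penalty and later forces both points to \<open>x0\<close>.\<close>
  have base: "0 \<le> u (X n) - v (Y n) - \<phi> (X n) - real (Suc n) * (norm (X n - Y n))\<^sup>2" for n
    using max[OF K(2) K(2), of n] \<phi>0 by simp
  obtain B where B: "\<And>x. x \<in> N \<Longrightarrow> \<bar>\<phi> x\<bar> \<le> B" by (rule Ck_closure_bounded[OF C Nb]) (rule that)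
  obtain Bu where Bu: "0 \<le> Bu" "\<And>x. \<bar>u x\<bar> \<le> Bu" by (rule bounded_continuousE[OF u]) (rule that)
  obtain Bv where Bv: "0 \<le> Bv" "\<And>x. \<bar>v x\<bar> \<le> Bv" by (rule bounded_continuousE[OF v]) (rule that)
  have XYlim: "(\<lambda>n. norm (X n - Y n)) \<longlonglongrightarrow> 0"
  proof -
    have "(norm (X n - Y n))\<^sup>2 \<le> (Bu + Bv + \<bar>B\<bar>) / real (Suc n)" for n
    proof -
      have "\<bar>\<phi> (X n)\<bar> \<le> B" using XY K by (intro B) auto
      then have "real (Suc n) * (norm (X n - Y n))\<^sup>2 \<le> Bu + Bv + \<bar>B\<bar>"
        using base[of n] Bu(2)[of "X n"] Bv(2)[of "Y n"] by linarith
      then show ?thesis by (simp add: field_simps)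
    qed
    moreover have "(\<lambda>n. (Bu + Bv + \<bar>B\<bar>) / real (Suc n)) \<longlonglongrightarrow> 0" by real_asymp
    ultimately have "(\<lambda>n. (norm (X n - Y n))\<^sup>2) \<longlonglongrightarrow> 0"
      by (intro tendsto_sandwich[where f = "\<lambda>_. 0" and g = "\<lambda>n. (norm (X n - Y n))\<^sup>2"]) auto
    then have "(\<lambda>n. sqrt ((norm (X n - Y n))\<^sup>2)) \<longlonglongrightarrow> sqrt 0" by (intro tendsto_real_sqrt)
    then show ?thesis by simp
  qed
  have vlim: "(\<lambda>n. v (X n) - v (Y n)) \<longlonglongrightarrow> 0"
  proof -
    have "uniformly_continuous_on K v"
      using K bounded_continuous_cont[OF v] by (intro compact_uniformly_continuous) auto
    then have "(\<lambda>n. dist (v (X n)) (v (Y n))) \<longlonglongrightarrow> 0"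
      using XYlim XY by (auto simp: uniformly_continuous_on_sequentially dist_norm)
    then show ?thesis unfolding dist_norm by (rule tendsto_norm_zero_cancel)
  qed
  have Xlim: "X \<longlonglongrightarrow> x0"
  proof (rule tendstoI)
    fix e :: real assume e: "0 < e"
    have hc: "continuous_on K (\<lambda>x. \<phi> x - (u x - v x))"
      using K by (intro continuous_on_diff bounded_continuous_cont u v continuous_on_subset[OF contphi])
    have hp: "0 < \<phi> x - (u x - v x)" if "x \<in> K" "x \<noteq> x0" for x
      using touch[of x] that K by auto
    obtain h where h: "0 < h" "\<And>x. x \<in> K \<Longrightarrow> \<phi> x - (u x - v x) < h \<Longrightarrow> dist x x0 < e"
      using strict_minimum_stable[OF K(1) hc hp e] by blast
    have "\<forall>\<^sub>F n in sequentially. v (X n) - v (Y n) < h" using vlim h(1) by (rule order_tendstoD(2))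
    then show "\<forall>\<^sub>F n in sequentially. dist (X n) x0 < e"
    proof eventually_elim
      case (elim n)
      have "0 \<le> real (Suc n) * (norm (X n - Y n))\<^sup>2" by (intro mult_nonneg_nonneg) auto
      then show ?case using base[of n] elim by (intro h(2) XY) linarith
    qed
  qed
  have Ylim: "Y \<longlonglongrightarrow> x0"
  proof -
    have "(\<lambda>n. X n - (X n - Y n)) \<longlonglongrightarrow> x0 - 0"
      by (rule tendsto_diff[OF Xlim tendsto_norm_zero_cancel[OF XYlim]])
    then show ?thesis by simp
  qed
  have "\<forall>\<^sub>F n in sequentially. dist (X n) x0 < r \<and> dist (Y n) x0 < r"
    using tendstoD[OF Xlim r(1)] tendstoD[OF Ylim r(1)] by (rule eventually_conj)
  then obtain n0 where n0: "\<And>n. n0 \<le> n \<Longrightarrow> dist (X n) x0 < r \<and> dist (Y n) x0 < r"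
    by (auto simp: eventually_sequentially)
  \<comment> \<open>The early terms are dropped, so that shifts of either point by at most
    \<open>r\<close> stay in \<open>K\<close>, where maximality is available.\<close>
  define x where "x n = X (n + n0)" for n
  define y where "y n = Y (n + n0)" for n
  define k where "k n = real (Suc (n + n0))" for n
  have k0: "0 < k n" for n by (simp add: k_def)
  have xr: "dist (x n) x0 < r" and yr: "dist (y n) x0 < r" for n
    using n0[of "n + n0"] by (auto simp: x_def y_def)
  have xlim: "x \<longlonglongrightarrow> x0" and ylim: "y \<longlonglongrightarrow> x0"
    using LIMSEQ_ignore_initial_segment[OF Xlim, of n0] LIMSEQ_ignore_initial_segment[OF Ylim, of n0]
    by (auto simp: x_def[abs_def] y_def[abs_def])
  have max': "u z - v w - \<phi> z - k n * (norm (z - w))\<^sup>2 \<le> u (x n) - v (y n) - \<phi> (x n) - k n * (norm (x n - y n))\<^sup>2"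
    if "z \<in> K" "w \<in> K" for n z w
    using max[OF that, of "n + n0"] by (simp only: x_def y_def k_def)
  have inK: "z + h \<in> K" if "dist z x0 < r" "norm h \<le> r" for z h
  proof -
    have "norm (z - x0 + h) \<le> 2 * r" using that norm_triangle_ineq[of "z - x0" h] by (simp add: dist_norm)
    moreover have "dist x0 (z + h) = norm (z - x0 + h)" by (simp add: dist_norm norm_minus_commute[of x0] algebra_simps)
    ultimately show ?thesis by (simp add: K_def)
  qed
  have inK': "z - h \<in> K" if "dist z x0 < r" "norm h \<le> r" for z h
    using inK[of z "-h"] that by simp
  have ballK: "ball z \<rho> \<subseteq> K" if "dist z x0 < r" "\<rho> \<le> r" for z \<rho>
  proof
    fix w assume "w \<in> ball z \<rho>"
    then have "norm (w - z) \<le> r" using that by (simp add: dist_norm norm_minus_commute)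
    then have "z + (w - z) \<in> K" using that by (intro inK) auto
    then show "w \<in> K" by simp
  qed
  \<comment> \<open>Both variables are shifted by the same vector, so the penalty does not change.\<close>
  have shift: "second_diff u (x n) h - second_diff v (y n) h \<le> second_diff \<phi> (x n) h" if "norm h < r" for n h
  proof -
    have "u (x n + h) - v (y n + h) - \<phi> (x n + h) \<le> u (x n) - v (y n) - \<phi> (x n)"
      using max'[of "x n + h" "y n + h" n] inK[OF xr, of h] inK[OF yr, of h] that by simp
    moreover have "u (x n - h) - v (y n - h) - \<phi> (x n - h) \<le> u (x n) - v (y n) - \<phi> (x n)"
      using max'[of "x n - h" "y n - h" n] inK'[OF xr, of h] inK'[OF yr, of h] that by simp
    ultimately show ?thesis by (simp add: second_diff_def)
  qed
  let ?w = "\<lambda>z. u z - v z"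
  have xK: "x n \<in> K" "y n \<in> K" for n using XY by (auto simp: x_def y_def)
  have xN: "x n \<in> N" "y n \<in> N" for n using xK[of n] K by auto
  have sub0: "ball x0 r \<subseteq> N" using ballK[of x0 r] r K by auto
  obtain D where D: "0 \<le> D" "\<And>z y. norm (z - x0) + norm y \<le> 2 * r \<Longrightarrow> \<bar>second_diff \<phi> z y\<bar> \<le> D * (norm y)\<^sup>2"
    by (rule Ck_closure_second_diff[OF C r(2)]) (rule that)
  \<comment> \<open>The error against the limit configuration. For small \<open>h\<close> only
    \<open>\<phi>\<close> is compared, because \<open>shift\<close> bounds the second differences of
    \<open>u\<close> and \<open>v\<close> by it; for large \<open>h\<close> continuity of
    \<open>u\<close> and \<open>v\<close> suffices.\<close>
  define a where "a n h = (if norm h < r then second_diff \<phi> (x n) h - second_diff \<phi> x0 h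
    else (second_diff u (x n) h - second_diff v (y n) h) - (?w (x0 + h) + ?w (x0 - h) - 2 * \<phi> x0))" for n h
  have am: "a n \<in> borel_measurable borel" for n
    unfolding a_def[abs_def] by measurable
  have alim: "(\<lambda>n. a n h) \<longlonglongrightarrow> 0" for h
  proof (cases "norm h < r")
    case True
    have in0: "x0 + h \<in> N" "x0 - h \<in> N" using sub0 True by (auto simp: subset_iff dist_norm)
    have "(\<lambda>n. (\<phi> (x n + h) + \<phi> (x n - h) - 2 * \<phi> (x n)) - (\<phi> (x0 + h) + \<phi> (x0 - h) - 2 * \<phi> x0))
        \<longlonglongrightarrow> (\<phi> (x0 + h) + \<phi> (x0 - h) - 2 * \<phi> x0) - (\<phi> (x0 + h) + \<phi> (x0 - h) - 2 * \<phi> x0)"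
      by (intro tendsto_intros isCont_tendsto_compose[OF cont] in0 N(2) xlim)
    then show ?thesis using True by (simp add: a_def second_diff_def)
  next
    case False
    have "(\<lambda>n. ((u (x n + h) + u (x n - h) - 2 * u (x n)) - (v (y n + h) + v (y n - h) - 2 * v (y n)))
         - (?w (x0 + h) + ?w (x0 - h) - 2 * \<phi> x0))
       \<longlonglongrightarrow> ((u (x0 + h) + u (x0 - h) - 2 * u x0) - (v (x0 + h) + v (x0 - h) - 2 * v x0))
         - (?w (x0 + h) + ?w (x0 - h) - 2 * \<phi> x0)"
      by (intro tendsto_intros isCont_tendsto_compose[OF bounded_continuous_isCont[OF u]]
          isCont_tendsto_compose[OF bounded_continuous_isCont[OF v]] xlim ylim)
    then show ?thesis using False \<phi>0 by (simp add: a_def second_diff_def)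
  qed
  define Q where "Q = 2 * D + 6 * Bu + 6 * Bv + 2 * \<bar>B\<bar>"
  have abd: "\<bar>a n h\<bar> \<le> Q * (if norm h < r then (norm h)\<^sup>2 else 1)" for n h
  proof (cases "norm h < r")
    case True
    have "\<bar>second_diff \<phi> (x n) h\<bar> \<le> D * (norm h)\<^sup>2" "\<bar>second_diff \<phi> x0 h\<bar> \<le> D * (norm h)\<^sup>2"
      using True xr[of n] r by (auto intro!: D(2) simp: dist_norm)
    then have "\<bar>a n h\<bar> \<le> 2 * D * (norm h)\<^sup>2" using True by (auto simp: a_def)
    also have "\<dots> \<le> Q * (norm h)\<^sup>2" using Bu Bv unfolding Q_def by (intro mult_right_mono) auto
    finally show ?thesis using True by simp
  next
    case False
    have "\<bar>second_diff u (x n) h\<bar> \<le> 4 * Bu"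
      using Bu(2)[of "x n + h"] Bu(2)[of "x n - h"] Bu(2)[of "x n"] unfolding second_diff_def by - (rule abs_leI; linarith)
    moreover have "\<bar>second_diff v (y n) h\<bar> \<le> 4 * Bv"
      using Bv(2)[of "y n + h"] Bv(2)[of "y n - h"] Bv(2)[of "y n"] unfolding second_diff_def by - (rule abs_leI; linarith)
    moreover have "\<bar>?w (x0 + h) + ?w (x0 - h) - 2 * \<phi> x0\<bar> \<le> 2 * Bu + 2 * Bv + 2 * B"
      using Bu(2)[of "x0 + h"] Bu(2)[of "x0 - h"] Bv(2)[of "x0 + h"] Bv(2)[of "x0 - h"] B[OF N(2)]
      by - (rule abs_leI; linarith)
    moreover have "a n h = (second_diff u (x n) h - second_diff v (y n) h) - (?w (x0 + h) + ?w (x0 - h) - 2 * \<phi> x0)"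
      using False by (simp add: a_def)
    ultimately have "\<bar>a n h\<bar> \<le> Q" using D(1) abs_ge_self[of B] unfolding Q_def by - (rule abs_leI; linarith)
    then show ?thesis using False by simp
  qed
  note lim = jump_dominated_convergence[OF r(1) am abd alim]
  have C0: "Ck_closure 2 (ball x0 r) \<phi>" using sub0 by (intro Ck_closure_subset[OF C]) auto
  have iw: "jump_integrable s (patch (ball x0 r) \<phi> ?w) x0"
    using r by (intro jump_integrable_patch C0 bounded_continuous_diff u v) auto
  have main: "f (x n) - g (y n) \<le> I (patch (ball x0 r) \<phi> ?w) x0 + 2 / real (Suc n)
      + Lam / 2 * (LINT h|lborel. \<bar>a n h\<bar> * jump_density s h)" for n
  proof -
    define e where "e = 1 / real (Suc n)"
    have e: "0 < e" by (simp add: e_def)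
    \<comment> \<open>The two penalties together contribute
      \<open>4 * k n * (norm h)\<^sup>2\<close> for \<open>norm h < \<rho>\<close>; with the factor
      \<open>Lam / 2\<close> this threshold keeps their cost below \<open>e\<close>.\<close>
    have "0 < e / (2 * k n * Lam)" using e k0[of n] lam by simp
    then obtain \<rho> where \<rho>: "0 < \<rho>" "\<rho> < r"
      "(LINT h::'a|lborel. (if norm h < \<rho> then (norm h)\<^sup>2 else 0) * jump_density s h) < e / (2 * k n * Lam)"
      using r(1) by (rule jump_near_small)
    \<comment> \<open>Freezing one variable at the maximum point turns maximality into a touching of
      \<open>u\<close> from above by \<open>A\<close> and of \<open>v\<close> from below by
      \<open>E\<close>.\<close>
    define A where "A z = \<phi> z + (k n * (norm (z - y n))\<^sup>2 + (u (x n) - \<phi> (x n) - k n * (norm (x n - y n))\<^sup>2))" for z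
    define E where "E z = (- k n) * (norm (z - x n))\<^sup>2 + (v (y n) + k n * (norm (x n - y n))\<^sup>2)" for z
    have bx: "ball (x n) \<rho> \<subseteq> K" "ball (y n) \<rho> \<subseteq> K" using ballK[OF xr] ballK[OF yr] \<rho>(2) by auto
    have CA: "Ck_closure 2 (ball (x n) \<rho>) A"
      unfolding A_def[abs_def] using bx(1) K(3)
      by (intro Ck_closure_add Ck_closure_quadratic Ck_closure_subset[OF C]) auto
    have CE: "Ck_closure 2 (ball (y n) \<rho>) E"
      unfolding E_def[abs_def] by (intro Ck_closure_quadratic) auto
    have "f (x n) \<le> I (patch (ball (x n) \<rho>) A u) (x n)"
    proof (rule visc_geD[OF vu u \<rho>(1) _ CA])
      show "ball (x n) \<rho> \<subseteq> \<Omega>" using bx K N by blast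
      show "A (x n) = u (x n)" by (simp add: A_def)
      show "u z \<le> A z" if "z \<in> ball (x n) \<rho>" for z
        using max'[of z "y n" n] that bx xK by (auto simp: A_def)
    qed
    moreover have iA: "jump_integrable s (patch (ball (x n) \<rho>) A u) (x n)"
      using \<rho> by (intro jump_integrable_patch CA u) auto
    \<comment> \<open>The supremum need not be attained; this loss is one of the two terms in
      \<open>2 / real (Suc n)\<close>, and the other pays for the penalty.\<close>
    ultimately have "\<exists>L\<in>\<L>. f (x n) - e < L (patch (ball (x n) \<rho>) A u) (x n)"
      using e by (intro sup_approx) auto
    then obtain L where L: "L \<in> \<L>" "f (x n) - e < L (patch (ball (x n) \<rho>) A u) (x n)" by blast
    have iE: "jump_integrable s (patch (ball (y n) \<rho>) E v) (y n)"
      using \<rho> by (intro jump_integrable_patch CE v) auto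
    have "L (patch (ball (y n) \<rho>) E v) (y n) \<le> g (y n)"
    proof (rule visc_leD[OF vv \<Omega> v \<rho>(1) _ CE _ _ L(1)])
      show "ball (y n) \<rho> \<subseteq> \<Omega>" using bx K N by blast
      show "E (y n) = v (y n)" by (simp add: E_def norm_minus_commute)
      show "E z \<le> v z" if "z \<in> ball (y n) \<rho>" for z
        using max'[of "x n" z n] that bx xK by (auto simp: E_def norm_minus_commute)
    qed
    moreover have "L (patch (ball (x n) \<rho>) A u) (x n) \<le> L (patch (ball (y n) \<rho>) E v) (y n)
        + L (patch (ball x0 r) \<phi> ?w) x0
        + Lam / 2 * (LINT h|lborel. (4 * k n * (if norm h < \<rho> then (norm h)\<^sup>2 else 0) + \<bar>a n h\<bar>) * jump_density s h)"
    proof (rule op_add_le[OF L(1) iA iE iw, where P = "\<lambda>h. 4 * k n * (if norm h < \<rho> then (norm h)\<^sup>2 else 0) + \<bar>a n h\<bar>"])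
      have "integrable lborel (\<lambda>h::'a. 4 * k n * (if norm h < \<rho> then (norm h)\<^sup>2 * jump_density s h else 0)
          + \<bar>a n h\<bar> * jump_density s h)"
        by (intro Bochner_Integration.integrable_add integrable_mult_right integrable_jump_near lim(2))
      then show "integrable lborel (\<lambda>h. (4 * k n * (if norm h < \<rho> then (norm h)\<^sup>2 else 0) + \<bar>a n h\<bar>) * jump_density s h)"
        by (rule Bochner_Integration.integrable_cong[THEN iffD1, rotated 2]) (auto simp: algebra_simps)
      show "0 \<le> 4 * k n * (if norm h < \<rho> then (norm h)\<^sup>2 else 0) + \<bar>a n h\<bar>" for h :: 'a
        using k0[of n] by simp
      show "second_diff (patch (ball (x n) \<rho>) A u) (x n) h \<le> second_diff (patch (ball (y n) \<rho>) E v) (y n) h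
         + second_diff (patch (ball x0 r) \<phi> ?w) x0 h
         + (4 * k n * (if norm h < \<rho> then (norm h)\<^sup>2 else 0) + \<bar>a n h\<bar>)" for h
      proof -
        \<comment> \<open>Near 0 the test functions are compared, in the annulus the common shift is
          used, and beyond \<open>r\<close> the values themselves.\<close>
        consider "norm h < \<rho>" | "\<rho> \<le> norm h" "norm h < r" | "r \<le> norm h" by linarith
        then show ?thesis
        proof cases
          case 1
          have "second_diff A (x n) h = second_diff \<phi> (x n) h + 2 * k n * (norm h)\<^sup>2"
            unfolding A_def[abs_def] by (subst second_diff_add) (simp only: second_diff_quadratic)
          moreover have "second_diff E (y n) h = - 2 * k n * (norm h)\<^sup>2"
            unfolding E_def[abs_def] second_diff_quadratic by simp
          ultimately show ?thesis
            using 1 \<rho>(2) abs_ge_self[of "a n h"] by (simp add: second_diff_patch_near[OF order_refl] a_def)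
        next
          case 2
          have "second_diff (patch (ball (x n) \<rho>) A u) (x n) h = second_diff u (x n) h"
            "second_diff (patch (ball (y n) \<rho>) E v) (y n) h = second_diff v (y n) h"
            using 2 \<rho> second_diff_patch_far[of \<rho> h "x n" A u] second_diff_patch_far[of \<rho> h "y n" E v]
            by (simp_all add: A_def E_def second_diff_def[of u] second_diff_def[of v] norm_minus_commute)
          then show ?thesis
            using 2 shift[of h n] abs_ge_self[of "a n h"] by (simp add: second_diff_patch_near[OF order_refl] a_def)
        next
          case 3
          have "second_diff (patch (ball (x n) \<rho>) A u) (x n) h = second_diff u (x n) h"
            "second_diff (patch (ball (y n) \<rho>) E v) (y n) h = second_diff v (y n) h"
            using 3 \<rho> second_diff_patch_far[of \<rho> h "x n" A u] second_diff_patch_far[of \<rho> h "y n" E v]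
            by (simp_all add: A_def E_def second_diff_def[of u] second_diff_def[of v] norm_minus_commute)
          then show ?thesis
            using 3 \<rho> r abs_ge_self[of "a n h"] by (simp add: second_diff_patch_far a_def)
        qed
      qed
    qed
    moreover have "(LINT h|lborel. (4 * k n * (if norm h < \<rho> then (norm h)\<^sup>2 else 0) + \<bar>a n h\<bar>) * jump_density s h)
       = 4 * k n * (LINT h::'a|lborel. (if norm h < \<rho> then (norm h)\<^sup>2 else 0) * jump_density s h)
         + (LINT h|lborel. \<bar>a n h\<bar> * jump_density s h)"
    proof -
      have i1: "integrable lborel (\<lambda>h::'a. (if norm h < \<rho> then (norm h)\<^sup>2 else 0) * jump_density s h)"
        using integrable_jump_near[of \<rho>, where 'a='a] by (simp add: if_distrib[of "\<lambda>z. z * _"] cong: if_cong)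
      have "(LINT h|lborel. (4 * k n * (if norm h < \<rho> then (norm h)\<^sup>2 else 0) + \<bar>a n h\<bar>) * jump_density s h)
        = (LINT h|lborel. 4 * k n * ((if norm h < \<rho> then (norm h)\<^sup>2 else 0) * jump_density s h) + \<bar>a n h\<bar> * jump_density s h)"
        by (simp add: distrib_right mult.assoc)
      also have "\<dots> = (LINT h::'a|lborel. 4 * k n * ((if norm h < \<rho> then (norm h)\<^sup>2 else 0) * jump_density s h))
         + (LINT h|lborel. \<bar>a n h\<bar> * jump_density s h)"
        by (intro Bochner_Integration.integral_add integrable_mult_right i1 lim(2))
      finally show ?thesis by (simp only: integral_mult_right_zero)
    qed
    moreover have "Lam / 2 * (4 * k n * (LINT h::'a|lborel. (if norm h < \<rho> then (norm h)\<^sup>2 else 0) * jump_density s h)) \<le> e"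
    proof -
      have "(Lam * 2 * k n) * (LINT h::'a|lborel. (if norm h < \<rho> then (norm h)\<^sup>2 else 0) * jump_density s h)
         \<le> (Lam * 2 * k n) * (e / (2 * k n * Lam))"
        using \<rho>(3) lam k0[of n] by (intro mult_left_mono) auto
      also have "\<dots> = e" using lam k0[of n] by simp
      finally show ?thesis by (simp add: mult_ac)
    qed
    moreover have "L (patch (ball x0 r) \<phi> ?w) x0 \<le> I (patch (ball x0 r) \<phi> ?w) x0" by (rule sup_ge[OF L(1) iw])
    moreover have "2 / real (Suc n) = e + e" by (simp add: e_def)
    ultimately show ?thesis using L(2) by (simp only: distrib_left)
  qed
  have "(\<lambda>n. f (x n) - g (y n)) \<longlonglongrightarrow> f x0 - g x0"
  proof (intro tendsto_diff)
    show "(\<lambda>n. f (x n)) \<longlonglongrightarrow> f x0"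
      using f xlim x0 xN(1) N(3) by (auto simp: continuous_on_sequentially o_def)
    show "(\<lambda>n. g (y n)) \<longlonglongrightarrow> g x0"
      using g ylim x0 xN(2) N(3) by (auto simp: continuous_on_sequentially o_def)
  qed
  moreover have "(\<lambda>n. I (patch (ball x0 r) \<phi> ?w) x0 + 2 / real (Suc n)
      + Lam / 2 * (LINT h|lborel. \<bar>a n h\<bar> * jump_density s h)) \<longlonglongrightarrow> I (patch (ball x0 r) \<phi> ?w) x0 + 0 + Lam / 2 * 0"
    by (intro tendsto_add tendsto_mult_left tendsto_const lim(1)) real_asymp
  ultimately have "f x0 - g x0 \<le> I (patch (ball x0 r) \<phi> ?w) x0 + 0 + Lam / 2 * 0"
    by (rule LIMSEQ_le) (use main in blast)
  then show "\<exists>r>0. ball x0 r \<subseteq> N \<and> f x0 - g x0 \<le> I (patch (ball x0 r) \<phi> ?w) x0"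
    using r sub0 by (intro exI[of _ r]) simp
qed

text \<open>For a fixed operator \<open>- u\<close> is a subsolution, so the difference result
  applies to \<open>- u\<close> and \<open>v\<close>. As the inequality is wanted for every
  operator, none has to be selected.\<close>

lemma visc_le_add:
  assumes \<Omega>: "bounded \<Omega>" and u: "bounded_continuous u" and v: "bounded_continuous v"
    and vu: "visc_le I \<Omega> u f" and vv: "visc_le I \<Omega> v g"
    and f: "continuous_on \<Omega> f" and g: "continuous_on \<Omega> g"
  shows "visc_le I \<Omega> (\<lambda>x. u x + v x) (\<lambda>x. f x + g x)"
  unfolding visc_le_sup_iff[OF \<Omega> bounded_continuous_add[OF u v]]
proof
  fix L assume L: "L \<in> \<L>"
  interpret S: jump_class s lam Lam "{L}" by (rule singleton[OF L])
  have "visc_ge L \<Omega> (\<lambda>x. - u x) (\<lambda>x. - f x)"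
    using vu L visc_le_neg visc_le_sup_iff[OF \<Omega> u] by blast
  moreover have "visc_le L \<Omega> v g" using vv L visc_le_sup_iff[OF \<Omega> v] by blast
  ultimately have "visc_ge L \<Omega> (\<lambda>x. - u x - v x) (\<lambda>x. - f x - g x)"
    using S.visc_ge_diff[OF \<Omega> bounded_continuous_uminus[OF u] v] f g
    unfolding sup_operator_singleton by (simp add: continuous_on_minus)
  then show "visc_le L \<Omega> (\<lambda>x. u x + v x) (\<lambda>x. f x + g x)"
    unfolding visc_le_neg[OF L] by (simp add: algebra_simps)
qed

end

section \<open>Exterior balls\<close>

text \<open>The mean value theorem on the segment and the Lipschitz gradient give the quadratic
  error. For the boundary graph this places a downward paraboloid beneath it.\<close>

lemma Ck_closure_taylor_lower:
  fixes f :: "'a::euclidean_space \<Rightarrow> real"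
  assumes C2: "Ck_closure 2 N f" and N: "cball x0 r \<subseteq> N"
  obtains C where "0 \<le> C" "\<And>x y. x \<in> cball x0 r \<Longrightarrow> y \<in> cball x0 r \<Longrightarrow>
     f x + frechet_derivative f (at x) (y - x) - C * (norm (y - x))\<^sup>2 \<le> f y"
proof -
  obtain C where C: "0 \<le> C" "\<And>x y h. x \<in> cball x0 r \<Longrightarrow> y \<in> cball x0 r \<Longrightarrow>
     \<bar>frechet_derivative f (at x) h - frechet_derivative f (at y) h\<bar> \<le> C * norm h * norm (x - y)"
    using Ck_closure_gradient_lipschitz[OF assms] by blast
  show ?thesis
  proof (rule that[OF C(1)])
    fix x y assume xy: "x \<in> cball x0 r" "y \<in> cball x0 r"
    let ?h = "y - x"
    have seg: "x + t *\<^sub>R ?h \<in> cball x0 r" if "0 \<le> t" "t \<le> 1" for t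
    proof -
      have "(1 - t) *\<^sub>R x + t *\<^sub>R y \<in> cball x0 r"
        using convexD_alt[OF convex_cball xy that] .
      moreover have "(1 - t) *\<^sub>R x + t *\<^sub>R y = x + t *\<^sub>R ?h" by (simp add: algebra_simps)
      ultimately show ?thesis by simp
    qed
    have fd: "(f has_derivative frechet_derivative f (at z)) (at z)" if "z \<in> cball x0 r" for z
      using Ck_closure_SucD1[OF C2[unfolded numeral_2_eq_2], of z] N that by blast
    have der: "((\<lambda>t. f (x + t *\<^sub>R ?h)) has_real_derivative frechet_derivative f (at (x + t *\<^sub>R ?h)) ?h) (at t)"
      if t: "0 \<le> t" "t \<le> 1" for t
    proof -
      let ?D1 = "frechet_derivative f (at (x + t *\<^sub>R ?h))"
      have "(f \<circ> (\<lambda>t. x + t *\<^sub>R ?h) has_derivative ?D1 \<circ> (\<lambda>k. k *\<^sub>R ?h)) (at t)"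
        by (intro diff_chain_at fd seg t) (auto intro!: derivative_eq_intros)
      moreover have "linear ?D1" using fd[OF seg[OF t]] by (auto dest: has_derivative_linear)
      ultimately have "((\<lambda>t. f (x + t *\<^sub>R ?h)) has_derivative (\<lambda>k. k * ?D1 ?h)) (at t)"
        by (simp add: o_def linear_cmul)
      moreover have "(\<lambda>k. k * ?D1 ?h) = (*) (?D1 ?h)" by (auto simp: mult.commute)
      ultimately show ?thesis by (simp add: has_field_derivative_def)
    qed
    obtain t where t: "0 < t" "t < 1"
      "f (x + 1 *\<^sub>R ?h) - f (x + 0 *\<^sub>R ?h) = (1 - 0) * frechet_derivative f (at (x + t *\<^sub>R ?h)) ?h"
      using MVT2[of 0 1 "\<lambda>t. f (x + t *\<^sub>R ?h)" "\<lambda>t. frechet_derivative f (at (x + t *\<^sub>R ?h)) ?h"] der zero_less_one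
      by blast
    have "\<bar>frechet_derivative f (at (x + t *\<^sub>R ?h)) ?h - frechet_derivative f (at x) ?h\<bar>
        \<le> C * norm ?h * norm ((x + t *\<^sub>R ?h) - x)"
      by (rule C(2)[OF seg xy(1)]) (use t in auto)
    also have "norm ((x + t *\<^sub>R ?h) - x) = t * norm ?h" using t by simp
    also have "C * norm ?h * (t * norm ?h) \<le> C * norm ?h * (1 * norm ?h)"
      using t C(1) by (intro mult_left_mono mult_right_mono) auto
    finally have "frechet_derivative f (at x) ?h - C * (norm ?h)\<^sup>2 \<le> frechet_derivative f (at (x + t *\<^sub>R ?h)) ?h"
      unfolding power2_eq_square by (simp add: abs_le_iff mult.assoc)
    then show "f x + frechet_derivative f (at x) ?h - C * (norm ?h)\<^sup>2 \<le> f y"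
      using t(3) by simp
  qed
qed

text \<open>Small balls fit under the paraboloid that lies below the graph. All radii
  \<open>R \<le> \<rho>\<close> and all nearby \<open>p\<close> are covered, so that finitely many
  charts can share one radius.\<close>

lemma exterior_ball_local:
  fixes \<Omega> :: "'a::euclidean_space set"
  assumes op: "open \<Omega>" and sb: "smooth_boundary \<Omega>" and z: "z \<in> frontier \<Omega>"
  shows "\<exists>\<rho>>0. \<forall>p\<in>frontier \<Omega> \<inter> ball z \<rho>. \<forall>R. 0 < R \<and> R \<le> \<rho> \<longrightarrow> (\<exists>c. dist p c = R \<and> ball c R \<inter> \<Omega> = {})"
proof -
  obtain r e \<gamma> where r: "r > 0" and e: "norm e = 1" and sm: "smooth_function \<gamma>" and
    gr: "\<Omega> \<inter> ball z r = {x \<in> ball z r. x \<bullet> e > \<gamma> (x - (x \<bullet> e) *\<^sub>R e)}"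
    using sb z unfolding smooth_boundary_def by blast
  define P where "P x = x - (x \<bullet> e) *\<^sub>R e" for x
  have ee: "e \<bullet> e = 1" using e by (simp add: norm_eq_1)
  have lP: "linear P" unfolding P_def[abs_def]
    by (rule linearI) (auto simp: inner_add_left algebra_simps)
  have Pe: "P e = 0" by (simp add: P_def ee)
  have Pn: "norm (P x) \<le> norm x" for x
  proof -
    have "(norm (P x))\<^sup>2 = (norm x)\<^sup>2 - (x \<bullet> e)\<^sup>2"
      unfolding P_def power2_norm_eq_inner by (simp add: inner_diff_left inner_diff_right ee power2_eq_square inner_commute)
    then have "(norm (P x))\<^sup>2 \<le> (norm x)\<^sup>2" by simp
    then show ?thesis by (rule power2_le_imp_le) simp
  qed
  have C2: "Ck_closure 2 UNIV \<gamma>" using sm by (simp add: smooth_function_def)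
  have contg: "continuous_on UNIV \<gamma>" by (rule Ck_closure_continuous_on[OF C2])
  have gd: "(\<gamma> has_derivative frechet_derivative \<gamma> (at x)) (at x)" for x
    using Ck_closure_SucD1[OF C2[unfolded numeral_2_eq_2], of x] by simp
  obtain C where C: "0 \<le> C" "\<And>x y. x \<in> cball (P z) r \<Longrightarrow> y \<in> cball (P z) r \<Longrightarrow>
     \<gamma> x + frechet_derivative \<gamma> (at x) (y - x) - C * (norm (y - x))\<^sup>2 \<le> \<gamma> y"
    by (rule Ck_closure_taylor_lower[OF C2 subset_UNIV]) (rule that)
  \<comment> \<open>Points of the exterior ball are closer than \<open>2 * R\<close> to
    \<open>p\<close>, so \<open>r / 4\<close> keeps them in the chart; the other bound gives
    \<open>2 * R * C \<le> 1\<close>, which closes the contradiction below.\<close>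
  define \<rho> where "\<rho> = min (r / 4) (1 / (2 * (C + 1)))"
  have \<rho>: "0 < \<rho>" using r C(1) by (simp add: \<rho>_def)
  have gr': "x \<in> \<Omega> \<longleftrightarrow> x \<bullet> e > \<gamma> (P x)" if "x \<in> ball z r" for x
  proof -
    have "x \<in> \<Omega> \<longleftrightarrow> x \<in> \<Omega> \<inter> ball z r" using that by blast
    also have "\<dots> \<longleftrightarrow> x \<bullet> e > \<gamma> (P x)" unfolding gr P_def using that by blast
    finally show ?thesis .
  qed
  have PB: "P x \<in> cball (P z) r" if "x \<in> ball z r" for x
  proof -
    have "norm (P z - P x) = norm (P (z - x))" using lP by (simp add: linear_diff)
    then show ?thesis using Pn[of "z - x"] that by (simp add: dist_norm)
  qed
  show ?thesis
  proof (intro exI[of _ \<rho>] conjI \<rho> ballI allI impI)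
    fix p R assume p: "p \<in> frontier \<Omega> \<inter> ball z \<rho>" and R: "0 < R \<and> R \<le> \<rho>"
    have pz: "dist z p < r / 4" using p by (simp add: \<rho>_def)
    have pb: "p \<in> ball z r" using pz r by simp
    have pO: "p \<notin> \<Omega>" "p \<in> closure \<Omega>" using p op by (auto simp: frontier_def interior_open)
    \<comment> \<open>A boundary point of the open set is not above the graph; strictly below it, a
      whole neighbourhood would miss \<open>\<Omega>\<close>.\<close>
    have peq: "p \<bullet> e = \<gamma> (P p)"
    proof (rule ccontr)
      assume "p \<bullet> e \<noteq> \<gamma> (P p)"
      then have lt: "p \<bullet> e < \<gamma> (P p)" using gr'[OF pb] pO by simp
      have "continuous_on UNIV (\<lambda>x. \<gamma> (P x))"
        by (rule continuous_on_compose2[OF contg]) (use lP in \<open>auto intro: linear_continuous_on linear_conv_bounded_linear[THEN iffD1]\<close>)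
      then have "open {x. x \<bullet> e < \<gamma> (P x)}" by (intro open_Collect_less continuous_intros)
      then have "open ({x. x \<bullet> e < \<gamma> (P x)} \<inter> ball z r)" by blast
      moreover have "p \<in> {x. x \<bullet> e < \<gamma> (P x)} \<inter> ball z r" using lt pb by blast
      ultimately have "({x. x \<bullet> e < \<gamma> (P x)} \<inter> ball z r) \<inter> \<Omega> \<noteq> {}"
        using pO(2) open_Int_closure_eq_empty[of "{x. x \<bullet> e < \<gamma> (P x)} \<inter> ball z r" \<Omega>] by blast
      then obtain x where "x \<in> \<Omega>" "x \<in> {x. x \<bullet> e < \<gamma> (P x)} \<inter> ball z r" by blast
      then show False using gr'[of x] by simp
    qed
    let ?G = "frechet_derivative \<gamma> (at (P p))"
    \<comment> \<open>\<open>l\<close> is the differential of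
      \<open>x \<bullet> e - \<gamma> (P x)\<close> at \<open>p\<close> and \<open>a\<close> its
      gradient, which points into \<open>\<Omega>\<close>; the centre is placed along
      \<open>- a\<close>. From \<open>a \<bullet> e = 1\<close> follows
      \<open>1 \<le> norm a\<close>.\<close>
    define l where "l v = v \<bullet> e - ?G (P v)" for v
    have lG: "linear ?G" by (rule has_derivative_linear[OF gd])
    have ll: "linear l" unfolding l_def[abs_def]
      using linear_compose[OF lP lG] by (intro linear_compose_sub) (auto simp: o_def intro: bounded_linear.linear bounded_linear_inner_left)
    define a where "a = (\<Sum>b\<in>Basis. l b *\<^sub>R b)"
    have a: "a \<bullet> v = l v" for v
    proof -
      have "l v = l (\<Sum>b\<in>Basis. (v \<bullet> b) *\<^sub>R b)" by (simp add: euclidean_representation)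
      also have "\<dots> = (\<Sum>b\<in>Basis. (v \<bullet> b) * l b)" using ll by (simp add: linear_sum linear_cmul)
      also have "\<dots> = a \<bullet> v" unfolding a_def inner_sum_left by (intro sum.cong refl) (simp add: inner_commute)
      finally show ?thesis ..
    qed
    have "a \<bullet> e = 1" unfolding a l_def using lG by (simp add: Pe ee linear_0)
    then have an: "1 \<le> norm a" using norm_cauchy_schwarz[of a e] e by simp
    have a0: "a \<noteq> 0" using an by auto
    define c where "c = p - (R / norm a) *\<^sub>R a"
    have "dist p c = R" using a0 R by (simp add: c_def dist_norm)
    moreover have "ball c R \<inter> \<Omega> = {}"
    proof (rule ccontr)
      assume "ball c R \<inter> \<Omega> \<noteq> {}"
      then obtain x where x: "norm (x - c) < R" "x \<in> \<Omega>" by (auto simp: dist_norm norm_minus_commute)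
      let ?v = "x - p"
      have "norm ?v \<le> norm (x - c) + norm (c - p)" using norm_triangle_ineq[of "x - c" "c - p"] by simp
      also have "norm (c - p) = R" using \<open>dist p c = R\<close> by (simp add: dist_norm norm_minus_commute)
      finally have vn: "norm ?v < 2 * R" using x(1) by simp
      have "dist z x \<le> dist z p + dist p x" by (rule dist_triangle)
      also have "\<dots> < r / 4 + 2 * (r / 4)"
        using pz vn R by (simp add: \<rho>_def dist_norm norm_minus_commute)
      finally have xb: "x \<in> ball z r" using r by simp
      have "\<gamma> (P p) + ?G (P x - P p) - C * (norm (P x - P p))\<^sup>2 \<le> \<gamma> (P x)"
        by (rule C(2)[OF PB[OF pb] PB[OF xb]])
      also have "\<dots> < x \<bullet> e" using gr'[OF xb] x(2) by simp
      also have "P x - P p = P ?v" using lP by (simp add: linear_diff)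
      finally have "- C * (norm (P ?v))\<^sup>2 < a \<bullet> ?v" unfolding a l_def using peq by (simp add: inner_diff_left)
      moreover have "C * (norm (P ?v))\<^sup>2 \<le> C * (norm ?v)\<^sup>2"
        using Pn[of ?v] C(1) by (intro mult_left_mono power_mono) auto
      ultimately have lo: "- C * (norm ?v)\<^sup>2 < a \<bullet> ?v" by simp
      \<comment> \<open>Membership in the ball forces \<open>a \<bullet> (x - p)\<close> below a
        negative multiple of the squared distance to \<open>p\<close> that is too steep for the
        paraboloid.\<close>
      have "(norm (x - c))\<^sup>2 < R\<^sup>2" using x(1) by (intro power_strict_mono) auto
      also have "x - c = ?v + (R / norm a) *\<^sub>R a" by (simp add: c_def)
      also have "(norm (?v + (R / norm a) *\<^sub>R a))\<^sup>2 = (norm ?v)\<^sup>2 + 2 * (R / norm a) * (a \<bullet> ?v) + R\<^sup>2"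
      proof -
        have "((R / norm a) *\<^sub>R a) \<bullet> ((R / norm a) *\<^sub>R a) = R\<^sup>2"
          using a0 R by (simp add: power2_norm_eq_inner[symmetric] power_mult_distrib power_divide)
        then show ?thesis unfolding power2_norm_eq_inner
          by (simp add: inner_add_left inner_add_right inner_commute)
      qed
      finally have "(norm ?v)\<^sup>2 < (2 * R / norm a) * (- (a \<bullet> ?v))" by simp
      also have "\<dots> \<le> (2 * R / norm a) * (C * (norm ?v)\<^sup>2)"
        using lo R an by (intro mult_left_mono) auto
      also have "\<dots> \<le> (2 * R / 1) * (C * (norm ?v)\<^sup>2)"
        using R an C(1) by (intro mult_right_mono divide_left_mono) auto
      finally have "(norm ?v)\<^sup>2 * 1 < (norm ?v)\<^sup>2 * (2 * R * C)" by (simp add: mult_ac)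
      moreover have "2 * R * C \<le> 1"
      proof -
        have "R \<le> 1 / (2 * (C + 1))" using R by (simp add: \<rho>_def)
        then have "R * (2 * (C + 1)) \<le> 1" using C(1) by (simp add: field_simps)
        then show ?thesis using R by (simp add: algebra_simps)
      qed
      then have "(norm ?v)\<^sup>2 * (2 * R * C) \<le> (norm ?v)\<^sup>2 * 1" by (intro mult_left_mono) auto
      ultimately show False by simp
    qed
    ultimately show "\<exists>c. dist p c = R \<and> ball c R \<inter> \<Omega> = {}" by blast
  qed
qed

text \<open>By compactness of the boundary the least of finitely many local radii serves
  everywhere.\<close>

lemma exterior_ball:
  fixes \<Omega> :: "'a::euclidean_space set"
  assumes op: "open \<Omega>" and sb: "smooth_boundary \<Omega>" and bd: "bounded \<Omega>"
  obtains R where "0 < R" "\<And>p. p \<in> frontier \<Omega> \<Longrightarrow> \<exists>c. dist p c = R \<and> ball c R \<inter> \<Omega> = {}"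
proof -
  have "\<forall>z\<in>frontier \<Omega>. \<exists>\<rho>>0. \<forall>p\<in>frontier \<Omega> \<inter> ball z \<rho>. \<forall>R. 0 < R \<and> R \<le> \<rho> \<longrightarrow> (\<exists>c. dist p c = R \<and> ball c R \<inter> \<Omega> = {})"
    using exterior_ball_local[OF op sb] by blast
  then obtain \<rho> where \<rho>: "\<And>z. z \<in> frontier \<Omega> \<Longrightarrow> 0 < \<rho> z"
    "\<And>z p R. z \<in> frontier \<Omega> \<Longrightarrow> p \<in> frontier \<Omega> \<inter> ball z (\<rho> z) \<Longrightarrow> 0 < R \<Longrightarrow> R \<le> \<rho> z \<Longrightarrow>
       \<exists>c. dist p c = R \<and> ball c R \<inter> \<Omega> = {}"
    unfolding bchoice_iff by blast
  have "compact (frontier \<Omega>)" using bd by (rule compact_frontier_bounded)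
  moreover have "frontier \<Omega> \<subseteq> (\<Union>z\<in>frontier \<Omega>. ball z (\<rho> z))" using \<rho>(1) by force
  ultimately obtain D where D: "D \<subseteq> frontier \<Omega>" "finite D" "frontier \<Omega> \<subseteq> (\<Union>z\<in>D. ball z (\<rho> z))"
    using compactE_image[of "frontier \<Omega>" "frontier \<Omega>" "\<lambda>z. ball z (\<rho> z)"] by auto
  \<comment> \<open>The inserted 1 makes the minimum meaningful even for an empty cover.\<close>
  define R where "R = Min (insert 1 (\<rho> ` D))"
  have R: "0 < R" unfolding R_def using D \<rho>(1) by (subst Min_gr_iff) auto
  have Rle: "R \<le> \<rho> z" if "z \<in> D" for z unfolding R_def using D(2) that by (intro Min_le) auto
  show thesis
  proof (rule that[OF R])
    fix p assume p: "p \<in> frontier \<Omega>"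
    then obtain z where "z \<in> D" "p \<in> ball z (\<rho> z)" using D(3) by blast
    then show "\<exists>c. dist p c = R \<and> ball c R \<inter> \<Omega> = {}"
      using \<rho>(2)[of z p R] p D(1) R Rle by blast
  qed
qed

text \<open>The concave power lies below its tangent at 1; this is Young's inequality with second
  argument 1.\<close>

lemma powr_bernoulli:
  assumes "0 \<le> a" "a \<le> 1" "0 \<le> (x::real)"
  shows "x powr a \<le> 1 + a * (x - 1)"
proof (cases "x = 0")
  case False
  then show ?thesis
    using Youngs_inequality_0[of a "1 - a" x 1] assms by (simp add: algebra_simps)
qed (use assms in simp)

definition exterior_distance_power :: "real \<Rightarrow> 'a::euclidean_space \<Rightarrow> real \<Rightarrow> 'a \<Rightarrow> real" where
  "exterior_distance_power a z R x = (max 0 (norm (x - z) - R)) powr a"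

text \<open>Every upward contribution carries the factor \<open>a\<close>, whereas a jump into the
  ball loses the full \<open>t powr a\<close>; a small \<open>a\<close> lets the loss win. In
  \<open>1 + 4 / s\<close> the 1 covers jumps of length at most \<open>t\<close> and
  \<open>4 / s\<close> the longer ones.\<close>

lemma second_diff_exterior_distance_power:
  fixes x z y :: "'a::euclidean_space"
  assumes s: "0 < s" "s < 1" and a: "0 < a" "a \<le> s" and R: "0 < R"
    and t: "t = norm (x - z) - R" "0 < t"
  shows "second_diff (exterior_distance_power a z R) x y \<le>
      a * t powr a * (1 + 4 / s) * min ((norm (y /\<^sub>R t))\<^sup>2) (norm (y /\<^sub>R t) powr s)
      - (if x + y \<in> ball z R then t powr a else 0)"
proof -
  let ?b = "exterior_distance_power a z R"
  define q where "q = norm y / t"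
  have q: "norm (y /\<^sub>R t) = q" "0 \<le> q" using t by (auto simp: q_def divide_inverse mult.commute)
  have bx: "?b x = t powr a" using t by (simp add: exterior_distance_power_def)
  have tpos: "0 < t powr a" using t by simp
  show ?thesis
  proof (cases "norm y \<le> t")
    case True
    then have q1: "q \<le> 1" using t by (simp add: q_def)
    have "q\<^sup>2 \<le> q powr s"
    proof (cases "q = 0")
      case False
      then show ?thesis using q q1 s powr_mono'[of s 2 q] by (simp add: powr_numeral)
    qed simp
    then have m: "min (q\<^sup>2) (q powr s) = q\<^sup>2" by simp
    let ?A = "norm (x - z)"
    let ?t1 = "norm (x + y - z) - R" and ?t2 = "norm (x - y - z) - R"
    have e1: "x + y - z = (x - z) + y" "x - y - z = (x - z) - y" by simp_all
    have t1: "0 \<le> ?t1" "0 \<le> ?t2"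
      using norm_diff_ineq[of "x - z" y] norm_triangle_ineq2[of "x - z" y] True t unfolding e1 by linarith+
    \<comment> \<open>Concavity replaces the power by its tangent at distance \<open>t\<close>, so
      only the second difference of the norm remains.\<close>
    have tan: "\<tau> powr a \<le> t powr a * (1 + a * (\<tau> / t - 1))" if "0 \<le> \<tau>" for \<tau>
    proof -
      have "\<tau> powr a = t powr a * (\<tau> / t) powr a" using t that by (simp add: powr_divide)
      also have "\<dots> \<le> t powr a * (1 + a * (\<tau> / t - 1))"
        using that t a s by (intro mult_left_mono powr_bernoulli) auto
      finally show ?thesis .
    qed
    have b1: "?b (x + y) \<le> t powr a * (1 + a * (?t1 / t - 1))" "?b (x - y) \<le> t powr a * (1 + a * (?t2 / t - 1))"
      using tan[OF t1(1)] tan[OF t1(2)] t1 by (simp_all add: exterior_distance_power_def max_def)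
    have "second_diff ?b x y \<le> t powr a * (a * ((?t1 + ?t2 - 2 * t) / t))"
    proof -
      have "T * (1 + a * (p / t - 1)) + T * (1 + a * (r / t - 1)) - 2 * T = T * (a * ((p + r - 2 * t) / t))" for T p r
        using t(2) by (simp add: field_simps)
      from this[of "t powr a" ?t1 ?t2] show ?thesis using b1 bx unfolding second_diff_def by linarith
    qed
    also have "?t1 + ?t2 - 2 * t = norm ((x - z) + y) + norm ((x - z) - y) - 2 * ?A" unfolding e1 t by simp
    also have "t powr a * (a * ((norm ((x - z) + y) + norm ((x - z) - y) - 2 * ?A) / t)) \<le> t powr a * (a * (((norm y)\<^sup>2 / t) / t))"
    proof (intro mult_left_mono divide_right_mono)
      let ?p = "norm ((x - z) + y)" and ?r = "norm ((x - z) - y)"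
      have A: "0 < ?A" "t \<le> ?A" using t R by auto
      \<comment> \<open>The parallelogram law bounds the second difference of the norm by
        \<open>(norm y)\<^sup>2 / norm (x - z)\<close>; then \<open>t \<le> norm (x - z)\<close>
        makes the bound homogeneous in \<open>t\<close>.\<close>
      have "?p\<^sup>2 + ?r\<^sup>2 = 2 * ?A\<^sup>2 + 2 * (norm y)\<^sup>2"
        unfolding power2_norm_eq_inner by (simp add: algebra_simps inner_commute)
      moreover have "(?p + ?r)\<^sup>2 \<le> 2 * (?p\<^sup>2 + ?r\<^sup>2)"
        using zero_le_power2[of "?p - ?r"] by (simp add: power2_eq_square algebra_simps)
      ultimately have "(?p + ?r)\<^sup>2 \<le> 4 * ?A\<^sup>2 + 4 * (norm y)\<^sup>2" by simp
      also have "\<dots> \<le> (2 * ?A + (norm y)\<^sup>2 / ?A)\<^sup>2"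
        using A by (simp add: power2_sum power_divide)
      finally have "?p + ?r \<le> 2 * ?A + (norm y)\<^sup>2 / ?A"
        by (rule power2_le_imp_le) (use A in simp)
      also have "(norm y)\<^sup>2 / ?A \<le> (norm y)\<^sup>2 / t" using A t by (intro divide_left_mono) auto
      finally show "?p + ?r - 2 * ?A \<le> (norm y)\<^sup>2 / t" by simp
    qed (use t a in auto)
    also have "\<dots> = a * t powr a * q\<^sup>2" using t by (simp add: q_def power2_eq_square)
    also have "\<dots> \<le> a * t powr a * (1 + 4 / s) * q\<^sup>2"
      using a s tpos by (simp add: algebra_simps)
    finally have "second_diff ?b x y \<le> a * t powr a * (1 + 4 / s) * q\<^sup>2" .
    \<comment> \<open>A jump no longer than \<open>t\<close> cannot enter the open ball, so there is
      no loss to account for.\<close>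
    moreover have "x + y \<notin> ball z R"
      using t1(1) by (simp add: dist_norm norm_minus_commute)
    ultimately show ?thesis unfolding q(1) m by simp
  next
    case False
    then have q1: "1 < q" using t by (simp add: q_def)
    have "q powr s \<le> q powr 2" using q1 s by (intro powr_mono) auto
    then have m: "min (q\<^sup>2) (q powr s) = q powr s" using q1 by (simp add: powr_numeral)
    let ?E = "t powr a * ((a / s) * (2 * q powr s))"
    have far: "?b w \<le> t powr a + ?E" if "norm (w - z) \<le> norm (x - z) + norm y" for w
    proof -
      have "?b w \<le> (t + norm y) powr a"
        unfolding exterior_distance_power_def using that t a by (intro powr_mono2) auto
      also have "t + norm y = t * (1 + q)" using t by (simp add: q_def algebra_simps)
      also have "(t * (1 + q)) powr a = t powr a * (1 + q) powr a" using t q by (simp add: powr_mult)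
      \<comment> \<open>An \<open>a / s\<close> power of an \<open>s\<close> power: Bernoulli's
        inequality then extracts the factor \<open>a\<close> and leaves the integrable growth
        \<open>q powr s\<close>.\<close>
      also have "(1 + q) powr a = ((1 + q) powr s) powr (a / s)" using s by (simp add: powr_powr)
      also have "\<dots> \<le> 1 + (a / s) * ((1 + q) powr s - 1)"
        using a s by (intro powr_bernoulli) auto
      also have "\<dots> \<le> 1 + (a / s) * (2 * q powr s)"
      proof -
        have "(1 + q) powr s \<le> (2 * q) powr s" using q1 s by (intro powr_mono2) auto
        also have "\<dots> = 2 powr s * q powr s" using q1 by (simp add: powr_mult)
        also have "\<dots> \<le> 2 powr 1 * q powr s" using s by (intro mult_right_mono powr_mono) auto
        finally have "(1 + q) powr s - 1 \<le> 2 * q powr s" by simp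
        then show ?thesis using a s by (intro add_left_mono mult_left_mono) auto
      qed
      finally show ?thesis using tpos by (simp add: algebra_simps)
    qed
    have E0: "0 \<le> ?E" using a s by simp
    have Eq: "2 * ?E \<le> a * t powr a * (1 + 4 / s) * q powr s"
      using a s tpos q by (simp add: field_simps)
    have f1: "?b (x + y) \<le> t powr a + ?E" "?b (x - y) \<le> t powr a + ?E"
    proof -
      have "x + y - z = (x - z) + y" "x - y - z = (x - z) - y" by simp_all
      then show "?b (x + y) \<le> t powr a + ?E" "?b (x - y) \<le> t powr a + ?E"
        using norm_triangle_ineq[of "x - z" y] norm_triangle_ineq4[of "x - z" y] by (metis far)+
    qed
    show ?thesis
    proof (cases "x + y \<in> ball z R")
      case True
      then have "?b (x + y) = 0" by (simp add: exterior_distance_power_def dist_norm norm_minus_commute)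
      then show ?thesis unfolding q(1) m using True f1 bx Eq E0 by (simp add: second_diff_def)
    next
      case False
      then show ?thesis unfolding q(1) m using f1 bx Eq by (simp add: second_diff_def)
    qed
  qed
qed

section \<open>The boundary barrier\<close>

lemma bounded_continuous_support:
  fixes u :: "'a::euclidean_space \<Rightarrow> real"
  assumes "continuous_on UNIV u" "bounded \<Omega>" "\<And>x. x \<notin> \<Omega> \<Longrightarrow> u x = 0"
  shows "bounded_continuous u"
proof -
  have "compact (u ` closure \<Omega>)"
    using assms by (intro compact_continuous_image continuous_on_subset[OF assms(1)]) auto
  then have "bounded (u ` closure \<Omega>)" by (rule compact_imp_bounded)
  then obtain B where B: "\<And>x. x \<in> closure \<Omega> \<Longrightarrow> \<bar>u x\<bar> \<le> B" unfolding bounded_iff by auto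
  show ?thesis
  proof (rule bounded_continuousI[OF assms(1), of "\<bar>B\<bar>"])
    show "\<bar>u x\<bar> \<le> \<bar>B\<bar>" for x
    proof (cases "x \<in> \<Omega>")
      case True
      then have "\<bar>u x\<bar> \<le> B" using closure_subset by (intro B) auto
      then show ?thesis by simp
    next
      case False
      then show ?thesis using assms(3) by simp
    qed
  qed
qed

context jump_class
begin

text \<open>By scaling, both contributions are \<open>t powr (a - 2 * s)\<close> times constants
  independent of \<open>a\<close>, \<open>z\<close>, \<open>R\<close> and \<open>t\<close>, so
  \<open>a\<close> can be chosen afterwards. In the application \<open>w\<close> is a patched test
  function below the ball barrier, equal to it at \<open>x\<close>.\<close>

lemma op_exterior_distance_power:
  obtains A \<kappa> where "0 \<le> A" "0 < \<kappa>"
    "\<And>L w a z R x t. L \<in> \<L> \<Longrightarrow> jump_integrable s w x \<Longrightarrow> 0 < a \<Longrightarrow> a \<le> s \<Longrightarrow> 0 < R \<Longrightarrow>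
       t = norm (x - z) - R \<Longrightarrow> 0 < t \<Longrightarrow>
       \<forall>y. second_diff w x y \<le> second_diff (exterior_distance_power a z R) x y \<Longrightarrow>
       L w x \<le> t powr (a - 2 * s) * (a * A - (if t \<le> R then \<kappa> else 0))"
proof -
  define M where "M = (LINT y::'a|lborel. min ((norm y)\<^sup>2) (norm y powr s) * jump_density s y)"
  define A where "A = Lam / 2 * ((1 + 4 / s) * M)"
  define d where "d = real DIM('a)"
  define V where "V = unit_ball_vol (real DIM('a))"
  \<comment> \<open>The volume of a ball of radius \<open>t\<close> times the least density
    \<open>(3 * t) powr (- d - 2 * s)\<close> over the jumps that reach it, with the powers of
    \<open>t\<close> split off.\<close>
  define \<kappa> where "\<kappa> = lam / 2 * (V * 3 powr (- d - 2 * s))"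
  have M0: "0 \<le> M" unfolding M_def by (intro Bochner_Integration.integral_nonneg) auto
  have A0: "0 \<le> A" using M0 lam s by (auto simp: A_def)
  have V0: "0 < V" by (simp add: V_def)
  have \<kappa>0: "0 < \<kappa>" using lam V0 by (simp add: \<kappa>_def)
  show thesis
  proof (rule that[OF A0 \<kappa>0])
    fix L and w :: "'a \<Rightarrow> real" and a and z :: 'a and R and x :: 'a and t
    assume L: "L \<in> \<L>" and w: "jump_integrable s w x" and a: "0 < a" "a \<le> s" and R: "0 < R"
      and t: "t = norm (x - z) - R" "0 < t"
      and "\<forall>y. second_diff w x y \<le> second_diff (exterior_distance_power a z R) x y"
    then have le: "\<And>y. second_diff w x y \<le> second_diff (exterior_distance_power a z R) x y" by blast
    define P where "P y = a * t powr a * (1 + 4 / s) * min ((norm (y /\<^sub>R t))\<^sup>2) (norm (y /\<^sub>R t) powr s)" for y :: 'a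
    have Pint: "integrable lborel (\<lambda>y. P y * jump_density s y)"
      unfolding P_def mult.assoc[of _ "min _ _"]
      by (intro integrable_mult_right integrable_jump_min_scale t s)
    have P0: "0 \<le> P y" for y using a s unfolding P_def by (intro mult_nonneg_nonneg) auto
    have tp: "t powr a * t powr (- 2 * s) = t powr (a - 2 * s)" by (simp add: powr_add[symmetric])
    have "(LINT y|lborel. P y * jump_density s y) = a * t powr a * (1 + 4 / s) * (t powr (- 2 * s) * M)"
      unfolding P_def mult.assoc[of _ "min _ _"] integral_mult_right_zero integral_jump_min_scale[OF t(2)] M_def ..
    also have "\<dots> = t powr (a - 2 * s) * (a * ((1 + 4 / s) * M))" unfolding tp[symmetric] by (simp only: mult_ac)
    finally have PA: "Lam / 2 * (LINT y|lborel. P y * jump_density s y) = t powr (a - 2 * s) * (a * A)"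
      by (simp add: A_def mult_ac)
    note sd = second_diff_exterior_distance_power[OF s a R t]
    show "L w x \<le> t powr (a - 2 * s) * (a * A - (if t \<le> R then \<kappa> else 0))"
    proof (cases "t \<le> R")
      case False
      have "second_diff w x y \<le> P y - 0" for y
      proof -
        have "0 \<le> (if x + y \<in> ball z R then t powr a else 0)" by simp
        then show ?thesis using le[of y] sd[of y] unfolding P_def by linarith
      qed
      from op_upper[OF L w Pint P0 _ _ this] have "L w x \<le> t powr (a - 2 * s) * (a * A)"
        using PA by simp
      then show ?thesis using False by simp
    next
      case True
      \<comment> \<open>The point at distance \<open>2 * t\<close> from \<open>x\<close> towards
        \<open>z\<close>. As \<open>t \<le> R\<close>, its ball of radius \<open>t\<close> lies in
        \<open>ball z R\<close>, and jumps into it have length between \<open>t\<close> and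
        \<open>3 * t\<close>.\<close>
      define c where "c = x - (2 * t / norm (x - z)) *\<^sub>R (x - z)"
      have nz: "0 < norm (x - z)" using t R by linarith
      have cx: "norm (c - x) = 2 * t" using nz t by (simp add: c_def)
      have cz: "norm (c - z) = R - t"
      proof -
        have "c - z = (1 - 2 * t / norm (x - z)) *\<^sub>R (x - z)" by (simp add: c_def algebra_simps)
        then have "norm (c - z) = \<bar>(1 - 2 * t / norm (x - z)) * norm (x - z)\<bar>" by (simp add: abs_mult)
        also have "(1 - 2 * t / norm (x - z)) * norm (x - z) = norm (x - z) - 2 * t"
          using nz by (simp add: field_simps)
        finally show ?thesis using t True by simp
      qed
      define S where "S = ball (c - x) t"
      have S1: "x + y \<in> ball z R" if "y \<in> S" for y
      proof -
        have "norm (x + y - z) \<le> norm (y - (c - x)) + norm (c - z)"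
          using norm_triangle_ineq[of "y - (c - x)" "c - z"] by (simp add: algebra_simps)
        also have "\<dots> < t + (R - t)" using that cz by (simp add: S_def dist_norm norm_minus_commute)
        finally show ?thesis by (simp add: dist_norm norm_minus_commute)
      qed
      have S2: "t < norm y" "norm y \<le> 3 * t" if "y \<in> S" for y
      proof -
        have *: "norm (y - (c - x)) < t" using that by (simp add: S_def dist_norm norm_minus_commute)
        show "t < norm y" using * cx norm_triangle_sub[of "c - x" y] by (simp add: norm_minus_commute)
        show "norm y \<le> 3 * t" using * cx norm_triangle_sub[of y "c - x"] by simp
      qed
      define G where "G y = t powr a * indicator S y" for y
      have G0: "0 \<le> G y" for y by (simp add: G_def)
      have [measurable]: "S \<in> sets borel" by (simp add: S_def)
      have Gint: "integrable lborel (\<lambda>y. G y * jump_density s y)"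
      proof (rule Bochner_Integration.integrable_bound)
        show "integrable lborel (\<lambda>y::'a. t powr a * (if norm y < t then 0 else jump_density s y))"
          by (intro integrable_mult_right integrable_jump_far t)
        show "AE y in lborel. norm (G y * jump_density s y) \<le> norm (t powr a * (if norm y < t then 0 else jump_density s y))"
        proof (intro AE_I2)
          fix y
          show "norm (G y * jump_density s y) \<le> norm (t powr a * (if norm y < t then 0 else jump_density s y))"
          proof (cases "y \<in> S")
            case True
            then have "\<not> norm y < t" using S2(1)[of y] by simp
            then show ?thesis by (simp add: G_def indicator_def)
          qed (simp add: G_def)
        qed
      qed (simp add: G_def[abs_def])
      have "second_diff w x y \<le> P y - G y" for y
      proof -
        have "G y \<le> (if x + y \<in> ball z R then t powr a else 0)" using S1[of y] by (simp add: G_def indicator_def)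
        then show ?thesis using le[of y] sd[of y] unfolding P_def by linarith
      qed
      from op_upper[OF L w Pint P0 Gint G0 this]
      have "L w x \<le> t powr (a - 2 * s) * (a * A) - lam / 2 * (LINT y|lborel. G y * jump_density s y)"
        using PA by simp
      moreover have "t powr (a - 2 * s) * (V * 3 powr (- d - 2 * s)) \<le> (LINT y|lborel. G y * jump_density s y)"
      proof -
        have mS: "emeasure lborel S = ennreal (V * t ^ DIM('a))"
          using t unfolding S_def V_def by (intro emeasure_ball) auto
        have iS: "integrable lborel (\<lambda>y. indicator S y :: real)"
          using mS by (simp add: integrable_indicator_iff)
        have "(LINT y|lborel. (t powr a * (3 * t) powr (- d - 2 * s)) * indicator S y) \<le> (LINT y|lborel. G y * jump_density s y)"
        proof (rule integral_mono[OF integrable_mult_right[OF iS] Gint])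
          fix y :: 'a
          show "(t powr a * (3 * t) powr (- d - 2 * s)) * indicator S y \<le> G y * jump_density s y"
          proof (cases "y \<in> S")
            case True
            have "(3 * t) powr (- d - 2 * s) \<le> norm y powr (- d - 2 * s)"
              using S2[OF True] t s by (intro powr_mono2') (auto simp: d_def)
            also have "\<dots> = jump_density s y"
              using powr_minus_divide[of "norm y" "d + 2 * s"] by (simp add: jump_density_def d_def)
            finally show ?thesis using True by (simp add: G_def mult_left_mono)
          qed (simp add: G_def)
        qed
        also have "(LINT y|lborel. (t powr a * (3 * t) powr (- d - 2 * s)) * indicator S y)
            = (t powr a * (3 * t) powr (- d - 2 * s)) * (V * t ^ DIM('a))"
          using mS V0 t by (simp add: measure_def)
        also have "\<dots> = t powr (a - 2 * s) * (V * 3 powr (- d - 2 * s))"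
        proof -
          have e1: "t powr a * t powr (- d - 2 * s) * t ^ DIM('a) = t powr (a - 2 * s)"
            using t(2) by (simp add: powr_realpow[symmetric] powr_add[symmetric] d_def)
          have "(3 * t) powr (- d - 2 * s) = 3 powr (- d - 2 * s) * t powr (- d - 2 * s)"
            using t(2) by (simp add: powr_mult)
          then show ?thesis unfolding e1[symmetric] by (simp only: mult_ac)
        qed
        finally show ?thesis .
      qed
      then have "lam / 2 * (t powr (a - 2 * s) * (V * 3 powr (- d - 2 * s))) \<le> lam / 2 * (LINT y|lborel. G y * jump_density s y)"
        using lam by (intro mult_left_mono) auto
      ultimately show ?thesis using True by (simp add: \<kappa>_def algebra_simps)
    qed
  qed
qed

text \<open>In \<open>\<Omega>\<close> the function \<open>\<beta>\<close> is an infimum of ball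
  barriers with one radius: at each point a nearest ball gives a barrier above
  \<open>\<beta>\<close> with equality at that point, so test functions below \<open>\<beta>\<close>
  are handled by a single ball. The bound by \<open>C\<close> controls \<open>\<beta>\<close> deep
  inside, where the exterior balls are too far for the loss to be used.\<close>

lemma boundary_barrier:
  assumes op: "open \<Omega>" and bd: "bounded \<Omega>" and sb: "smooth_boundary \<Omega>"
  obtains \<beta> K C where "bounded_continuous \<beta>" "\<And>x. x \<in> \<Omega> \<Longrightarrow> 0 < \<beta> x" "\<And>x. x \<notin> \<Omega> \<Longrightarrow> \<beta> x = 0"
    "compact K" "K \<subseteq> \<Omega>" "visc_le I (\<Omega> - K) \<beta> (\<lambda>x. - 1 - \<mu> * \<beta> x)" "visc_le I \<Omega> \<beta> (\<lambda>x. C)"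
proof -
  obtain R where R: "0 < R" "\<And>p. p \<in> frontier \<Omega> \<Longrightarrow> \<exists>c. dist p c = R \<and> ball c R \<inter> \<Omega> = {}"
    using exterior_ball[OF op sb bd] by blast
  obtain A \<kappa> where A: "0 \<le> A" "0 < \<kappa>"
    "\<And>L w a z R x t. L \<in> \<L> \<Longrightarrow> jump_integrable s w x \<Longrightarrow> 0 < a \<Longrightarrow> a \<le> s \<Longrightarrow> 0 < R \<Longrightarrow>
       t = norm (x - z) - R \<Longrightarrow> 0 < t \<Longrightarrow>
       \<forall>y. second_diff w x y \<le> second_diff (exterior_distance_power a z R) x y \<Longrightarrow>
       L w x \<le> t powr (a - 2 * s) * (a * A - (if t \<le> R then \<kappa> else 0))"
    by (rule op_exterior_distance_power) (rule that)
  \<comment> \<open>Keeps \<open>a * A\<close> at most half of the loss constant; adding 1 avoids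
    division by 0.\<close>
  define a where "a = min s (\<kappa> / (2 * (A + 1)))"
  have a: "0 < a" "a \<le> s" using s A by (auto simp: a_def)
  have aA: "a * A \<le> \<kappa> / 2"
  proof -
    have "a * A \<le> (\<kappa> / (2 * (A + 1))) * (A + 1)" using a A by (intro mult_mono) (auto simp: a_def)
    also have "\<dots> = \<kappa> / 2" using A by (simp add: field_simps)
    finally show ?thesis .
  qed
  \<comment> \<open>The centres of all balls of radius \<open>R\<close> that miss
    \<open>\<Omega>\<close>. This set is closed, so a nearest centre exists.\<close>
  define Z where "Z = {z. ball z R \<inter> \<Omega> = {}}"
  have Zeq: "Z = (\<Inter>x\<in>\<Omega>. - ball x R)"
    unfolding Z_def by (auto simp: dist_commute)
  have Zc: "closed Z" unfolding Zeq by (intro closed_INT ballI) auto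
  have Zne: "Z \<noteq> {}"
  proof -
    obtain B where B: "\<And>x. x \<in> \<Omega> \<Longrightarrow> norm x \<le> B" using bd by (auto simp: bounded_iff)
    obtain z :: 'a where z: "norm z = \<bar>B\<bar> + R" using vector_choose_size[of "\<bar>B\<bar> + R"] R(1) by auto
    have "R \<le> dist z x" if "x \<in> \<Omega>" for x
      using B[OF that] z norm_triangle_ineq2[of z x] by (simp add: dist_norm)
    then have "z \<in> Z" by (force simp: Z_def)
    then show ?thesis by blast
  qed
  define D where "D x = infdist x Z" for x
  have Datt: "\<exists>z\<in>Z. D x = norm (x - z)" for x
    using infdist_attains_inf[OF Zc Zne, of x] by (auto simp: D_def dist_norm)
  have Dle: "D x \<le> norm (x - z)" if "z \<in> Z" for x z
    using infdist_le[OF that, of x] by (simp add: D_def dist_norm)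
  have Dcont: "continuous_on S D" for S
    unfolding D_def[abs_def] by (intro continuous_on_infdist continuous_on_id)
  \<comment> \<open>The weak inequality is built into \<open>Z\<close>; strictness comes from moving
    \<open>x\<close> towards the nearest centre within the open set.\<close>
  have Din: "R < D x" if x: "x \<in> \<Omega>" for x
  proof -
    obtain z where z: "z \<in> Z" "D x = norm (x - z)" using Datt by blast
    obtain e where e: "0 < e" "ball x e \<subseteq> \<Omega>" using op x open_contains_ball by blast
    have "0 < norm (x - z)"
    proof -
      have "x \<notin> ball z R" using z(1) x by (auto simp: Z_def)
      then show ?thesis using R(1) by (auto simp: dist_norm)
    qed
    then have nz: "0 < norm (x - z)" .
    define h where "h = min (e / 2) (norm (x - z) / 2)"
    have "h \<le> e / 2" "h \<le> norm (x - z) / 2" by (simp_all add: h_def)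
    then have h: "h < e" "h < norm (x - z)" using e nz by linarith+
    have h0: "0 < h" using e nz by (simp only: h_def min_less_iff_conj half_gt_zero_iff)
    note h = h0 h
    define x' where "x' = x - (h / norm (x - z)) *\<^sub>R (x - z)"
    have "dist x x' = h" using nz h by (simp add: x'_def dist_norm)
    then have "x' \<in> \<Omega>" using e h by auto
    then have "R \<le> dist z x'" using z(1) by (auto simp: Z_def not_less[symmetric])
    also have "\<dots> = norm (x - z) - h"
    proof -
      have "x' - z = (1 - h / norm (x - z)) *\<^sub>R (x - z)" by (simp add: x'_def algebra_simps)
      then have "norm (x' - z) = \<bar>(1 - h / norm (x - z)) * norm (x - z)\<bar>" by (simp add: abs_mult)
      also have "(1 - h / norm (x - z)) * norm (x - z) = norm (x - z) - h" using nz by (simp add: field_simps)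
      finally show ?thesis using h by (simp add: dist_norm norm_minus_commute)
    qed
    finally show ?thesis using z(2) h by simp
  qed
  have Dfr: "D x \<le> R" if fx: "x \<in> frontier \<Omega>" for x
  proof -
    obtain c where "dist x c = R" "ball c R \<inter> \<Omega> = {}" using R(2)[OF fx] by blast
    then show ?thesis using Dle[of c x] by (simp add: Z_def dist_norm)
  qed
  define g where "g x = (max 0 (D x - R)) powr a" for x
  have gcont: "continuous_on S g" for S
    unfolding g_def[abs_def] using a(1) by (intro continuous_on_powr' continuous_intros Dcont) auto
  define \<beta> where "\<beta> x = (if x \<in> \<Omega> then g x else 0)" for x
  have fr: "closure \<Omega> - \<Omega> = frontier \<Omega>" using op by (simp add: frontier_def interior_open)
  have \<beta>cont: "continuous_on UNIV \<beta>"
  proof -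
    have "continuous_on (closure \<Omega> \<union> - \<Omega>) \<beta>"
      unfolding \<beta>_def[abs_def]
    proof (rule continuous_on_cases)
      show "\<forall>x. x \<in> closure \<Omega> \<and> x \<notin> \<Omega> \<or> x \<in> - \<Omega> \<and> x \<in> \<Omega> \<longrightarrow> g x = 0"
      proof (intro allI impI)
        fix x assume "x \<in> closure \<Omega> \<and> x \<notin> \<Omega> \<or> x \<in> - \<Omega> \<and> x \<in> \<Omega>"
        then have "x \<in> frontier \<Omega>" using fr by blast
        then have "max 0 (D x - R) = 0" using Dfr[of x] by (intro max_absorb1) simp
        then show "g x = 0" by (simp only: g_def powr_0)
      qed
    qed (use op gcont in auto)
    moreover have "closure \<Omega> \<union> - \<Omega> = UNIV" using closure_subset by blast
    ultimately show ?thesis by simp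
  qed
  have \<beta>0: "\<beta> x = 0" if "x \<notin> \<Omega>" for x using that by (simp add: \<beta>_def)
  have \<beta>bc: "bounded_continuous \<beta>" by (rule bounded_continuous_support[OF \<beta>cont bd \<beta>0])
  have \<beta>eq: "\<beta> x = (D x - R) powr a" if "x \<in> \<Omega>" for x
    using Din[OF that] that by (simp add: \<beta>_def g_def max_def)
  have \<beta>pos: "0 < \<beta> x" if "x \<in> \<Omega>" for x using Din[OF that] by (simp add: \<beta>eq that)
  have gle: "g x \<le> exterior_distance_power a z R x" if "z \<in> Z" for x z
    unfolding g_def exterior_distance_power_def using Dle[OF that, of x] a by (intro powr_mono2) auto
  have \<beta>le: "\<beta> x \<le> exterior_distance_power a z R x" if "z \<in> Z" for x z
    using gle[OF that, of x] unfolding \<beta>_def by (auto simp: exterior_distance_power_def)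
  have key: "I (patch N \<phi> \<beta>) x0 \<le> (D x0 - R) powr (a - 2 * s) * (a * A - (if D x0 - R \<le> R then \<kappa> else 0))"
    if *: "x0 \<in> \<Omega>" "open N" "x0 \<in> N" "N \<subseteq> \<Omega>" "Ck_closure 2 N \<phi>" "\<phi> x0 = \<beta> x0" "\<forall>x\<in>N - {x0}. \<phi> x < \<beta> x"
    for x0 N \<phi>
  proof (rule sup_le)
    fix L assume L: "L \<in> \<L>"
    obtain z where z: "z \<in> Z" "D x0 = norm (x0 - z)" using Datt by blast
    have ji: "jump_integrable s (patch N \<phi> \<beta>) x0"
      using * bd bounded_subset \<beta>bc by (intro jump_integrable_patch) blast+
    have "patch N \<phi> \<beta> w \<le> exterior_distance_power a z R w" for w
    proof (cases "w \<in> N")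
      case True
      then have "\<phi> w \<le> \<beta> w" using *(6,7) by (cases "w = x0") (auto intro: less_imp_le)
      then show ?thesis using True \<beta>le[OF z(1), of w] by simp
    next
      case False
      then show ?thesis using \<beta>le[OF z(1), of w] by simp
    qed
    moreover have "patch N \<phi> \<beta> x0 = exterior_distance_power a z R x0"
      using * Din[OF *(1)] z(2) \<beta>eq[OF *(1)] by (simp add: exterior_distance_power_def)
    ultimately have "second_diff (patch N \<phi> \<beta>) x0 y \<le> second_diff (exterior_distance_power a z R) x0 y" for y
      unfolding second_diff_def by (simp add: add_mono)
    then show "L (patch N \<phi> \<beta>) x0 \<le> (D x0 - R) powr (a - 2 * s) * (a * A - (if D x0 - R \<le> R then \<kappa> else 0))"
      using A(3)[OF L ji a R(1), of "D x0 - R" z] z(2) Din[OF *(1)] by simp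
  qed
  \<comment> \<open>Solves \<open>B * (\<kappa> / 2) = 1 + \<bar>\<mu>\<bar>\<close>. The exponent
    \<open>a - 2 * s\<close> is negative, so a distance below \<open>\<rho>\<close> makes the power
    at least \<open>B\<close>; the caps in \<open>\<rho>\<close> give \<open>\<beta> \<le> 1\<close>
    and keep the loss term available.\<close>
  define B where "B = 2 * (1 + \<bar>\<mu>\<bar>) / \<kappa>"
  have B: "0 < B" using A(2) by (simp add: B_def)
  define \<rho> where "\<rho> = min (min 1 R) (B powr (1 / (a - 2 * s)))"
  have \<rho>: "0 < \<rho>" using R(1) B by (simp add: \<rho>_def)
  have neg: "a - 2 * s < 0" using a s by simp
  \<comment> \<open>Taking the closure of \<open>\<Omega>\<close> makes \<open>K\<close> compact;
    since \<open>D \<le> R\<close> on the boundary, \<open>K\<close> still lies inside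
    \<open>\<Omega>\<close>.\<close>
  define K where "K = {x \<in> closure \<Omega>. R + \<rho> \<le> D x}"
  have Kc: "compact K"
  proof -
    have "closed (closure \<Omega> \<inter> {x. R + \<rho> \<le> D x})"
      by (intro closed_Int closed_Collect_le continuous_on_const Dcont) auto
    then have "closed K" by (simp add: K_def Collect_conj_eq)
    moreover have "bounded K" using bd by (auto simp: K_def intro: bounded_subset[OF bounded_closure])
    ultimately show ?thesis by (simp add: compact_eq_bounded_closed)
  qed
  have KO: "K \<subseteq> \<Omega>"
  proof
    fix x assume x: "x \<in> K"
    show "x \<in> \<Omega>"
    proof (rule ccontr)
      assume "x \<notin> \<Omega>"
      then have "x \<in> frontier \<Omega>" using x fr by (auto simp: K_def)
      then show False using Dfr[of x] x \<rho> by (simp add: K_def)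
    qed
  qed
  define C where "C = R powr (a - 2 * s) * (a * A)"
  have C0: "0 \<le> C" using a A by (simp add: C_def)
  show thesis
  proof (rule that[OF \<beta>bc \<beta>pos \<beta>0 Kc KO])
    show "visc_le I \<Omega> \<beta> (\<lambda>x. C)"
      unfolding visc_patch_le
    proof (intro ballI allI impI, elim conjE)
      fix x0 N \<phi> assume *: "x0 \<in> \<Omega>" "open N" "x0 \<in> N" "N \<subseteq> \<Omega>" "Ck_closure 2 N \<phi>" "\<phi> x0 = \<beta> x0"
        "\<forall>x\<in>N - {x0}. \<phi> x < \<beta> x"
      note key[OF *]
      also have "(D x0 - R) powr (a - 2 * s) * (a * A - (if D x0 - R \<le> R then \<kappa> else 0)) \<le> C"
      proof (cases "D x0 - R \<le> R")
        case True
        have "(D x0 - R) powr (a - 2 * s) * (a * A - \<kappa>) \<le> 0"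
          using aA A(2) by (intro mult_nonneg_nonpos) auto
        then show ?thesis using True C0 by simp
      next
        case False
        have "(D x0 - R) powr (a - 2 * s) \<le> R powr (a - 2 * s)"
          using False R(1) neg by (intro powr_mono2') auto
        then show ?thesis using False a A by (simp add: C_def mult_right_mono)
      qed
      finally show "I (patch N \<phi> \<beta>) x0 \<le> C" .
    qed
    show "visc_le I (\<Omega> - K) \<beta> (\<lambda>x. - 1 - \<mu> * \<beta> x)"
      unfolding visc_patch_le
    proof (intro ballI allI impI, elim conjE)
      fix x0 N \<phi> assume *: "x0 \<in> \<Omega> - K" "open N" "x0 \<in> N" "N \<subseteq> \<Omega> - K" "Ck_closure 2 N \<phi>" "\<phi> x0 = \<beta> x0"
        "\<forall>x\<in>N - {x0}. \<phi> x < \<beta> x"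
      define t where "t = D x0 - R"
      have x0: "x0 \<in> \<Omega>" using * by blast
      have t: "0 < t" "t < \<rho>" using Din[OF x0] * closure_subset[of \<Omega>] by (auto simp: t_def K_def)
      have tR: "t \<le> R" "t \<le> 1" "t \<le> B powr (1 / (a - 2 * s))" using t by (auto simp: \<rho>_def)
      have "I (patch N \<phi> \<beta>) x0 \<le> t powr (a - 2 * s) * (a * A - \<kappa>)"
        using key[of x0 N \<phi>] * tR(1) by (auto simp: t_def)
      also have "\<dots> \<le> t powr (a - 2 * s) * (- (\<kappa> / 2))"
        using aA by (intro mult_left_mono) auto
      also have "\<dots> \<le> B * (- (\<kappa> / 2))"
      proof (rule mult_right_mono_neg)
        have "B = (B powr (1 / (a - 2 * s))) powr (a - 2 * s)" using B neg by (simp add: powr_powr)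
        also have "\<dots> \<le> t powr (a - 2 * s)" using tR(3) t(1) neg by (intro powr_mono2') auto
        finally show "B \<le> t powr (a - 2 * s)" .
      qed (use A(2) in simp)
      also have "\<dots> = - 1 - \<bar>\<mu>\<bar>" using A(2) by (simp add: B_def field_simps)
      also have "\<dots> \<le> - 1 - \<mu> * \<beta> x0"
      proof -
        have "\<beta> x0 \<le> 1" using tR t a by (simp add: \<beta>eq[OF x0] t_def[symmetric] powr_le1)
        then have "\<bar>\<mu>\<bar> * \<beta> x0 \<le> \<bar>\<mu>\<bar> * 1" by (intro mult_left_mono) auto
        moreover have "\<mu> * \<beta> x0 \<le> \<bar>\<mu>\<bar> * \<beta> x0" using \<beta>pos[OF x0] by (intro mult_right_mono) auto
        ultimately show ?thesis by simp
      qed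
      finally show "I (patch N \<phi> \<beta>) x0 \<le> - 1 - \<mu> * \<beta> x0" .
    qed
  qed
qed

end

section \<open>Strict supersolutions and comparison\<close>

lemma L_star_translate:
  assumes "L \<in> L_star s lam Lam"
  shows "L (\<lambda>z. u (z + h)) x = L u (x + h)"
proof -
  obtain K where K: "\<And>u x. L u x = 1 / 2 * (LINT y|lborel. (u (x + y) + u (x - y) - 2 * u x) * K y)"
    using L_star_kernel[OF assms] by blast
  have eq: "x + y + h = x + h + y" "x - y + h = x + h - y" for y by (simp_all add: algebra_simps)
  show ?thesis unfolding K eq ..
qed

context stable_order
begin

text \<open>For \<open>norm y \<ge> r\<close> one has
  \<open>1 + norm (x + y) \<le> c * norm y\<close>, so the density is dominated by a multiple of the
  weight at \<open>x + y\<close>.\<close>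

lemma L1_weight_translate_far:
  fixes u :: "'a::euclidean_space \<Rightarrow> real"
  assumes u: "u \<in> L1_weight s" and r: "0 < r" and [measurable]: "u \<in> borel_measurable borel"
  shows "integrable lborel (\<lambda>y. if norm y < r then 0 else u (x + y) * jump_density s y)"
proof (rule Bochner_Integration.integrable_bound)
  define p where "p = real DIM('a) + 2 * s"
  have p: "0 \<le> p" using s by (simp add: p_def)
  define c where "c = (1 + norm x) / r + 1"
  let ?w = "\<lambda>y. u y * (1 + norm y) powr (- real DIM('a) - 2 * s)"
  have "integrable (distr lborel borel ((+) x)) ?w"
    unfolding lborel_distr_plus using u by (simp add: L1_weight_def)
  then have "integrable lborel (\<lambda>y. ?w (x + y))"
    by (subst (asm) integrable_distr_eq) auto
  then show "integrable lborel (\<lambda>y. c powr p * ?w (x + y))" by (rule integrable_mult_right)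
  show "AE y in lborel. norm (if norm y < r then 0 else u (x + y) * jump_density s y) \<le> norm (c powr p * ?w (x + y))"
  proof (intro AE_I2)
    fix y :: 'a
    show "norm (if norm y < r then 0 else u (x + y) * jump_density s y) \<le> norm (c powr p * ?w (x + y))"
    proof (cases "norm y < r")
      case False
      have y: "r \<le> norm y" "0 < norm y" using False r by linarith+
      have "1 + norm x \<le> (1 + norm x) / r * norm y"
      proof -
        have "(1 + norm x) * r \<le> (1 + norm x) * norm y" using y by (intro mult_left_mono) auto
        then show ?thesis using r by (simp add: pos_le_divide_eq)
      qed
      then have le: "1 + norm (x + y) \<le> c * norm y"
        using norm_triangle_ineq[of x y] by (simp add: c_def algebra_simps)
      have c0: "0 < c" using r by (simp add: c_def add_nonneg_pos)
      have "(c * norm y) powr (- p) \<le> (1 + norm (x + y)) powr (- p)"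
        using le p by (intro powr_mono2') (auto intro: add_pos_nonneg)
      then have "c powr p * (c * norm y) powr (- p) \<le> c powr p * (1 + norm (x + y)) powr (- p)"
        by (intro mult_left_mono) auto
      also have "c powr p * (c * norm y) powr (- p) = norm y powr (- p)"
      proof -
        have "(c * norm y) powr (- p) = c powr (- p) * norm y powr (- p)" using c0 y by (simp add: powr_mult)
        moreover have "c powr p * c powr (- p) = 1" using c0 by (simp add: powr_add[symmetric])
        ultimately show ?thesis by (simp add: mult.assoc[symmetric])
      qed
      also have "norm y powr (- p) = jump_density s y"
        using powr_minus_divide[of "norm y" p] by (simp add: jump_density_def p_def)
      finally have "\<bar>u (x + y)\<bar> * jump_density s y \<le> \<bar>u (x + y)\<bar> * (c powr p * (1 + norm (x + y)) powr (- p))"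
        by (intro mult_left_mono) auto
      then show ?thesis using False by (simp add: abs_mult p_def algebra_simps)
    qed simp
  qed
qed measurable

lemma jump_integrable_patch_L1:
  fixes N :: "'a::euclidean_space set"
  assumes N: "open N" "bounded N" "x \<in> N" and C: "Ck_closure 2 N \<phi>"
    and uc: "continuous_on UNIV u" and u: "u \<in> L1_weight s"
  shows "jump_integrable s (patch N \<phi> u) x"
proof -
  have um [measurable]: "u \<in> borel_measurable borel" using uc by (rule borel_measurable_continuous_onI)
  have Nm [measurable]: "N \<in> sets borel" using N by simp
  obtain r where r: "r > 0" "cball x r \<subseteq> N"
    using N open_contains_cball_eq by metis
  obtain D where D: "0 \<le> D" "\<And>z y. norm (z - x) + norm y \<le> r \<Longrightarrow> \<bar>second_diff \<phi> z y\<bar> \<le> D * (norm y)\<^sup>2"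
    by (rule Ck_closure_second_diff[OF C r(2)]) (rule that)
  obtain B where B: "\<And>x. x \<in> N \<Longrightarrow> \<bar>\<phi> x\<bar> \<le> B" by (rule Ck_closure_bounded[OF C N(2)]) (rule that)
  have pm [measurable]: "patch N \<phi> u \<in> borel_measurable borel"
    unfolding patch_def using N Ck_closure_continuous_on[OF C] continuous_on_subset[OF uc]
    by (intro borel_measurable_continuous_on_if) auto
  show ?thesis
  proof (rule jump_integrableI[OF pm r(1), where C = D])
    show "\<bar>second_diff (patch N \<phi> u) x y\<bar> \<le> D * (norm y)\<^sup>2" if "norm y < r" for y
      using D(2)[of x y] that r(2) ball_subset_cball[of x r]
      by (subst second_diff_patch_near[of _ r]) auto
    show "integrable lborel (\<lambda>y. if norm y < r then 0 else patch N \<phi> u (x + y) * jump_density s y)"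
    proof (rule Bochner_Integration.integrable_bound)
      let ?f = "\<lambda>y. if norm y < r then 0 else u (x + y) * jump_density s y"
      show "integrable lborel (\<lambda>y. \<bar>?f y\<bar> + \<bar>B\<bar> * (if norm y < r then 0 else jump_density s y))"
        using L1_weight_translate_far[OF u r(1) um]
        by (intro Bochner_Integration.integrable_add integrable_abs integrable_mult_right integrable_jump_far r(1))
      show "AE y in lborel. norm (if norm y < r then 0 else patch N \<phi> u (x + y) * jump_density s y)
         \<le> norm (\<bar>?f y\<bar> + \<bar>B\<bar> * (if norm y < r then 0 else jump_density s y))"
      proof (intro AE_I2)
        fix y
        have "\<bar>patch N \<phi> u (x + y)\<bar> \<le> \<bar>u (x + y)\<bar> + \<bar>B\<bar>"
        proof (cases "x + y \<in> N")
          case True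
          then show ?thesis using B[of "x + y"] by simp
        next
          case False
          then show ?thesis by simp
        qed
        then have "\<bar>patch N \<phi> u (x + y)\<bar> * jump_density s y \<le> (\<bar>u (x + y)\<bar> + \<bar>B\<bar>) * jump_density s y"
          by (intro mult_right_mono) auto
        then show "norm (if norm y < r then 0 else patch N \<phi> u (x + y) * jump_density s y)
         \<le> norm (\<bar>?f y\<bar> + \<bar>B\<bar> * (if norm y < r then 0 else jump_density s y))"
          by (simp add: abs_mult distrib_right)
      qed
    qed measurable
  qed
qed

end

section \<open>Restriction, gluing and scaling of viscosity inequalities\<close>

lemma compact_pos_lower_bound:
  fixes g :: "'a::topological_space \<Rightarrow> real"
  assumes "compact K" "continuous_on K g" "\<And>x. x \<in> K \<Longrightarrow> 0 < g x"
  obtains m where "0 < m" "\<And>x. x \<in> K \<Longrightarrow> m \<le> g x"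
proof (cases "K = {}")
  case True
  then show thesis using that[of 1] by simp
next
  case False
  then obtain z where "z \<in> K" "\<And>x. x \<in> K \<Longrightarrow> g z \<le> g x"
    using continuous_attains_inf[OF assms(1) False assms(2)] by blast
  then show thesis using that[of "g z"] assms(3) by blast
qed

lemma visc_le_subset:
  assumes "visc_le J \<Omega> u f" "\<Omega>' \<subseteq> \<Omega>"
  shows "visc_le J \<Omega>' u f"
  unfolding visc_le_def
proof (intro ballI allI impI, elim conjE)
  fix x0 N \<phi>
  assume "x0 \<in> \<Omega>'" "open N" "x0 \<in> N" "N \<subseteq> \<Omega>'" "Ck_closure 2 N \<phi>" "\<phi> x0 = u x0" "\<forall>x\<in>N - {x0}. \<phi> x < u x"
  then show "J (\<lambda>x. if x \<in> N then \<phi> x else u x) x0 \<le> f x0"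
    using assms(1)[unfolded visc_le_def, rule_format, of x0 N \<phi>] assms(2) by blast
qed

lemma visc_ge_subset:
  assumes "visc_ge J \<Omega> u f" "\<Omega>' \<subseteq> \<Omega>"
  shows "visc_ge J \<Omega>' u f"
  unfolding visc_ge_def
proof (intro ballI allI impI, elim conjE)
  fix x0 N \<phi>
  assume "x0 \<in> \<Omega>'" "open N" "x0 \<in> N" "N \<subseteq> \<Omega>'" "Ck_closure 2 N \<phi>" "\<phi> x0 = u x0" "\<forall>x\<in>N - {x0}. u x < \<phi> x"
  then show "f x0 \<le> J (\<lambda>x. if x \<in> N then \<phi> x else u x) x0"
    using assms(1)[unfolded visc_ge_def, rule_format, of x0 N \<phi>] assms(2) by blast
qed

lemma visc_le_mono:
  assumes "visc_le J \<Omega> u f" "\<And>x. x \<in> \<Omega> \<Longrightarrow> f x \<le> g x"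
  shows "visc_le J \<Omega> u g"
  unfolding visc_le_def
proof (intro ballI allI impI)
  fix x0 N \<phi>
  assume x0: "x0 \<in> \<Omega>" and h: "open N \<and> x0 \<in> N \<and> N \<subseteq> \<Omega> \<and> Ck_closure 2 N \<phi> \<and> \<phi> x0 = u x0 \<and> (\<forall>x\<in>N - {x0}. \<phi> x < u x)"
  show "J (\<lambda>x. if x \<in> N then \<phi> x else u x) x0 \<le> g x0"
    using assms(1)[unfolded visc_le_def, rule_format, OF x0 h] assms(2)[OF x0] by linarith
qed

lemma visc_ge_mono:
  assumes "visc_ge J \<Omega> u f" "\<And>x. x \<in> \<Omega> \<Longrightarrow> g x \<le> f x"
  shows "visc_ge J \<Omega> u g"
  unfolding visc_ge_def
proof (intro ballI allI impI)
  fix x0 N \<phi>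
  assume x0: "x0 \<in> \<Omega>" and h: "open N \<and> x0 \<in> N \<and> N \<subseteq> \<Omega> \<and> Ck_closure 2 N \<phi> \<and> \<phi> x0 = u x0 \<and> (\<forall>x\<in>N - {x0}. u x < \<phi> x)"
  show "g x0 \<le> J (\<lambda>x. if x \<in> N then \<phi> x else u x) x0"
    using assms(1)[unfolded visc_ge_def, rule_format, OF x0 h] assms(2)[OF x0] by linarith
qed

context jump_class
begin

text \<open>The inequality for \<open>v\<close> is needed only near \<open>x0\<close>, but
  \<open>v\<close> must lie below \<open>u\<close> everywhere, because the operator sees all values.
  Maxima of subsolutions are the typical case.\<close>

lemma visc_ge_touch:
  assumes \<Omega>: "bounded \<Omega>" and u: "bounded_continuous u"
    and loc: "\<And>x0. x0 \<in> \<Omega> \<Longrightarrow> \<exists>\<Omega>' v g. open \<Omega>' \<and> x0 \<in> \<Omega>' \<and> bounded_continuous v \<and> (\<forall>x. v x \<le> u x) \<and>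
      v x0 = u x0 \<and> visc_ge I \<Omega>' v g \<and> f x0 \<le> g x0"
  shows "visc_ge I \<Omega> u f"
proof (rule visc_geI[OF \<Omega> u])
  fix x0 N \<phi> assume *: "x0 \<in> \<Omega>" "open N" "x0 \<in> N" "N \<subseteq> \<Omega>" "Ck_closure 2 N \<phi>" "\<phi> x0 = u x0"
    "\<And>x. x \<in> N \<Longrightarrow> x \<noteq> x0 \<Longrightarrow> u x < \<phi> x"
  obtain \<Omega>' v g where g: "open \<Omega>'" "x0 \<in> \<Omega>'" "bounded_continuous v" "\<And>x. v x \<le> u x" "v x0 = u x0"
    "visc_ge I \<Omega>' v g" "f x0 \<le> g x0" using loc[OF *(1)] by blast
  obtain r where r: "r > 0" "ball x0 r \<subseteq> N \<inter> \<Omega>'"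
    using open_contains_ball_eq[OF open_Int[OF *(2) g(1)], of x0] *(3) g(2) by auto
  have C: "Ck_closure 2 (ball x0 r) \<phi>" using r by (intro Ck_closure_subset[OF *(5)]) auto
  have le: "u x \<le> \<phi> x" if "x \<in> ball x0 r" for x
    using that r * by (cases "x = x0") (auto intro!: less_imp_le)
  have "g x0 \<le> I (patch (ball x0 r) \<phi> v) x0"
    by (rule visc_geD[OF g(6,3) r(1) _ C]) (use r * g(5) le order_trans[OF g(4)] in auto)
  also have "\<dots> \<le> I (patch (ball x0 r) \<phi> u) x0"
    using r by (intro sup_patch_mono C g u) auto
  finally show "\<exists>r>0. ball x0 r \<subseteq> N \<and> f x0 \<le> I (patch (ball x0 r) \<phi> u) x0"
    using r g(7) by (intro exI[of _ r]) auto
qed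

text \<open>Serves for minima of supersolutions and, with \<open>v\<close> the function itself, for
  assembling inequalities known on different open sets.\<close>

lemma visc_le_touch:
  assumes \<Omega>: "bounded \<Omega>" and u: "bounded_continuous u"
    and loc: "\<And>x0. x0 \<in> \<Omega> \<Longrightarrow> \<exists>\<Omega>' v g. open \<Omega>' \<and> bounded \<Omega>' \<and> x0 \<in> \<Omega>' \<and> bounded_continuous v \<and> (\<forall>x. u x \<le> v x) \<and>
      v x0 = u x0 \<and> visc_le I \<Omega>' v g \<and> g x0 \<le> f x0"
  shows "visc_le I \<Omega> u f"
proof (rule visc_leI[OF \<Omega> u])
  fix x0 N \<phi> assume *: "x0 \<in> \<Omega>" "open N" "x0 \<in> N" "N \<subseteq> \<Omega>" "Ck_closure 2 N \<phi>" "\<phi> x0 = u x0"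
    "\<And>x. x \<in> N \<Longrightarrow> x \<noteq> x0 \<Longrightarrow> \<phi> x < u x"
  obtain \<Omega>' v g where g: "open \<Omega>'" "bounded \<Omega>'" "x0 \<in> \<Omega>'" "bounded_continuous v" "\<And>x. u x \<le> v x" "v x0 = u x0"
    "visc_le I \<Omega>' v g" "g x0 \<le> f x0" using loc[OF *(1)] by blast
  obtain r where r: "r > 0" "ball x0 r \<subseteq> N \<inter> \<Omega>'"
    using open_contains_ball_eq[OF open_Int[OF *(2) g(1)], of x0] *(3) g(3) by auto
  have C: "Ck_closure 2 (ball x0 r) \<phi>" using r by (intro Ck_closure_subset[OF *(5)]) auto
  have le: "\<phi> x \<le> u x" if "x \<in> ball x0 r" for x
    using that r * by (cases "x = x0") (auto intro!: less_imp_le)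
  have "I (patch (ball x0 r) \<phi> u) x0 \<le> I (patch (ball x0 r) \<phi> v) x0"
    using r by (intro sup_patch_mono C g u) auto
  also have "\<dots> \<le> g x0"
    by (rule sup_le, rule visc_leD[OF g(7,2,4) r(1) _ C])
      (use r * g(6) le order_trans[OF _ g(5)] in auto)
  finally show "\<exists>r>0. ball x0 r \<subseteq> N \<and> I (patch (ball x0 r) \<phi> u) x0 \<le> f x0"
    using r g(8) by (intro exI[of _ r]) auto
qed

lemma visc_le_cmult:
  assumes \<Omega>: "bounded \<Omega>" and u: "bounded_continuous u" and v: "visc_le I \<Omega> u f" and c: "0 < c"
  shows "visc_le I \<Omega> (\<lambda>x. c * u x) (\<lambda>x. c * f x)"
  unfolding visc_patch_le
proof (intro ballI allI impI, elim conjE)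
  fix x0 N \<phi> assume *: "x0 \<in> \<Omega>" "open N" "x0 \<in> N" "N \<subseteq> \<Omega>" "Ck_closure 2 N \<phi>" "\<phi> x0 = c * u x0"
    "\<forall>x\<in>N - {x0}. \<phi> x < c * u x"
  let ?p = "\<lambda>x. (1 / c) * \<phi> x"
  have C: "Ck_closure 2 N ?p" by (rule Ck_closure_cmult[OF *(5,2)])
  have "\<forall>x\<in>N - {x0}. ?p x < u x" using *(7) c by (simp add: field_simps)
  then have Ile: "I (patch N ?p u) x0 \<le> f x0"
    using v[unfolded visc_patch_le, rule_format, of x0 N ?p] * C c by simp
  have ji: "jump_integrable s (patch N ?p u) x0"
    using * \<Omega> bounded_subset u C by (intro jump_integrable_patch) blast+
  have eq: "patch N \<phi> (\<lambda>x. c * u x) = (\<lambda>x. c * patch N ?p u x)"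
    using c by (auto simp: patch_def)
  show "I (patch N \<phi> (\<lambda>x. c * u x)) x0 \<le> c * f x0"
  proof (rule sup_le)
    fix L assume L: "L \<in> \<L>"
    have "L (patch N ?p u) x0 \<le> f x0" using sup_ge[OF L ji] Ile by linarith
    moreover have "L (\<lambda>x. c * patch N ?p u x) x0 = c * L (patch N ?p u) x0"
      by (rule op_cmult[OF L])
    ultimately show "L (patch N \<phi> (\<lambda>x. c * u x)) x0 \<le> c * f x0" unfolding eq using c by simp
  qed
qed

lemma visc_le_const:
  assumes \<Omega>: "bounded \<Omega>"
  shows "visc_le I \<Omega> (\<lambda>x. c) (\<lambda>x. 0)"
  unfolding visc_patch_le
proof (intro ballI allI impI, elim conjE, rule sup_le)
  fix L x0 N \<phi> assume *: "x0 \<in> \<Omega>" "open N" "x0 \<in> N" "N \<subseteq> \<Omega>" "Ck_closure 2 N \<phi>" "\<phi> x0 = c"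
    "\<forall>x\<in>N - {x0}. \<phi> x < c" and L: "L \<in> \<L>"
  have "L (patch N \<phi> (\<lambda>x. c)) x0 \<le> L (\<lambda>x. c) x0"
  proof (rule op_mono[OF L])
    show "jump_integrable s (patch N \<phi> (\<lambda>x. c)) x0"
      using * \<Omega> bounded_subset bounded_continuous_const by (intro jump_integrable_patch) blast+
    have "patch N \<phi> (\<lambda>x. c) z \<le> c" for z using * by (cases "z = x0") (auto simp: patch_def less_imp_le)
    from add_mono[OF this this] * show "second_diff (patch N \<phi> (\<lambda>x. c)) x0 y \<le> second_diff (\<lambda>x. c) x0 y" for y
      by (simp add: second_diff_def)
  qed simp
  then show "L (patch N \<phi> (\<lambda>x. c)) x0 \<le> 0" using op_zero[OF L] by simp
qed

text \<open>One operator is enough: the bound on the supremum passes to it, negation reverses it,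
  and the supremum for \<open>- u\<close> is at least its value.\<close>

lemma visc_ge_uminus:
  assumes \<Omega>: "bounded \<Omega>" and u: "bounded_continuous u" and v: "visc_le I \<Omega> u f"
  shows "visc_ge I \<Omega> (\<lambda>x. - u x) (\<lambda>x. - f x)"
  unfolding visc_patch_ge
proof (intro ballI allI impI, elim conjE)
  fix x0 N \<phi> assume *: "x0 \<in> \<Omega>" "open N" "x0 \<in> N" "N \<subseteq> \<Omega>" "Ck_closure 2 N \<phi>" "\<phi> x0 = - u x0"
    "\<forall>x\<in>N - {x0}. - u x < \<phi> x"
  obtain L where L: "L \<in> \<L>" using ne by blast
  have "visc_ge L \<Omega> (\<lambda>x. - u x) (\<lambda>x. - f x)"
    using v L visc_le_neg visc_le_sup_iff[OF \<Omega> u] by blast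
  then have "- f x0 \<le> L (patch N \<phi> (\<lambda>x. - u x)) x0" using * unfolding visc_patch_ge by blast
  also have "\<dots> \<le> I (patch N \<phi> (\<lambda>x. - u x)) x0"
    using * \<Omega> bounded_subset bounded_continuous_uminus[OF u] by (intro sup_ge L jump_integrable_patch) blast+
  finally show "- f x0 \<le> I (patch N \<phi> (\<lambda>x. - u x)) x0" .
qed

lemma sup_translate: "I (\<lambda>z. u (z + h)) x = I u (x + h)"
  unfolding sup_operator_def by (intro SUP_cong refl) (use L_star_translate sub in blast)

text \<open>The kernels depend on the jump and not on the base point.\<close>

lemma visc_ge_translate:
  assumes v: "visc_ge I \<Omega> u f"
  shows "visc_ge I ((\<lambda>x. x - h) ` \<Omega>) (\<lambda>x. u (x + h)) (\<lambda>x. f (x + h))"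
  unfolding visc_patch_ge
proof (intro ballI allI impI, elim conjE)
  fix x0 N \<phi> assume *: "x0 \<in> (\<lambda>x. x - h) ` \<Omega>" "open N" "x0 \<in> N" "N \<subseteq> (\<lambda>x. x - h) ` \<Omega>" "Ck_closure 2 N \<phi>"
    "\<phi> x0 = u (x0 + h)" "\<forall>x\<in>N - {x0}. u (x + h) < \<phi> x"
  let ?N = "(\<lambda>x. x - (- h)) ` N" and ?p = "\<lambda>x. \<phi> (x + - h)"
  have "?N = (+) h ` N" by (auto simp: image_def)
  then have "open ?N" using open_translation[OF *(2), of h] by simp
  moreover have "Ck_closure 2 ?N ?p" by (rule Ck_closure_translate[OF *(5,2)])
  moreover have "x0 + h \<in> \<Omega>" "x0 + h \<in> ?N" "?N \<subseteq> \<Omega>" using *(1,3,4) by auto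
  moreover have "\<forall>x\<in>?N - {x0 + h}. u x < ?p x" using *(7) by auto
  ultimately have "f (x0 + h) \<le> I (patch ?N ?p u) (x0 + h)"
    using v[unfolded visc_patch_ge, rule_format, of "x0 + h" ?N ?p] *(6) by simp
  also have "\<dots> = I (\<lambda>z. patch ?N ?p u (z + h)) x0" by (rule sup_translate[symmetric])
  also have "(\<lambda>z. patch ?N ?p u (z + h)) = patch N \<phi> (\<lambda>x. u (x + h))"
  proof
    fix z
    have "z + h \<in> ?N \<longleftrightarrow> z \<in> N" by (auto simp: image_iff)
    then show "patch ?N ?p u (z + h) = patch N \<phi> (\<lambda>x. u (x + h)) z" by (simp only: patch_def) simp
  qed
  finally show "f (x0 + h) \<le> I (patch N \<phi> (\<lambda>x. u (x + h))) x0" .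
qed

text \<open>Truncation far away keeps the supersolution property, since lowering a function outside
  \<open>\<Omega>\<close> lowers the operator in \<open>\<Omega>\<close>.\<close>

lemma visc_le_truncate:
  assumes \<Omega>: "bounded \<Omega>" and c: "continuous_on UNIV \<psi>" and w: "\<psi> \<in> L1_weight s"
    and v: "visc_le I \<Omega> \<psi> f" and M: "\<And>x. x \<in> \<Omega> \<Longrightarrow> \<psi> x \<le> M" and b: "bounded_continuous (\<lambda>x. min (\<psi> x) M)"
  shows "visc_le I \<Omega> (\<lambda>x. min (\<psi> x) M) f"
  unfolding visc_patch_le
proof (intro ballI allI impI, elim conjE)
  fix x0 N \<phi> assume *: "x0 \<in> \<Omega>" "open N" "x0 \<in> N" "N \<subseteq> \<Omega>" "Ck_closure 2 N \<phi>" "\<phi> x0 = min (\<psi> x0) M"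
    "\<forall>x\<in>N - {x0}. \<phi> x < min (\<psi> x) M"
  have Nb: "bounded N" using \<Omega> *(4) by (rule bounded_subset)
  have "I (patch N \<phi> (\<lambda>x. min (\<psi> x) M)) x0 \<le> I (patch N \<phi> \<psi>) x0"
  proof (rule sup_mono)
    show "jump_integrable s (patch N \<phi> (\<lambda>x. min (\<psi> x) M)) x0" by (rule jump_integrable_patch[OF *(2) Nb *(3,5) b])
    show "jump_integrable s (patch N \<phi> \<psi>) x0" by (rule jump_integrable_patch_L1[OF *(2) Nb *(3,5) c w])
    have "patch N \<phi> (\<lambda>x. min (\<psi> x) M) z \<le> patch N \<phi> \<psi> z" for z by (simp add: patch_def)
    from add_mono[OF this this] *(3)
    show "second_diff (patch N \<phi> (\<lambda>x. min (\<psi> x) M)) x0 y \<le> second_diff (patch N \<phi> \<psi>) x0 y" for y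
      by (simp add: second_diff_def)
  qed
  also have "\<dots> \<le> f x0"
    using v[unfolded visc_patch_le, rule_format, of x0 N \<phi>] * M[OF *(1)] by simp
  finally show "I (patch N \<phi> (\<lambda>x. min (\<psi> x) M)) x0 \<le> f x0" .
qed

text \<open>The summands of \<open>V\<close> share the work: \<open>\<psi>\<close> gives strictness
  on the compact set \<open>K\<close>, the barrier gives it off \<open>K\<close>, and both must pay
  for the constant. \<open>W\<close> is the minimum of \<open>V\<close> and a multiple of the
  barrier, which forces it to vanish outside \<open>\<Omega>\<close>.\<close>

lemma strict_supersolution:
  assumes op: "open \<Omega>" and bd: "bounded \<Omega>" and sb: "smooth_boundary \<Omega>"
    and \<mu>: "ereal \<mu> < Lambda_plus s \<L> \<Omega>"
  obtains V W where "bounded_continuous V" "\<And>x. 1 \<le> V x" "visc_le I \<Omega> V (\<lambda>x. - 1 - \<mu> * V x)"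
    "bounded_continuous W" "\<And>x. 0 \<le> W x" "\<And>x. x \<notin> \<Omega> \<Longrightarrow> W x = 0" "visc_le I \<Omega> W (\<lambda>x. - 1 - \<mu> * W x)"
proof -
  \<comment> \<open>The gap between \<open>\<mu>\<close> and \<open>\<mu>'\<close> is the source of
    strictness on \<open>K\<close>.\<close>
  obtain \<mu>' \<psi>0 where \<mu>': "\<mu> < \<mu>'" and \<psi>0: "continuous_on UNIV \<psi>0" "\<psi>0 \<in> L1_weight s" "\<And>x. 0 \<le> \<psi>0 x"
      "\<And>x. x \<in> \<Omega> \<Longrightarrow> 0 < \<psi>0 x" "visc_le I \<Omega> \<psi>0 (\<lambda>x. - \<mu>' * \<psi>0 x)"
    using \<mu> unfolding Lambda_plus_def less_Sup_iff by auto
  have "compact (\<psi>0 ` closure \<Omega>)"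
    using bd by (intro compact_continuous_image continuous_on_subset[OF \<psi>0(1)]) auto
  then have "bounded (\<psi>0 ` closure \<Omega>)" by (rule compact_imp_bounded)
  then obtain M where M: "\<And>x. x \<in> closure \<Omega> \<Longrightarrow> \<bar>\<psi>0 x\<bar> \<le> M" unfolding bounded_iff by auto
  \<comment> \<open>Cut above its maximum on the closure, the function is unchanged in
    \<open>\<Omega>\<close> and becomes bounded, as the results on sums require.\<close>
  define \<psi> where "\<psi> x = min (\<psi>0 x) (\<bar>M\<bar> + 1)" for x
  have M': "\<psi>0 x \<le> \<bar>M\<bar> + 1" if "x \<in> \<Omega>" for x
    using M[of x] that closure_subset[of \<Omega>] abs_ge_self[of M] abs_ge_self[of "\<psi>0 x"] by auto
  have \<psi>bc: "bounded_continuous \<psi>"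
  proof (rule bounded_continuousI)
    show "continuous_on UNIV \<psi>" unfolding \<psi>_def[abs_def] by (intro continuous_intros \<psi>0(1))
    show "\<bar>\<psi> x\<bar> \<le> \<bar>M\<bar> + 1" for x using \<psi>0(3)[of x] by (simp add: \<psi>_def)
  qed
  have \<psi>v: "visc_le I \<Omega> \<psi> (\<lambda>x. - \<mu>' * \<psi> x)"
  proof -
    have "visc_le I \<Omega> \<psi> (\<lambda>x. - \<mu>' * \<psi>0 x)"
      unfolding \<psi>_def[abs_def]
      by (rule visc_le_truncate[OF bd \<psi>0(1,2,5) M' \<psi>bc[unfolded \<psi>_def[abs_def]]])
    then show ?thesis by (rule visc_le_mono) (use M' in \<open>simp add: \<psi>_def min_def\<close>)
  qed
  have \<psi>0': "0 \<le> \<psi> x" for x using \<psi>0(3)[of x] by (simp add: \<psi>_def)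
  have \<psi>pos: "0 < \<psi> x" if "x \<in> \<Omega>" for x using \<psi>0(4)[OF that] by (simp add: \<psi>_def add_nonneg_pos)
  obtain \<beta> K C where \<beta>: "bounded_continuous \<beta>" "\<And>x. x \<in> \<Omega> \<Longrightarrow> 0 < \<beta> x" "\<And>x. x \<notin> \<Omega> \<Longrightarrow> \<beta> x = 0"
    "compact K" "K \<subseteq> \<Omega>" "visc_le I (\<Omega> - K) \<beta> (\<lambda>x. - 1 - \<mu> * \<beta> x)" "visc_le I \<Omega> \<beta> (\<lambda>x. C)"
    using boundary_barrier[OF op bd sb] by blast
  have \<beta>0: "0 \<le> \<beta> x" for x using \<beta>(2,3) by (cases "x \<in> \<Omega>") (auto simp: less_imp_le)
  obtain Bb where Bb: "0 \<le> Bb" "\<And>x. \<bar>\<beta> x\<bar> \<le> Bb" by (rule bounded_continuousE[OF \<beta>(1)]) (rule that)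
  have opK: "open (\<Omega> - K)" using op \<beta>(4) by (intro open_Diff compact_imp_closed)
  have bdK: "bounded (\<Omega> - K)" using bd by (rule bounded_subset) blast
  note cont = bounded_continuous_cont[OF \<psi>bc] bounded_continuous_cont[OF \<beta>(1)]
  obtain m where m: "0 < m" "\<And>x. x \<in> K \<Longrightarrow> m \<le> \<psi> x"
    using compact_pos_lower_bound[OF \<beta>(4) bounded_continuous_cont[OF \<psi>bc]] \<psi>pos \<beta>(5) by blast
  obtain m' where m': "0 < m'" "\<And>x. x \<in> K \<Longrightarrow> m' \<le> \<beta> x"
    using compact_pos_lower_bound[OF \<beta>(4) bounded_continuous_cont[OF \<beta>(1)]] \<beta>(2,5) by blast
  \<comment> \<open>Pays for the constant 1 in \<open>V\<close>, whose cost is at most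
    \<open>\<bar>\<mu>\<bar>\<close>, and for the required \<open>- 1\<close>.\<close>
  define B where "B = \<bar>\<mu>\<bar> + 1"
  have B: "0 < B" by (simp add: B_def)
  \<comment> \<open>On \<open>K\<close> the barrier obeys only the bound \<open>C\<close>. The
    numerator adds up all that must be paid there, and \<open>t\<close> makes the gain
    \<open>t * ((\<mu>' - \<mu>) * m)\<close> equal to it.\<close>
  define t where "t = (B * \<bar>C\<bar> + 1 + \<bar>\<mu>\<bar> + \<bar>\<mu>\<bar> * B * Bb) / ((\<mu>' - \<mu>) * m)"
  have t: "0 < t"
  proof -
    have "0 \<le> B * \<bar>C\<bar>" "0 \<le> \<bar>\<mu>\<bar> * B * Bb" using B Bb(1) by simp_all
    then have "0 < B * \<bar>C\<bar> + 1 + \<bar>\<mu>\<bar> + \<bar>\<mu>\<bar> * B * Bb" by linarith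
    then show ?thesis unfolding t_def using m \<mu>' by (intro divide_pos_pos mult_pos_pos) auto
  qed
  define V where "V x = (t * \<psi> x + B * \<beta> x) + 1" for x
  have V: "bounded_continuous V"
    unfolding V_def[abs_def] by (intro bounded_continuous_add bounded_continuous_cmult bounded_continuous_const \<psi>bc \<beta>(1))
  have V1: "1 \<le> V x" for x using t B \<psi>0'[of x] \<beta>0[of x] by (simp add: V_def)
  have sum: "visc_le I \<Omega>' V (\<lambda>x. (t * (- \<mu>' * \<psi> x) + B * h x) + 0)"
    if "open \<Omega>'" "\<Omega>' \<subseteq> \<Omega>" "visc_le I \<Omega>' \<beta> h" "continuous_on \<Omega>' h" for \<Omega>' h
  proof -
    have b: "bounded \<Omega>'" using bd that(2) by (rule bounded_subset)
    show ?thesis unfolding V_def[abs_def]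
      by (intro visc_le_add[OF b] visc_le_cmult[OF b] visc_le_const[OF b] bounded_continuous_add bounded_continuous_cmult
          bounded_continuous_const \<psi>bc \<beta>(1) t B that visc_le_subset[OF \<psi>v] continuous_intros cont)
  qed
  have Vv: "visc_le I \<Omega> V (\<lambda>x. - 1 - \<mu> * V x)"
  proof (rule visc_le_touch[OF bd V])
    fix x0 assume x0: "x0 \<in> \<Omega>"
    have mV: "\<mu> * V x0 = \<mu> * (t * \<psi> x0) + \<mu> * (B * \<beta> x0) + \<mu>" by (simp add: V_def distrib_left)
    show "\<exists>\<Omega>' v g. open \<Omega>' \<and> bounded \<Omega>' \<and> x0 \<in> \<Omega>' \<and> bounded_continuous v \<and> (\<forall>x. V x \<le> v x) \<and>
      v x0 = V x0 \<and> visc_le I \<Omega>' v g \<and> g x0 \<le> - 1 - \<mu> * V x0"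
    proof (cases "x0 \<in> K")
      case True
      have "visc_le I \<Omega> V (\<lambda>x. (t * (- \<mu>' * \<psi> x) + B * C) + 0)"
        by (rule sum[OF op order_refl \<beta>(7)]) (intro continuous_intros)
      moreover have "(t * (- \<mu>' * \<psi> x0) + B * C) + 0 \<le> - 1 - \<mu> * V x0"
      proof -
        have "B * \<bar>C\<bar> + 1 + \<bar>\<mu>\<bar> + \<bar>\<mu>\<bar> * B * Bb = t * ((\<mu>' - \<mu>) * m)" using m \<mu>' by (simp add: t_def)
        also have "\<dots> \<le> t * ((\<mu>' - \<mu>) * \<psi> x0)"
          using t \<mu>' m(2)[OF True] by (intro mult_left_mono) auto
        also have "\<dots> = t * (\<mu>' * \<psi> x0) - \<mu> * (t * \<psi> x0)" by (simp add: algebra_simps)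
        finally have 1: "B * \<bar>C\<bar> + 1 + \<bar>\<mu>\<bar> + \<bar>\<mu>\<bar> * B * Bb \<le> t * (\<mu>' * \<psi> x0) - \<mu> * (t * \<psi> x0)" .
        have 2: "B * C \<le> B * \<bar>C\<bar>" using B by (intro mult_left_mono) auto
        have "\<mu> * (B * \<beta> x0) \<le> \<bar>\<mu>\<bar> * (B * \<beta> x0)" using B \<beta>0 by (intro mult_right_mono) auto
        also have "\<dots> \<le> \<bar>\<mu>\<bar> * (B * Bb)" using Bb(2)[of x0] B by (intro mult_left_mono) auto
        finally have 3: "\<mu> * (B * \<beta> x0) \<le> \<bar>\<mu>\<bar> * B * Bb" by simp
        have "t * (- \<mu>' * \<psi> x0) = - (t * (\<mu>' * \<psi> x0))" by simp
        then show ?thesis using 1 2 3 mV abs_ge_self[of \<mu>] by linarith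
      qed
      ultimately show ?thesis using op bd x0 V by (intro exI[of _ \<Omega>] exI[of _ V] exI conjI) auto
    next
      case False
      have "visc_le I (\<Omega> - K) V (\<lambda>x. (t * (- \<mu>' * \<psi> x) + B * (- 1 - \<mu> * \<beta> x)) + 0)"
        by (rule sum[OF opK Diff_subset \<beta>(6)]) (intro continuous_intros cont)
      moreover have "(t * (- \<mu>' * \<psi> x0) + B * (- 1 - \<mu> * \<beta> x0)) + 0 \<le> - 1 - \<mu> * V x0"
      proof -
        have "0 \<le> t * ((\<mu>' - \<mu>) * \<psi> x0)" using t \<mu>' \<psi>0'[of x0] by (intro mult_nonneg_nonneg) auto
        then have "\<mu> * (t * \<psi> x0) \<le> t * (\<mu>' * \<psi> x0)" by (simp add: algebra_simps)
        moreover have "B * (- 1 - \<mu> * \<beta> x0) = - \<bar>\<mu>\<bar> - 1 - \<mu> * (B * \<beta> x0)" by (simp add: B_def algebra_simps)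
        moreover have "t * (- \<mu>' * \<psi> x0) = - (t * (\<mu>' * \<psi> x0))" by simp
        ultimately show ?thesis using mV abs_ge_self[of \<mu>] by linarith
      qed
      ultimately show ?thesis using opK bdK x0 False V
        by (intro exI[of _ "\<Omega> - K"] exI[of _ V] exI conjI) auto
    qed
  qed
  obtain BV where BV: "0 \<le> BV" "\<And>x. \<bar>V x\<bar> \<le> BV" by (rule bounded_continuousE[OF V]) (rule that)
  \<comment> \<open>With this factor \<open>A * \<beta>\<close> exceeds \<open>V\<close> on
    \<open>K\<close>; where the minimum switches to the barrier, the point is therefore off
    \<open>K\<close> and the barrier is a strict supersolution.\<close>
  define A where "A = (BV + 1) / m' + 1"
  have A: "1 \<le> A" using BV m' by (simp add: A_def)
  define W where "W x = min (V x) (A * \<beta> x)" for x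
  have W0: "0 \<le> W x" for x using A \<beta>0[of x] V1[of x] by (simp add: W_def)
  have Wout: "W x = 0" if "x \<notin> \<Omega>" for x using \<beta>(3)[OF that] V1[of x] by (simp add: W_def)
  have W: "bounded_continuous W"
  proof (rule bounded_continuousI)
    show "continuous_on UNIV W" unfolding W_def[abs_def]
      by (intro continuous_intros bounded_continuous_cont[OF V] cont)
    show "\<bar>W x\<bar> \<le> BV" for x using W0[of x] BV(2)[of x] by (simp add: W_def)
  qed
  have Wv: "visc_le I \<Omega> W (\<lambda>x. - 1 - \<mu> * W x)"
  proof (rule visc_le_touch[OF bd W])
    fix x0 assume x0: "x0 \<in> \<Omega>"
    show "\<exists>\<Omega>' v g. open \<Omega>' \<and> bounded \<Omega>' \<and> x0 \<in> \<Omega>' \<and> bounded_continuous v \<and> (\<forall>x. W x \<le> v x) \<and>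
      v x0 = W x0 \<and> visc_le I \<Omega>' v g \<and> g x0 \<le> - 1 - \<mu> * W x0"
    proof (cases "V x0 \<le> A * \<beta> x0")
      case True
      then show ?thesis using op bd x0 V Vv
        by (intro exI[of _ \<Omega>] exI[of _ V] exI[of _ "\<lambda>x. - 1 - \<mu> * V x"]) (auto simp: W_def)
    next
      case False
      have "x0 \<notin> K"
      proof
        assume "x0 \<in> K"
        then have "((BV + 1) / m') * m' \<le> A * \<beta> x0" using m' BV A by (intro mult_mono) (auto simp: A_def)
        then have "BV + 1 \<le> A * \<beta> x0" using m'(1) by simp
        then show False using False BV(2)[of x0] by simp
      qed
      moreover have "visc_le I (\<Omega> - K) (\<lambda>x. A * \<beta> x) (\<lambda>x. A * (- 1 - \<mu> * \<beta> x))"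
        using A by (intro visc_le_cmult[OF bdK \<beta>(1,6)]) auto
      moreover have "A * (- 1 - \<mu> * \<beta> x0) \<le> - 1 - \<mu> * (A * \<beta> x0)" using A by (simp add: algebra_simps)
      ultimately show ?thesis using opK bdK x0 False bounded_continuous_cmult[OF \<beta>(1), of A]
        by (intro exI[of _ "\<Omega> - K"] exI[of _ "\<lambda>x. A * \<beta> x"] exI[of _ "\<lambda>x. A * (- 1 - \<mu> * \<beta> x)"]) (auto simp: W_def)
    qed
  qed
  show thesis by (rule that[OF V V1 Vv W W0 Wout Wv])
qed

text \<open>With \<open>t\<close> the maximal quotient, \<open>u - v - t V\<close> is nonpositive
  and vanishes at a point of \<open>\<Omega>\<close>, so the constant 0 is a test function there.
  The zero order terms cancel and the strictness of \<open>V\<close> leaves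
  \<open>t \<le> 0\<close>.\<close>

lemma visc_comparison:
  assumes bd: "bounded \<Omega>" and op: "open \<Omega>" and u: "bounded_continuous u" and v: "bounded_continuous v"
    and V: "bounded_continuous V" "\<And>x. 1 \<le> V x" "visc_le I \<Omega> V (\<lambda>x. - 1 - \<mu> * V x)"
    and f: "continuous_on \<Omega> f"
    and vu: "visc_ge I \<Omega> u (\<lambda>x. f x - \<mu> * u x)" and vv: "visc_le I \<Omega> v (\<lambda>x. f x - \<mu> * v x)"
    and out: "\<And>x. x \<notin> \<Omega> \<Longrightarrow> u x \<le> v x"
  shows "u x \<le> v x"
proof (rule ccontr)
  assume "\<not> u x \<le> v x"
  then have x: "v x < u x" by simp
  note cont = bounded_continuous_cont[OF u] bounded_continuous_cont[OF v] bounded_continuous_cont[OF V(1)]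
  define q where "q z = (u z - v z) / V z" for z
  have V0: "0 < V z" for z using V(2)[of z] by linarith
  have xO: "x \<in> \<Omega>" using out x by force
  have "continuous_on (closure \<Omega>) q"
    unfolding q_def[abs_def] using V0
    by (intro continuous_intros cont) (metis less_irrefl)
  moreover have "compact (closure \<Omega>)" "closure \<Omega> \<noteq> {}" using bd xO by auto
  ultimately obtain x0 where x0: "x0 \<in> closure \<Omega>" "\<And>z. z \<in> closure \<Omega> \<Longrightarrow> q z \<le> q x0"
    using continuous_attains_sup[of "closure \<Omega>" q] by blast
  define t where "t = q x0"
  have "0 < q x" using x V0 by (simp add: q_def)
  then have t: "0 < t" using x0(2)[of x] xO closure_subset[of \<Omega>] by (auto simp: t_def)
  have le: "u z - v z \<le> t * V z" for z
  proof (cases "z \<in> \<Omega>")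
    case True
    then have "q z \<le> t" using x0(2)[of z] closure_subset[of \<Omega>] by (auto simp: t_def)
    then show ?thesis using V0[of z] by (simp add: q_def field_simps)
  next
    case False
    then have "u z - v z \<le> 0" using out by simp
    also have "0 \<le> t * V z" using t V0[of z] by simp
    finally show ?thesis .
  qed
  have eq: "u x0 - v x0 = t * V x0" using V0[of x0] by (simp add: t_def q_def)
  have "0 < t * V x0" using t V0 by simp
  then have x0O: "x0 \<in> \<Omega>" using out[of x0] eq by force
  let ?w = "\<lambda>z. (u z - v z) - t * V z"
  have w: "bounded_continuous ?w"
    by (intro bounded_continuous_diff bounded_continuous_cmult u v V(1))
  have d: "visc_ge I \<Omega> (\<lambda>z. u z - v z) (\<lambda>z. (f z - \<mu> * u z) - (f z - \<mu> * v z))"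
    by (rule visc_ge_diff[OF bd u v vu vv]) (intro continuous_intros f cont)+
  have vw: "visc_ge I \<Omega> ?w (\<lambda>z. ((f z - \<mu> * u z) - (f z - \<mu> * v z)) - t * (- 1 - \<mu> * V z))"
    by (rule visc_ge_diff[OF bd bounded_continuous_diff[OF u v] bounded_continuous_cmult[OF V(1)] d
          visc_le_cmult[OF bd V(1,3) t]]) (intro continuous_intros f cont)+
  obtain r where r: "0 < r" "ball x0 r \<subseteq> \<Omega>" using op x0O open_contains_ball by blast
  have C: "Ck_closure 2 (ball x0 r) (\<lambda>z. 0 :: real)" by (rule Ck_closure_const) simp
  have "((f x0 - \<mu> * u x0) - (f x0 - \<mu> * v x0)) - t * (- 1 - \<mu> * V x0) \<le> I (patch (ball x0 r) (\<lambda>z. 0) ?w) x0"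
    by (rule visc_geD[OF vw w r C]) (use eq le in auto)
  also have "\<dots> \<le> 0"
  proof (rule sup_le)
    fix L assume L: "L \<in> \<L>"
    have "L (patch (ball x0 r) (\<lambda>z. 0) ?w) x0 \<le> L (\<lambda>z. 0) x0"
    proof (rule op_mono[OF L])
      show "jump_integrable s (patch (ball x0 r) (\<lambda>z. 0) ?w) x0"
        using r by (intro jump_integrable_patch C w) auto
      have "patch (ball x0 r) (\<lambda>z. 0) ?w z \<le> 0" for z using le[of z] by (simp add: patch_def)
      from add_mono[OF this this] r
      show "second_diff (patch (ball x0 r) (\<lambda>z. 0) ?w) x0 y \<le> second_diff (\<lambda>z. 0) x0 y" for y
        by (simp add: second_diff_def)
    qed simp
    then show "L (patch (ball x0 r) (\<lambda>z. 0) ?w) x0 \<le> 0" using op_zero[OF L] by simp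
  qed
  also have "((f x0 - \<mu> * u x0) - (f x0 - \<mu> * v x0)) - t * (- 1 - \<mu> * V x0) = t - \<mu> * ((u x0 - v x0) - t * V x0)"
    by (simp add: algebra_simps)
  finally show False using t eq by simp
qed

end

section \<open>Perron's method\<close>

text \<open>Competitors are enclosed between \<open>- W\<close> and \<open>W\<close>, which vanish
  outside \<open>\<Omega>\<close>; the exterior condition therefore holds for each of them and for
  their supremum.\<close>

locale perron = jump_class s lam Lam \<L>
  for s lam Lam :: real and \<L> :: "(('a::euclidean_space \<Rightarrow> real) \<Rightarrow> 'a \<Rightarrow> real) set" +
  fixes \<Omega> :: "'a set" and f V W :: "'a \<Rightarrow> real" and \<mu> :: real
  assumes op: "open \<Omega>" and bd: "bounded \<Omega>"
    and uf: "uniformly_continuous_on \<Omega> f"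
    and V: "bounded_continuous V" "\<And>x. 1 \<le> V x" "visc_le I \<Omega> V (\<lambda>x. - 1 - \<mu> * V x)"
    and W: "bounded_continuous W" "\<And>x. 0 \<le> W x" "\<And>x. x \<notin> \<Omega> \<Longrightarrow> W x = 0"
      "visc_le I \<Omega> W (\<lambda>x. f x - \<mu> * W x)" "visc_ge I \<Omega> (\<lambda>x. - W x) (\<lambda>x. f x - \<mu> * (- W x))"
begin

lemma f: "continuous_on \<Omega> f"
  using uf by (rule uniformly_continuous_imp_continuous)

definition subsolutions :: "('a \<Rightarrow> real) set" where
  "subsolutions = {w. continuous_on UNIV w \<and> (\<forall>x. - W x \<le> w x \<and> w x \<le> W x) \<and>
     visc_ge I \<Omega> w (\<lambda>x. f x - \<mu> * w x)}"

definition perron_solution :: "'a \<Rightarrow> real" where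
  "perron_solution x = (SUP w\<in>subsolutions. w x)"

lemma subsolutionsD:
  assumes "w \<in> subsolutions"
  shows "bounded_continuous w" "- W x \<le> w x" "w x \<le> W x" "visc_ge I \<Omega> w (\<lambda>x. f x - \<mu> * w x)"
proof -
  have w: "- W x \<le> w x" "w x \<le> W x" for x using assms by (auto simp: subsolutions_def)
  then show "- W x \<le> w x" "w x \<le> W x" by blast+
  show "visc_ge I \<Omega> w (\<lambda>x. f x - \<mu> * w x)" using assms by (simp add: subsolutions_def)
  show "bounded_continuous w"
    by (rule bounded_continuous_between[OF _ W(1) w]) (use assms in \<open>simp add: subsolutions_def\<close>)
qed

lemma minus_W_subsolution: "(\<lambda>x. - W x) \<in> subsolutions"
proof -
  have "- W x \<le> W x" for x using W(2)[of x] by linarith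
  then show ?thesis
    using W(5) bounded_continuous_cont[OF bounded_continuous_uminus[OF W(1)], of UNIV]
    by (simp add: subsolutions_def)
qed

lemma perron_upper: "w \<in> subsolutions \<Longrightarrow> w x \<le> perron_solution x"
  unfolding perron_solution_def using subsolutionsD(3)
  by (intro cSUP_upper) (auto intro!: bdd_aboveI2)

lemma perron_least: "(\<And>w. w \<in> subsolutions \<Longrightarrow> w x \<le> c) \<Longrightarrow> perron_solution x \<le> c"
  unfolding perron_solution_def using minus_W_subsolution by (intro cSUP_least) auto

lemma perron_approx:
  assumes "c < perron_solution x"
  obtains w where "w \<in> subsolutions" "c < w x"
  using perron_least[of x c] assms by (meson not_less)

lemma perron_bounds: "- W x \<le> perron_solution x" "perron_solution x \<le> W x"
  using perron_upper[OF minus_W_subsolution] perron_least[OF subsolutionsD(3)] by auto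

lemma perron_outside: "x \<notin> \<Omega> \<Longrightarrow> perron_solution x = 0"
  using perron_bounds[of x] W(3)[of x] by simp

text \<open>This transfers the modulus of continuity of \<open>W\<close> and \<open>f\<close> to the supremum without any
  regularity theory.\<close>

lemma translate_subsolution:
  assumes w: "w \<in> subsolutions" and e: "0 < e"
    and Wh: "\<And>x. \<bar>W (x + h) - W x\<bar> \<le> e"
    and fh: "\<And>x. x \<in> \<Omega> \<Longrightarrow> x + h \<in> \<Omega> \<Longrightarrow> \<bar>f (x + h) - f x\<bar> \<le> e"
  shows "(\<lambda>x. max (w (x + h) - e * V x) (- W x)) \<in> subsolutions"
proof -
  note wD = subsolutionsD[OF w]
  let ?wh = "\<lambda>x. w (x + h)"
  \<comment> \<open>Lowering by \<open>e * V\<close> pays twice: the strict inequality of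
    \<open>V\<close> absorbs the error \<open>e\<close> in \<open>f\<close>, and
    \<open>V \<ge> 1\<close> absorbs the error \<open>e\<close> in \<open>W\<close>, so the function
    stays below \<open>W\<close>.\<close>
  let ?g = "\<lambda>x. ?wh x - e * V x"
  let ?m = "\<lambda>x. max (?g x) (- W x)"
  have wh: "bounded_continuous ?wh"
  proof -
    obtain B where B: "\<And>x. \<bar>w x\<bar> \<le> B" using bounded_continuousE[OF wD(1)] by metis
    show ?thesis
    proof (rule bounded_continuousI)
      show "continuous_on UNIV ?wh"
        by (rule continuous_on_compose2[OF bounded_continuous_cont[OF wD(1), of UNIV]]) (auto intro!: continuous_intros)
    qed (use B in auto)
  qed
  have g: "bounded_continuous ?g" by (intro bounded_continuous_diff wh bounded_continuous_cmult V(1))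
  have eV: "e \<le> e * V x" for x using e V(2)[of x] by simp
  have gW: "?g x \<le> W x" for x using wD(3)[of "x + h"] Wh[of x] eV[of x] by linarith
  have m1: "- W x \<le> ?m x" "?m x \<le> W x" for x using gW[of x] W(2)[of x] by auto
  have mc: "continuous_on UNIV ?m"
    by (intro continuous_on_max bounded_continuous_cont[OF g] continuous_on_minus bounded_continuous_cont[OF W(1)])
  have m: "bounded_continuous ?m" by (rule bounded_continuous_between[OF mc W(1) m1])
  define \<Omega>1 where "\<Omega>1 = \<Omega> \<inter> (\<lambda>x. x - h) ` \<Omega>"
  have img: "(\<lambda>x. x - h) ` \<Omega> = (+) (- h) ` \<Omega>" by (auto simp: image_def)
  have o1: "open \<Omega>1" unfolding \<Omega>1_def img using op by (intro open_Int open_translation)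
  have b1: "bounded \<Omega>1" unfolding \<Omega>1_def using bd by (simp add: bounded_Int)
  have mem1: "x \<in> \<Omega>1 \<longleftrightarrow> x \<in> \<Omega> \<and> x + h \<in> \<Omega>" for x
    unfolding \<Omega>1_def by (auto simp: image_iff intro!: bexI[of _ "x + h"])
  have v1: "visc_ge I \<Omega>1 ?wh (\<lambda>x. f (x + h) - \<mu> * w (x + h))"
    by (rule visc_ge_subset[OF visc_ge_translate[OF wD(4), of h]]) (simp add: \<Omega>1_def)
  have v2: "visc_le I \<Omega>1 (\<lambda>x. e * V x) (\<lambda>x. e * (- 1 - \<mu> * V x))"
    by (rule visc_le_cmult[OF b1 V(1) visc_le_subset[OF V(3)] e]) (simp add: \<Omega>1_def)
  have fc: "continuous_on \<Omega>1 (\<lambda>x. f (x + h))"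
    by (rule continuous_on_compose2[OF f]) (auto intro!: continuous_intros simp: mem1)
  have v3: "visc_ge I \<Omega>1 ?g (\<lambda>x. (f (x + h) - \<mu> * w (x + h)) - e * (- 1 - \<mu> * V x))"
    by (rule visc_ge_diff[OF b1 wh bounded_continuous_cmult[OF V(1)] v1 v2])
      (intro continuous_intros fc bounded_continuous_cont[OF wh] bounded_continuous_cont[OF V(1)])+
  have "visc_ge I \<Omega> ?m (\<lambda>x. f x - \<mu> * ?m x)"
  proof (rule visc_ge_touch[OF bd m])
    fix x0 assume x0: "x0 \<in> \<Omega>"
    show "\<exists>\<Omega>' v g. open \<Omega>' \<and> x0 \<in> \<Omega>' \<and> bounded_continuous v \<and> (\<forall>x. v x \<le> ?m x) \<and>
      v x0 = ?m x0 \<and> visc_ge I \<Omega>' v g \<and> f x0 - \<mu> * ?m x0 \<le> g x0"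
    proof (cases "?g x0 \<le> - W x0")
      case True
      then have "- W x0 = ?m x0" by simp
      then show ?thesis using op x0 W(5) bounded_continuous_uminus[OF W(1)]
        by (intro exI[of _ \<Omega>] exI[of _ "\<lambda>x. - W x"] exI[of _ "\<lambda>x. f x - \<mu> * (- W x)"] conjI) simp_all
    next
      case False
      \<comment> \<open>Otherwise the translate would be nonpositive and
        \<open>W x0 \<le> e\<close>, so the lowered function would be at most \<open>- W x0\<close>,
        against the case assumption.\<close>
      have in\<Omega>: "x0 + h \<in> \<Omega>"
      proof (rule ccontr)
        assume "x0 + h \<notin> \<Omega>"
        then have "W (x0 + h) = 0" by (rule W(3))
        then show False using False wD(3)[of "x0 + h"] Wh[of x0] eV[of x0] by linarith
      qed
      have meq: "?g x0 = ?m x0" using False by simp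
      have "f x0 - \<mu> * ?m x0 \<le> (f (x0 + h) - \<mu> * w (x0 + h)) - e * (- 1 - \<mu> * V x0)"
      proof -
        have "f x0 \<le> f (x0 + h) + e" using fh[OF x0 in\<Omega>] by linarith
        then show ?thesis unfolding meq[symmetric] by (simp add: algebra_simps)
      qed
      then show ?thesis using o1 g v3 meq x0 in\<Omega> mem1
        by (intro exI[of _ \<Omega>1] exI[of _ ?g] exI[of _ "\<lambda>x. (f (x + h) - \<mu> * w (x + h)) - e * (- 1 - \<mu> * V x)"] conjI) simp_all
    qed
  qed
  then show ?thesis using mc m1 by (simp add: subsolutions_def)
qed

text \<open>\<open>W\<close> has a modulus on the whole space because it vanishes outside a bounded
  set: of two points closer than 1 either both miss \<open>\<Omega>\<close> or both lie in the
  compact unit enlargement of its closure.\<close>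

lemma uniform_moduli:
  assumes e: "0 < e"
  obtains \<delta> where "0 < \<delta>" "\<And>h x. norm h < \<delta> \<Longrightarrow> \<bar>W (x + h) - W x\<bar> \<le> e"
    "\<And>h x. norm h < \<delta> \<Longrightarrow> x \<in> \<Omega> \<Longrightarrow> x + h \<in> \<Omega> \<Longrightarrow> \<bar>f (x + h) - f x\<bar> \<le> e"
proof -
  obtain d1 where d1: "0 < d1" "\<And>x y. x \<in> \<Omega> \<Longrightarrow> y \<in> \<Omega> \<Longrightarrow> dist y x < d1 \<Longrightarrow> dist (f y) (f x) < e"
    using uf e unfolding uniformly_continuous_on_def by meson
  define K where "K = {x + y |x y. x \<in> closure \<Omega> \<and> y \<in> cball 0 (1::real)}"
  have "compact K" unfolding K_def using bd by (intro compact_sums) auto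
  then have "uniformly_continuous_on K W"
    by (intro compact_uniformly_continuous bounded_continuous_cont[OF W(1)])
  then obtain d2 where d2: "0 < d2" "\<And>x y. x \<in> K \<Longrightarrow> y \<in> K \<Longrightarrow> dist y x < d2 \<Longrightarrow> dist (W y) (W x) < e"
    using e unfolding uniformly_continuous_on_def by meson
  have inK: "x + y \<in> K" if "x \<in> \<Omega>" "norm y \<le> 1" for x y
    unfolding K_def using that closure_subset[of \<Omega>] by force
  show thesis
  proof (rule that[of "min 1 (min d1 d2)"])
    show "0 < min 1 (min d1 d2)" using d1 d2 by simp
    fix h x :: 'a assume h: "norm h < min 1 (min d1 d2)"
    have dist: "dist (x + h) x = norm h" by (simp add: dist_norm)
    show "\<bar>W (x + h) - W x\<bar> \<le> e"
    proof (cases "x \<in> \<Omega> \<or> x + h \<in> \<Omega>")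
      case True
      have "x \<in> K \<and> x + h \<in> K"
        using True inK[of x 0] inK[of x h] inK[of "x + h" 0] inK[of "x + h" "- h"] h by auto
      then have "dist (W (x + h)) (W x) < e" using d2(2)[of x "x + h"] h dist by simp
      then show ?thesis by (simp add: dist_real_def)
    next
      case False
      then show ?thesis using W(3) e by simp
    qed
    assume "x \<in> \<Omega>" "x + h \<in> \<Omega>"
    then have "dist (f (x + h)) (f x) < e" using d1(2)[of x "x + h"] h dist by simp
    then show "\<bar>f (x + h) - f x\<bar> \<le> e" by (simp add: dist_real_def)
  qed
qed

lemma perron_continuous: "bounded_continuous perron_solution"
proof -
  obtain BV where BV: "0 \<le> BV" "\<And>x. \<bar>V x\<bar> \<le> BV" by (rule bounded_continuousE[OF V(1)]) (rule that)
  have "continuous_on UNIV perron_solution"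
  proof (rule uniformly_continuous_imp_continuous, unfold uniformly_continuous_on_def, intro allI impI)
    fix \<epsilon> :: real assume \<epsilon>: "0 < \<epsilon>"
    \<comment> \<open>The translated competitor was lowered by at most \<open>e * BV\<close>; this
      choice keeps that below \<open>\<epsilon>\<close>.\<close>
    define e where "e = (\<epsilon> / 2) / (BV + 1)"
    have nz: "BV + 1 \<noteq> 0" using BV(1) by linarith
    have e: "0 < e" using \<epsilon> BV(1) by (simp add: e_def)
    have eBV: "e * BV < \<epsilon>"
    proof -
      have "e * BV \<le> e * (BV + 1)" using e by simp
      also have "\<dots> = \<epsilon> / 2" using nonzero_eq_divide_eq[OF nz] e_def by blast
      finally show ?thesis using \<epsilon> by linarith
    qed
    obtain \<delta> where \<delta>: "0 < \<delta>" "\<And>h x. norm h < \<delta> \<Longrightarrow> \<bar>W (x + h) - W x\<bar> \<le> e"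
      "\<And>h x. norm h < \<delta> \<Longrightarrow> x \<in> \<Omega> \<Longrightarrow> x + h \<in> \<Omega> \<Longrightarrow> \<bar>f (x + h) - f x\<bar> \<le> e"
      using uniform_moduli[OF e] by metis
    have le: "perron_solution (x + h) \<le> perron_solution x + e * BV" if h: "norm h < \<delta>" for x h
    proof (rule perron_least)
      fix w assume w: "w \<in> subsolutions"
      have "w (x + h) - e * V x \<le> max (w (x + h) - e * V x) (- W x)" by simp
      also have "\<dots> \<le> perron_solution x"
        by (rule perron_upper[OF translate_subsolution[OF w e]]) (use \<delta>(2,3)[OF h] in auto)
      finally have "w (x + h) \<le> perron_solution x + e * V x" by simp
      also have "e * V x \<le> e * BV" using e BV(2)[of x] by simp
      finally show "w (x + h) \<le> perron_solution x + e * BV" by simp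
    qed
    show "\<exists>d>0. \<forall>x\<in>UNIV. \<forall>x'\<in>UNIV. dist x' x < d \<longrightarrow> dist (perron_solution x') (perron_solution x) < \<epsilon>"
    proof (intro exI[of _ \<delta>] conjI \<delta> ballI impI)
      fix x x' :: 'a assume d: "dist x' x < \<delta>"
      have "perron_solution x' \<le> perron_solution x + e * BV"
        using le[of "x' - x" x] d by (simp add: dist_norm)
      moreover have "perron_solution x \<le> perron_solution x' + e * BV"
        using le[of "x - x'" x'] d by (simp add: dist_norm norm_minus_commute)
      ultimately show "dist (perron_solution x') (perron_solution x) < \<epsilon>"
        using eBV unfolding dist_real_def by linarith
    qed
  qed
  then show ?thesis by (rule bounded_continuous_between[OF _ W(1) perron_bounds])
qed

section \<open>The supremum is a subsolution and a supersolution\<close>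

abbreviation u :: "'a \<Rightarrow> real" where "u \<equiv> perron_solution"

text \<open>An inequality failing at \<open>x0\<close> fails with a margin \<open>\<gamma>\<close>.
  Half of it is spent on the operator and half on the right-hand side when the touching point moves
  and the test function is shifted by \<open>c\<close>.\<close>

lemma test_perturbation:
  assumes x0: "x0 \<in> \<Omega>" and C: "Ck_closure 2 N \<phi>" and N: "open N" "N \<subseteq> \<Omega>"
    and r: "0 < r" "cball x0 (2 * r) \<subseteq> N" and m: "\<phi> \<in> borel_measurable borel" and g: "0 < \<gamma>"
  obtains \<delta> where "0 < \<delta>" "\<And>x c. dist x x0 < \<delta> \<Longrightarrow> \<bar>c\<bar> < \<delta> \<Longrightarrow>
      \<bar>I (patch (ball x r) (\<lambda>z. \<phi> z + c) u) x - I (patch (ball x0 r) \<phi> u) x0\<bar> < \<gamma> / 2"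
    "\<And>x c. x \<in> N \<Longrightarrow> dist x x0 < \<delta> \<Longrightarrow> \<bar>c\<bar> < \<delta> \<Longrightarrow>
      \<bar>(f x - \<mu> * (\<phi> x + c)) - (f x0 - \<mu> * \<phi> x0)\<bar> < \<gamma> / 2"
proof -
  have Nb: "bounded N" using bd N(2) by (rule bounded_subset)
  obtain d1 where d1: "0 < d1" "\<And>x c. dist x x0 < d1 \<Longrightarrow> \<bar>c\<bar> < d1 \<Longrightarrow>
      \<bar>I (patch (ball x r) (\<lambda>z. \<phi> z + c) u) x - I (patch (ball x0 r) \<phi> u) x0\<bar> < \<gamma> / 2"
    using sup_patch_continuous[OF C N(1) Nb r perron_continuous m, of "\<gamma> / 2"] g by auto
  have "continuous_on N (\<lambda>x. f x - \<mu> * \<phi> x)"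
    by (intro continuous_intros Ck_closure_continuous_on[OF C] continuous_on_subset[OF f N(2)])
  moreover have "x0 \<in> N" using r by auto
  ultimately obtain d2 where d2: "0 < d2" "\<And>x. x \<in> N \<Longrightarrow> dist x x0 < d2 \<Longrightarrow>
      dist (f x - \<mu> * \<phi> x) (f x0 - \<mu> * \<phi> x0) < \<gamma> / 4"
    using g unfolding continuous_on_iff by (metis divide_pos_pos zero_less_numeral)
  define d3 where "d3 = (\<gamma> / 4) / (\<bar>\<mu>\<bar> + 1)"
  have d3: "0 < d3" using g by (simp add: d3_def)
  have mc: "\<bar>\<mu> * c\<bar> \<le> \<gamma> / 4" if "\<bar>c\<bar> < d3" for c
  proof -
    have "\<bar>\<mu> * c\<bar> \<le> (\<bar>\<mu>\<bar> + 1) * d3" using that unfolding abs_mult by (intro mult_mono) auto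
    also have "\<dots> = \<gamma> / 4"
    proof -
      have "\<bar>\<mu>\<bar> + 1 \<noteq> 0" using abs_ge_zero[of \<mu>] by linarith
      from nonzero_eq_divide_eq[OF this] d3_def show ?thesis by (simp only: mult.commute)
    qed
    finally show ?thesis .
  qed
  show thesis
  proof (rule that[of "min d1 (min d2 d3)"])
    show "0 < min d1 (min d2 d3)" using d1 d2 d3 by simp
    fix x c
    show "\<bar>I (patch (ball x r) (\<lambda>z. \<phi> z + c) u) x - I (patch (ball x0 r) \<phi> u) x0\<bar> < \<gamma> / 2"
      if "dist x x0 < min d1 (min d2 d3)" "\<bar>c\<bar> < min d1 (min d2 d3)"
      using that by (intro d1(2)) auto
    assume *: "x \<in> N" "dist x x0 < min d1 (min d2 d3)" "\<bar>c\<bar> < min d1 (min d2 d3)"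
    have "\<bar>(f x - \<mu> * \<phi> x) - (f x0 - \<mu> * \<phi> x0)\<bar> < \<gamma> / 4"
      using d2(2)[of x] * by (simp add: dist_real_def)
    moreover have "\<bar>\<mu> * c\<bar> \<le> \<gamma> / 4" using * by (intro mc) auto
    moreover have "f x - \<mu> * (\<phi> x + c) = (f x - \<mu> * \<phi> x) - \<mu> * c" by (simp add: algebra_simps)
    ultimately show "\<bar>(f x - \<mu> * (\<phi> x + c)) - (f x0 - \<mu> * \<phi> x0)\<bar> < \<gamma> / 2" by linarith
  qed
qed

lemma ball_in_cball_double:
  fixes x x0 :: 'a
  assumes "dist x x0 \<le> r"
  shows "ball x r \<subseteq> cball x0 (2 * r)"
proof
  fix z assume "z \<in> ball x r"
  then show "z \<in> cball x0 (2 * r)" using dist_triangle[of x0 z x] assms by (simp add: dist_commute)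
qed

text \<open>A competitor close to \<open>u\<close> at \<open>x0\<close> is touched from above, near
  \<open>x0\<close>, by a small shift of \<open>\<phi>\<close>. Replacing the competitor by
  \<open>u\<close> outside the ball only raises the operator, so a failure with a margin would
  contradict the competitor's own inequality.\<close>

lemma perron_subsolution: "visc_ge I \<Omega> u (\<lambda>x. f x - \<mu> * u x)"
proof (rule visc_geI[OF bd perron_continuous])
  fix x0 N and \<phi> :: "'a \<Rightarrow> real"
  assume x0: "x0 \<in> \<Omega>" and N: "open N" "x0 \<in> N" "N \<subseteq> \<Omega>" and C: "Ck_closure 2 N \<phi>"
    and m: "\<phi> \<in> borel_measurable borel" and \<phi>0: "\<phi> x0 = u x0"
    and touch: "\<And>x. x \<in> N \<Longrightarrow> x \<noteq> x0 \<Longrightarrow> u x < \<phi> x"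
  obtain r' where r': "r' > 0" "cball x0 r' \<subseteq> N" using N(1,2) open_contains_cball_eq by metis
  define r where "r = r' / 2"
  have r: "r > 0" "cball x0 (2 * r) \<subseteq> N" using r' by (auto simp: r_def)
  define K where "K = cball x0 (2 * r)"
  have K: "compact K" "x0 \<in> K" "K \<subseteq> N" using r by (auto simp: K_def)
  have r0: "ball x0 r \<subseteq> N" using ball_in_cball_double[of x0 x0 r] r by auto
  have phic: "continuous_on K \<phi>" using continuous_on_subset[OF Ck_closure_continuous_on[OF C] K(3)] .
  have "f x0 - \<mu> * u x0 \<le> I (patch (ball x0 r) \<phi> u) x0"
  proof (rule ccontr)
    assume n: "\<not> ?thesis"
    define \<gamma> where "\<gamma> = f x0 - \<mu> * u x0 - I (patch (ball x0 r) \<phi> u) x0"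
    have \<gamma>: "0 < \<gamma>" using n by (simp add: \<gamma>_def)
    obtain \<delta> where \<delta>: "0 < \<delta>" "\<And>x c. dist x x0 < \<delta> \<Longrightarrow> \<bar>c\<bar> < \<delta> \<Longrightarrow>
      \<bar>I (patch (ball x r) (\<lambda>z. \<phi> z + c) u) x - I (patch (ball x0 r) \<phi> u) x0\<bar> < \<gamma> / 2"
    "\<And>x c. x \<in> N \<Longrightarrow> dist x x0 < \<delta> \<Longrightarrow> \<bar>c\<bar> < \<delta> \<Longrightarrow>
      \<bar>(f x - \<mu> * (\<phi> x + c)) - (f x0 - \<mu> * \<phi> x0)\<bar> < \<gamma> / 2"
      using test_perturbation[OF x0 C N(1,3) r m \<gamma>] by metis
    have hc: "continuous_on K (\<lambda>x. \<phi> x - u x)"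
      by (intro continuous_on_diff phic bounded_continuous_cont perron_continuous)
    have hp: "0 < \<phi> x - u x" if "x \<in> K" "x \<noteq> x0" for x using touch[of x] that K by auto
    have mr: "0 < min \<delta> r" using \<delta> r by simp
    obtain k where k: "0 < k" "\<And>x. x \<in> K \<Longrightarrow> \<phi> x - u x < k \<Longrightarrow> dist x x0 < min \<delta> r"
      using strict_minimum_stable[OF K(1) hc hp mr] by blast
    \<comment> \<open>Closeness within \<open>k\<close> puts the new touching point near
      \<open>x0\<close>; closeness within \<open>\<delta>\<close> makes the shift small
      enough.\<close>
    obtain w where w: "w \<in> subsolutions" "u x0 - min k \<delta> < w x0"
      by (rule perron_approx[of "u x0 - min k \<delta>" x0]) (use k \<delta> in auto)
    note wD = subsolutionsD[OF w(1)]
    have "continuous_on K (\<lambda>x. \<phi> x - w x)"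
      by (intro continuous_on_diff phic bounded_continuous_cont wD(1))
    then obtain x1 where x1: "x1 \<in> K" "\<And>x. x \<in> K \<Longrightarrow> \<phi> x1 - w x1 \<le> \<phi> x - w x"
      using continuous_attains_inf[OF K(1), of "\<lambda>x. \<phi> x - w x"] K(2) by blast
    define c where "c = w x1 - \<phi> x1"
    have wu: "w x \<le> u x" for x by (rule perron_upper[OF w(1)])
    have "u x1 \<le> \<phi> x1" using hp[OF x1(1)] \<phi>0 by (cases "x1 = x0") auto
    then have c0: "c \<le> 0" using wu[of x1] by (simp add: c_def)
    have cm: "- c < min k \<delta>" using x1(2)[OF K(2)] w(2) \<phi>0 unfolding c_def by linarith
    have "\<phi> x1 - u x1 < k" using wu[of x1] cm by (simp add: c_def)
    then have d: "dist x1 x0 < \<delta>" "dist x1 x0 < r" using k(2)[OF x1(1)] by auto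
    have ca: "\<bar>c\<bar> < \<delta>" using c0 cm by simp
    have bK: "ball x1 r \<subseteq> K" using ball_in_cball_double[of x1 x0 r] d by (simp add: K_def)
    have Cc: "Ck_closure 2 (ball x1 r) (\<lambda>z. \<phi> z + c)"
      using bK K(3) by (intro Ck_closure_add Ck_closure_const Ck_closure_subset[OF C]) auto
    have "f x1 - \<mu> * w x1 \<le> I (patch (ball x1 r) (\<lambda>z. \<phi> z + c) w) x1"
    proof (rule visc_geD[OF wD(4,1) r(1) _ Cc])
      show "ball x1 r \<subseteq> \<Omega>" using bK K N by blast
      show "w x \<le> \<phi> x + c" if "x \<in> ball x1 r" for x using x1(2)[of x] that bK by (auto simp: c_def)
    qed (simp add: c_def)
    also have "\<dots> \<le> I (patch (ball x1 r) (\<lambda>z. \<phi> z + c) u) x1"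
      using r by (intro sup_patch_mono Cc wD(1) perron_continuous wu) auto
    also have "\<dots> < I (patch (ball x0 r) \<phi> u) x0 + \<gamma> / 2" using \<delta>(2)[OF d(1) ca] by linarith
    finally have "f x1 - \<mu> * (\<phi> x1 + c) < I (patch (ball x0 r) \<phi> u) x0 + \<gamma> / 2" by (simp add: c_def)
    moreover have "\<bar>(f x1 - \<mu> * (\<phi> x1 + c)) - (f x0 - \<mu> * \<phi> x0)\<bar> < \<gamma> / 2"
      using x1(1) K(3) by (intro \<delta>(3) d ca) auto
    moreover have "f x0 - \<mu> * \<phi> x0 = I (patch (ball x0 r) \<phi> u) x0 + \<gamma>" by (simp add: \<gamma>_def \<phi>0)
    ultimately show False by linarith
  qed
  then show "\<exists>r>0. ball x0 r \<subseteq> N \<and> f x0 - \<mu> * u x0 \<le> I (patch (ball x0 r) \<phi> u) x0"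
    using r r0 by blast
qed

text \<open>If the inequality failed, raising \<open>u\<close> to \<open>\<phi> + c\<close> near
  \<open>x0\<close> would give a larger competitor. Where \<open>u\<close> equals \<open>W\<close>
  there is no room for this, but then \<open>\<phi>\<close> touches \<open>W\<close> itself, whose
  supersolution property decides.\<close>

lemma perron_supersolution: "visc_le I \<Omega> u (\<lambda>x. f x - \<mu> * u x)"
proof (rule visc_leI[OF bd perron_continuous])
  fix x0 N and \<phi> :: "'a \<Rightarrow> real"
  assume x0: "x0 \<in> \<Omega>" and N: "open N" "x0 \<in> N" "N \<subseteq> \<Omega>" and C: "Ck_closure 2 N \<phi>"
    and m: "\<phi> \<in> borel_measurable borel" and \<phi>0: "\<phi> x0 = u x0"
    and touch: "\<And>x. x \<in> N \<Longrightarrow> x \<noteq> x0 \<Longrightarrow> \<phi> x < u x"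
  obtain r' where r': "r' > 0" "cball x0 r' \<subseteq> N" using N(1,2) open_contains_cball_eq by metis
  define r where "r = r' / 2"
  have r: "r > 0" "cball x0 (2 * r) \<subseteq> N" using r' by (auto simp: r_def)
  define K where "K = cball x0 (2 * r)"
  have K: "compact K" "x0 \<in> K" "K \<subseteq> N" using r by (auto simp: K_def)
  have r0: "ball x0 r \<subseteq> N" using ball_in_cball_double[of x0 x0 r] r by auto
  have phic: "continuous_on K \<phi>" using continuous_on_subset[OF Ck_closure_continuous_on[OF C] K(3)] .
  have ple: "\<phi> x \<le> u x" if "x \<in> N" for x using touch[OF that] \<phi>0 by (cases "x = x0") auto
  have C0: "Ck_closure 2 (ball x0 r) \<phi>" using r0 by (intro Ck_closure_subset[OF C]) auto
  have "I (patch (ball x0 r) \<phi> u) x0 \<le> f x0 - \<mu> * u x0"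
  proof (cases "u x0 = W x0")
    case True
    have "I (patch (ball x0 r) \<phi> u) x0 \<le> I (patch (ball x0 r) \<phi> W) x0"
      using r by (intro sup_patch_mono C0 perron_continuous W(1) perron_bounds(2)) auto
    also have "\<dots> \<le> f x0 - \<mu> * W x0"
    proof (rule sup_le, rule visc_leD[OF W(4) bd W(1) r(1) _ C0])
      show "ball x0 r \<subseteq> \<Omega>" using r0 N by blast
      show "\<phi> x \<le> W x" if "x \<in> ball x0 r" for x
        using ple[of x] perron_bounds(2)[of x] that r0 by (meson order_trans subset_iff)
    qed (use \<phi>0 True in auto)
    finally show ?thesis using True by simp
  next
    case False
    show ?thesis
    proof (rule ccontr)
      assume n: "\<not> ?thesis"
      define \<gamma> where "\<gamma> = I (patch (ball x0 r) \<phi> u) x0 - (f x0 - \<mu> * u x0)"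
      have \<gamma>: "0 < \<gamma>" using n by (simp add: \<gamma>_def)
      obtain \<delta> where \<delta>: "0 < \<delta>" "\<And>x c. dist x x0 < \<delta> \<Longrightarrow> \<bar>c\<bar> < \<delta> \<Longrightarrow>
        \<bar>I (patch (ball x r) (\<lambda>z. \<phi> z + c) u) x - I (patch (ball x0 r) \<phi> u) x0\<bar> < \<gamma> / 2"
      "\<And>x c. x \<in> N \<Longrightarrow> dist x x0 < \<delta> \<Longrightarrow> \<bar>c\<bar> < \<delta> \<Longrightarrow>
        \<bar>(f x - \<mu> * (\<phi> x + c)) - (f x0 - \<mu> * \<phi> x0)\<bar> < \<gamma> / 2"
        using test_perturbation[OF x0 C N(1,3) r m \<gamma>] by metis
      define q where "q = W x0 - u x0"
      have q: "0 < q" using perron_bounds(2)[of x0] False by (simp add: q_def)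
      have "continuous_on K (\<lambda>x. W x - \<phi> x)"
        by (intro continuous_on_diff phic bounded_continuous_cont W(1))
      then obtain d2 where d2: "0 < d2" "\<And>x. x \<in> K \<Longrightarrow> dist x x0 < d2 \<Longrightarrow>
          dist (W x - \<phi> x) (W x0 - \<phi> x0) < q / 2"
        using q K(2) unfolding continuous_on_iff by (metis half_gt_zero)
      define e where "e = min \<delta> (min d2 r)"
      have e: "0 < e" "e \<le> \<delta>" "e \<le> d2" "e \<le> r" using \<delta> d2 r by (auto simp: e_def)
      have hc: "continuous_on K (\<lambda>x. u x - \<phi> x)"
        by (intro continuous_on_diff phic bounded_continuous_cont perron_continuous)
      have hp: "0 < u x - \<phi> x" if "x \<in> K" "x \<noteq> x0" for x using touch[of x] that K by auto
      obtain k where k: "0 < k" "\<And>x. x \<in> K \<Longrightarrow> u x - \<phi> x < k \<Longrightarrow> dist x x0 < e"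
        using strict_minimum_stable[OF K(1) hc hp e(1)] by blast
      \<comment> \<open>\<open>k / 2\<close> confines the raised region to distance below
        \<open>e\<close>, \<open>q / 2\<close> keeps the result below \<open>W\<close>, and
        \<open>\<delta> / 2\<close> keeps the shift within the perturbation estimate.\<close>
      define c where "c = min (k / 2) (min (q / 2) (\<delta> / 2))"
      have "c \<le> k / 2" "c \<le> q / 2" "c \<le> \<delta> / 2" by (simp_all add: c_def)
      moreover have c0: "0 < c" using k q \<delta> by (simp add: c_def)
      ultimately have c: "0 < c" "c < k" "c \<le> q / 2" "\<bar>c\<bar> < \<delta>" using k q \<delta> by linarith+
      have near: "dist x x0 < e" if "x \<in> K" "u x < \<phi> x + c" for x
        using that c by (intro k(2)) auto
      \<comment> \<open>The raised region ends before the sphere of radius \<open>r\<close>, since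
        \<open>e \<le> r\<close>; on the sphere the maximum is \<open>u\<close>, so the branches fit
        continuously.\<close>
      define w where "w x = (if x \<in> cball x0 r then max (u x) (\<phi> x + c) else u x)" for x
      have wK: "\<phi> x + c \<le> w x" if "x \<in> K" for x
      proof (cases "x \<in> cball x0 r")
        case False
        then have "\<not> dist x x0 < e" using e by (simp add: dist_commute)
        then show ?thesis using near[OF that] False by (force simp: w_def)
      qed (simp add: w_def)
      have wu: "u x \<le> w x" for x by (simp add: w_def)
      have w_cases: "w x = u x \<or> (x \<in> K \<and> dist x x0 < e \<and> w x = \<phi> x + c \<and> u x < \<phi> x + c)" for x
      proof (cases "x \<in> cball x0 r \<and> u x < \<phi> x + c")
        case True
        then have "x \<in> K" using r by (auto simp: K_def)
        then show ?thesis using True near[of x] by (simp add: w_def)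
      next
        case False
        then show ?thesis by (auto simp: w_def)
      qed
      have wc: "continuous_on UNIV w"
      proof -
        have "continuous_on (cball x0 r \<union> - ball x0 r) w"
          unfolding w_def[abs_def]
        proof (rule continuous_on_cases)
          have sub: "cball x0 r \<subseteq> K" using r by (auto simp: K_def)
          show "continuous_on (cball x0 r) (\<lambda>x. max (u x) (\<phi> x + c))"
            by (intro continuous_on_max continuous_on_add continuous_on_const continuous_on_subset[OF phic sub]
                bounded_continuous_cont[OF perron_continuous])
          show "continuous_on (- ball x0 r) u" by (rule bounded_continuous_cont[OF perron_continuous])
          show "\<forall>x. x \<in> cball x0 r \<and> x \<notin> cball x0 r \<or> x \<in> - ball x0 r \<and> x \<in> cball x0 r \<longrightarrow> max (u x) (\<phi> x + c) = u x"
          proof (intro allI impI)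
            fix x assume "x \<in> cball x0 r \<and> x \<notin> cball x0 r \<or> x \<in> - ball x0 r \<and> x \<in> cball x0 r"
            then have x: "x \<in> - ball x0 r" "x \<in> cball x0 r" by auto
            then have "x \<in> K" "\<not> dist x x0 < e" using sub e by (auto simp: dist_commute)
            then have "\<not> u x < \<phi> x + c" using near by blast
            then show "max (u x) (\<phi> x + c) = u x" by simp
          qed
        qed auto
        moreover have "cball x0 r \<union> - ball x0 r = UNIV" by auto
        ultimately show ?thesis by simp
      qed
      have wW: "w x \<le> W x" for x
      proof (cases "w x = u x")
        case True
        then show ?thesis using perron_bounds(2)[of x] by simp
      next
        case False
        then have *: "x \<in> K" "dist x x0 < e" "w x = \<phi> x + c" using w_cases[of x] by auto
        have "dist (W x - \<phi> x) (W x0 - \<phi> x0) < q / 2" using * e by (intro d2(2)) auto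
        then have "W x0 - \<phi> x0 - (W x - \<phi> x) < q / 2" by (simp only: dist_real_def abs_less_iff minus_diff_eq)
        then have "q / 2 < W x - \<phi> x" using \<phi>0 by (simp add: q_def)
        then show ?thesis using * c by linarith
      qed
      have wlo: "- W x \<le> w x" for x using perron_bounds(1)[of x] wu[of x] by linarith
      have wbc: "bounded_continuous w" by (rule bounded_continuous_between[OF wc W(1) wlo wW])
      have "visc_ge I \<Omega> w (\<lambda>x. f x - \<mu> * w x)"
      proof (rule visc_geI[OF bd wbc])
        fix x1 M and \<theta> :: "'a \<Rightarrow> real"
        assume x1: "x1 \<in> \<Omega>" and M: "open M" "x1 \<in> M" "M \<subseteq> \<Omega>" and CX: "Ck_closure 2 M \<theta>"
          and \<theta>0: "\<theta> x1 = w x1" and tX: "\<And>x. x \<in> M \<Longrightarrow> x \<noteq> x1 \<Longrightarrow> w x < \<theta> x"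
        obtain \<rho> where \<rho>: "0 < \<rho>" "ball x1 \<rho> \<subseteq> M" using M open_contains_ball_eq by metis
        have CX1: "Ck_closure 2 (ball x1 \<rho>) \<theta>" using \<rho> by (intro Ck_closure_subset[OF CX]) auto
        have wX: "w x \<le> \<theta> x" if "x \<in> ball x1 \<rho>" for x
          using tX[of x] that \<rho> \<theta>0 by (cases "x = x1") (auto intro: less_imp_le)
        have jw: "jump_integrable s (patch (ball x1 \<rho>) \<theta> w) x1"
          using \<rho> by (intro jump_integrable_patch CX1 wbc) auto
        have "f x1 - \<mu> * w x1 \<le> I (patch (ball x1 \<rho>) \<theta> w) x1"
          using w_cases[of x1]
        proof
          assume eq: "w x1 = u x1"
          have "f x1 - \<mu> * u x1 \<le> I (patch (ball x1 \<rho>) \<theta> u) x1"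
            by (rule visc_geD[OF perron_subsolution perron_continuous \<rho>(1) _ CX1])
              (use \<rho> M \<theta>0 eq wX order_trans[OF wu] in auto)
          also have "\<dots> \<le> I (patch (ball x1 \<rho>) \<theta> w) x1"
            using \<rho> by (intro sup_patch_mono CX1 perron_continuous wbc wu) auto
          finally show ?thesis using eq by simp
        next
          \<comment> \<open>At a raised point the margin gives the inequality for
            \<open>\<phi> + c\<close> patched into \<open>u\<close>. The patch of
            \<open>\<theta>\<close> into \<open>w\<close> dominates this function everywhere and
            equals it at \<open>x1\<close>, so its operator value is at least as large.\<close>
          assume *: "x1 \<in> K \<and> dist x1 x0 < e \<and> w x1 = \<phi> x1 + c \<and> u x1 < \<phi> x1 + c"
          then have d: "dist x1 x0 < \<delta>" "dist x1 x0 < r" using e by auto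
          have bK: "ball x1 r \<subseteq> K" using ball_in_cball_double[of x1 x0 r] d by (simp add: K_def)
          have Cc: "Ck_closure 2 (ball x1 r) (\<lambda>z. \<phi> z + c)"
            using bK K(3) by (intro Ck_closure_add Ck_closure_const Ck_closure_subset[OF C]) auto
          have "\<bar>(f x1 - \<mu> * (\<phi> x1 + c)) - (f x0 - \<mu> * \<phi> x0)\<bar> < \<gamma> / 2"
            using * K(3) by (intro \<delta>(3) d c) auto
          moreover have "I (patch (ball x0 r) \<phi> u) x0 = f x0 - \<mu> * \<phi> x0 + \<gamma>" by (simp add: \<gamma>_def \<phi>0)
          ultimately have "f x1 - \<mu> * (\<phi> x1 + c) \<le> I (patch (ball x1 r) (\<lambda>z. \<phi> z + c) u) x1"
            using \<delta>(2)[OF d(1) c(4)] by linarith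
          also have "\<dots> \<le> I (patch (ball x1 \<rho>) \<theta> w) x1"
          proof (rule sup_mono[OF _ jw])
            show "jump_integrable s (patch (ball x1 r) (\<lambda>z. \<phi> z + c) u) x1"
              using r by (intro jump_integrable_patch Cc perron_continuous) auto
            have le: "patch (ball x1 r) (\<lambda>z. \<phi> z + c) u z \<le> patch (ball x1 \<rho>) \<theta> w z" for z
            proof -
              have "patch (ball x1 r) (\<lambda>z. \<phi> z + c) u z \<le> w z"
              proof (cases "z \<in> ball x1 r")
                case True
                then have "\<phi> z + c \<le> w z" using bK by (intro wK) blast
                then show ?thesis using True by simp
              next
                case False
                then show ?thesis using wu[of z] by simp
              qed
              also have "w z \<le> patch (ball x1 \<rho>) \<theta> w z" using wX[of z] by (simp add: patch_def)
              finally show ?thesis .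
            qed
            have "patch (ball x1 r) (\<lambda>z. \<phi> z + c) u x1 = patch (ball x1 \<rho>) \<theta> w x1"
              using r \<rho> \<theta>0 * by simp
            with add_mono[OF le le]
            show "second_diff (patch (ball x1 r) (\<lambda>z. \<phi> z + c) u) x1 y \<le> second_diff (patch (ball x1 \<rho>) \<theta> w) x1 y" for y
              unfolding second_diff_def by simp
          qed
          finally show ?thesis using * by simp
        qed
        then show "\<exists>r>0. ball x1 r \<subseteq> M \<and> f x1 - \<mu> * w x1 \<le> I (patch (ball x1 r) \<theta> w) x1"
          using \<rho> by blast
      qed
      then have "w \<in> subsolutions" using wc wlo wW by (simp add: subsolutions_def)
      then have "w x0 \<le> u x0" by (rule perron_upper)
      moreover have "\<phi> x0 + c \<le> w x0" by (rule wK[OF K(2)])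
      ultimately show False using \<phi>0 c by simp
    qed
  qed
  then show "\<exists>r>0. ball x0 r \<subseteq> N \<and> I (patch (ball x0 r) \<phi> u) x0 \<le> f x0 - \<mu> * u x0"
    using r r0 by blast
qed

end

theorem theorem1p7:
  fixes \<Omega> :: "'a::euclidean_space set"
    and \<L> :: "(('a \<Rightarrow> real) \<Rightarrow> 'a \<Rightarrow> real) set"
    and s lam Lam \<mu> :: real
    and f :: "'a \<Rightarrow> real"
  assumes "0 < s" and "s < 1"
    and "0 < lam" and "lam \<le> Lam"
    and "\<L> \<subseteq> L_star s lam Lam" and "\<L> \<noteq> {}"
    and "smooth_domain \<Omega>" and "bounded \<Omega>"
    and "continuous_on (closure \<Omega>) f"
    and "ereal \<mu> < Lambda_plus s \<L> \<Omega>"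
  shows "\<exists>!u. continuous_on UNIV u \<and>
           visc_eq (sup_operator \<L>) \<Omega> u (\<lambda>x. f x - \<mu> * u x) \<and>
           (\<forall>x\<in>-\<Omega>. u x = 0)"
proof -
  interpret jump_class s lam Lam \<L>
    using assms(1-6) by unfold_locales auto
  have op: "open \<Omega>" and sb: "smooth_boundary \<Omega>" using assms(7) by (auto simp: smooth_domain_def)
  note bd = assms(8)
  have f: "continuous_on \<Omega> f" by (rule continuous_on_subset[OF assms(9) closure_subset])
  have cc: "compact (closure \<Omega>)" using bd by simp
  have uf: "uniformly_continuous_on \<Omega> f"
    using compact_uniformly_continuous[OF assms(9) cc] closure_subset[of \<Omega>]
    unfolding uniformly_continuous_on_def by (meson subset_iff)
  have "bounded (f ` closure \<Omega>)"
    by (intro compact_imp_bounded compact_continuous_image assms(9) cc)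
  then obtain F where "\<And>x. x \<in> closure \<Omega> \<Longrightarrow> \<bar>f x\<bar> \<le> F" unfolding bounded_iff by auto
  then have F: "\<bar>f x\<bar> \<le> \<bar>F\<bar> + 1" if "x \<in> \<Omega>" for x
    using that closure_subset[of \<Omega>] abs_ge_self[of F] by fastforce
  obtain V W1 where V: "bounded_continuous V" "\<And>x. 1 \<le> V x" "visc_le I \<Omega> V (\<lambda>x. - 1 - \<mu> * V x)" and
    W1: "bounded_continuous W1" "\<And>x. 0 \<le> W1 x" "\<And>x. x \<notin> \<Omega> \<Longrightarrow> W1 x = 0" "visc_le I \<Omega> W1 (\<lambda>x. - 1 - \<mu> * W1 x)"
    using strict_supersolution[OF op bd sb assms(10)] by blast
  \<comment> \<open>The factor turns the right-hand side into \<open>- (\<bar>F\<bar> + 1)\<close>,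
    which lies below \<open>f\<close> while its negative lies above; so \<open>W\<close> and
    \<open>- W\<close> are a super- and a subsolution.\<close>
  define W where "W x = (\<bar>F\<bar> + 1) * W1 x" for x
  have W: "bounded_continuous W" unfolding W_def[abs_def] by (rule bounded_continuous_cmult[OF W1(1)])
  have Wv: "visc_le I \<Omega> W (\<lambda>x. (\<bar>F\<bar> + 1) * (- 1 - \<mu> * W1 x))"
    unfolding W_def[abs_def] by (rule visc_le_cmult[OF bd W1(1,4)]) simp
  have eq: "(\<bar>F\<bar> + 1) * (- 1 - \<mu> * W1 x) = - (\<bar>F\<bar> + 1) - \<mu> * W x" for x
    by (simp add: W_def algebra_simps)
  interpret perron s lam Lam \<L> \<Omega> f V W \<mu>
  proof unfold_locales
    show "visc_le I \<Omega> W (\<lambda>x. f x - \<mu> * W x)"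
    proof (rule visc_le_mono[OF Wv])
      show "(\<bar>F\<bar> + 1) * (- 1 - \<mu> * W1 x) \<le> f x - \<mu> * W x" if "x \<in> \<Omega>" for x
        using F[OF that] unfolding eq by linarith
    qed
    show "visc_ge I \<Omega> (\<lambda>x. - W x) (\<lambda>x. f x - \<mu> * - W x)"
    proof (rule visc_ge_mono[OF visc_ge_uminus[OF bd W Wv]])
      show "f x - \<mu> * - W x \<le> - ((\<bar>F\<bar> + 1) * (- 1 - \<mu> * W1 x))" if "x \<in> \<Omega>" for x
        using F[OF that] unfolding eq by simp
    qed
  qed (use op bd f uf V W W1 in \<open>auto simp: W_def\<close>)
  show ?thesis
  proof (rule ex1I[of _ perron_solution])
    show "continuous_on UNIV perron_solution \<and> visc_eq I \<Omega> perron_solution (\<lambda>x. f x - \<mu> * perron_solution x) \<and>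
       (\<forall>x\<in>-\<Omega>. perron_solution x = 0)"
      using bounded_continuous_cont[OF perron_continuous] perron_subsolution perron_supersolution perron_outside
      by (auto simp: visc_eq_def)
  next
    fix v assume v: "continuous_on UNIV v \<and> visc_eq I \<Omega> v (\<lambda>x. f x - \<mu> * v x) \<and> (\<forall>x\<in>-\<Omega>. v x = 0)"
    \<comment> \<open>Any other solution is continuous and vanishes outside a bounded set, hence
      bounded, as the comparison requires.\<close>
    have vb: "bounded_continuous v" using v by (intro bounded_continuous_support[OF _ bd]) auto
    have vge: "visc_ge I \<Omega> v (\<lambda>x. f x - \<mu> * v x)" and vle: "visc_le I \<Omega> v (\<lambda>x. f x - \<mu> * v x)"
      using v by (simp_all add: visc_eq_def)
    have out: "v x = perron_solution x" if "x \<notin> \<Omega>" for x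
      using v that perron_outside by simp
    show "v = perron_solution"
    proof (rule ext, rule antisym)
      show "v x \<le> perron_solution x" for x
        by (rule visc_comparison[OF bd op vb perron_continuous V f vge perron_supersolution]) (simp add: out)
      show "perron_solution x \<le> v x" for x
        by (rule visc_comparison[OF bd op perron_continuous vb V f perron_subsolution vle]) (simp add: out)
    qed
  qed
qed

end
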